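(* Let $n\ge 16$. There is a one-to-one correspondence between the moduli space $\mathcal M_n$ of $\mathbb Z_{>0}$-filtered deformations of $\mathcal V_n$ (the set of isomorphism classes of Lie algebras $(\mathcal V_n,[\,,]+\Psi)$, $\Psi$ a $\mathbb Z_{>0}$-filtered deformation of $\mathcal V_n$) and the orbit space of the action $\tilde\rho_n$ of $\mathbb K^*$ on $\mathbb K^5$ defined by $$\tilde\rho_n(\alpha)(x_1,x_2,x_3,x_4,x_5)=(\alpha^{n-11}x_1,\alpha^{n-10}x_2,\alpha^{n-9}x_3,\alpha^{n-8}x_4,\alpha^{n-7}x_5),\qquad \alpha\in\mathbb K^*,$$ where the orbit of $(x_1,\dots,x_5)$ corresponds to the isomorphism class of the Lie algebra $(\mathcal V_n,[\,,]+\Psi)$ with $\Psi=x_1\psi_{n,11}+x_2\psi_{n,10}+x_3\psi_{n,9}+x_4\psi_{n,8}+x_5\psi_{n,7}$.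
   Context: $\mathbb K$ is a field of characteristic zero. $\mathcal V_n$ is the Lie algebra over $\mathbb K$ with basis $e_1,\dots,e_n$ and $[e_i,e_j]=(j-i)e_{i+j}$ if $i+j\le n$, $[e_i,e_j]=0$ if $i+j>n$. A $\mathbb Z_{>0}$-filtered deformation of $\mathcal V_n$ is a skew-symmetric bilinear map $\Psi:\mathcal V_n\times\mathcal V_n\to\mathcal V_n$ of the form $\Psi=\sum_{l\ge1}\Psi_l$ with $\Psi_l(e_i,e_j)=c_{ij}^l e_{i+j+l}$ for $i+j+l\le n$ and $\Psi_l(e_i,e_j)=0$ otherwise ($c_{ij}^l\in\mathbb K$), such that $[\,,]+\Psi$ is a Lie bracket on the vector space $\mathcal V_n$. Let $e^1,\dots,e^n$ be the dual basis; for $a\in\mathcal V_n$, $a\otimes(e^p\wedge e^q)$ denotes the skew bilinear map $(x,y)\mapsto (e^p(x)e^q(y)-e^p(y)e^q(x))\,a$. Put $\xi_0=e^2\wedge e^5-3e^3\wedge e^4$, $\xi_1(j)=\frac{j-1}{2}(e^2\wedge e^6-2e^3\wedge e^5)$, $\xi_2(j)=P_1(j)e^2\wedge e^7+P_2(j)e^3\wedge e^6+P_3(j)e^4\wedge e^5$, $\xi_3(j)=Q_1(j)e^2\wedge e^8+Q_2(j)e^3\wedge e^7+Q_3(j)e^4\wedge e^6$, $\xi_4(j)=Z_1(j)e^2\wedge e^9+Z_2(j)e^3\wedge e^8+Z_3(j)e^4\wedge e^7+Z_4(j)e^5\wedge e^6$, where $P_1(j)=\frac{1}{21}\left(5\binom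 j2+3j-6\right)$, $P_2(j)=-\frac1{21}\left(4\binom j2+15j-30\right)$, $P_3(j)=-\frac1{21}\left(13\binom j2-30j+60\right)$; $Q_1(j)=\frac1{28}\left(3\binom{j+1}3+4\binom{j+1}2-4(j+1)\right)$, $Q_2(j)=\frac1{14}\left(\binom{j+1}3-8\binom{j+1}2+8(j+1)\right)$, $Q_3(j)=\frac1{28}\left(-13\binom{j+1}3+20\binom{j+1}2-20(j+1)\right)$; $Z_1(j)=\frac1{22}\binom{j+2}4+\frac{23}{231}\binom{j+2}3-\frac7{198}\binom{j+2}2-\frac{59}{693}(j+2)+\frac{37}{231}$, $Z_2(j)=\frac{17}{154}\binom{j+2}4-\frac{62}{231}\binom{j+2}3-\frac{53}{1386}\binom{j+2}2+\frac{59}{99}(j+2)-\frac{37}{33}$, $Z_3(j)=-\frac{29}{154}\binom{j+2}4-\frac4{77}\binom{j+2}3+\frac{317}{462}\binom{j+2}2-\frac{59}{33}(j+2)+\frac{37}{11}$, $Z_4(j)=-\frac{47}{154}\binom{j+2}4+\frac{185}{231}\binom{j+2}3-\frac{2245}{1386}\binom{j+2}2+\frac{295}{99}(j+2)-\frac{185}{33}$. The basic cocycles are $\psi_{n,7+s}=e_{n-s}\otimes\xi_0+\sum_{p=1}^{s}e_{n-s+p}\otimes\xi_p(n-s)$ for $s=0,1,2,3,4$. *)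

theory Defs
  imports Complex_Main "HOL-Library.Function_Algebras"
begin

text \<open>
  The vector space with basis \<open>e\<^sub>1, \<dots>, e\<^sub>n\<close> consists of the coordinate functions
  \<open>nat \<Rightarrow> 'k\<close> that vanish outside \<open>{1..n}\<close>, with the pointwise addition; the value \<open>x p\<close>
  is the dual basis vector \<open>e\<^sup>p\<close> evaluated at \<open>x\<close>. Maps on this space are total HOL functions of which
  only the restriction to the carrier is relevant; all notions below look at that restriction only.
\<close>

type_synonym 'k vect = "nat \<Rightarrow> 'k"
type_synonym 'k bimap = "'k vect \<Rightarrow> 'k vect \<Rightarrow> 'k vect"

definition V :: "nat \<Rightarrow> ('k::field) vect set" where
  "V n = {x. \<forall>k. k \<notin> {1..n} \<longrightarrow> x k = 0}"

definition scale :: "'k::field \<Rightarrow> 'k vect \<Rightarrow> 'k vect"  (infixr "*\<^sub>V" 75) where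
  "c *\<^sub>V x = (\<lambda>k. c * x k)"

definition e :: "nat \<Rightarrow> ('k::field) vect" where
  "e i = (\<lambda>k. if k = i then 1 else 0)"

definition linear_map :: "nat \<Rightarrow> (('k::field) vect \<Rightarrow> 'k vect) \<Rightarrow> bool" where
  "linear_map n f \<longleftrightarrow>
     (\<forall>x\<in>V n. f x \<in> V n) \<and>
     (\<forall>x\<in>V n. \<forall>y\<in>V n. f (x + y) = f x + f y) \<and>
     (\<forall>c. \<forall>x\<in>V n. f (c *\<^sub>V x) = c *\<^sub>V f x)"

definition bilinear_map :: "nat \<Rightarrow> ('k::field) bimap \<Rightarrow> bool" where
  "bilinear_map n B \<longleftrightarrow>
     (\<forall>y\<in>V n. linear_map n (\<lambda>x. B x y)) \<and> (\<forall>x\<in>V n. linear_map n (\<lambda>y. B x y))"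

definition skew_symmetric :: "nat \<Rightarrow> ('k::field) bimap \<Rightarrow> bool" where
  "skew_symmetric n B \<longleftrightarrow> (\<forall>x\<in>V n. \<forall>y\<in>V n. B x y = - B y x)"

definition lie_bracket :: "nat \<Rightarrow> ('k::field) bimap \<Rightarrow> bool" where
  "lie_bracket n B \<longleftrightarrow>
     bilinear_map n B \<and>
     (\<forall>x\<in>V n. B x x = 0) \<and>
     (\<forall>x\<in>V n. \<forall>y\<in>V n. \<forall>z\<in>V n. B x (B y z) + B y (B z x) + B z (B x y) = 0)"

definition lie_isomorphic :: "nat \<Rightarrow> ('k::field) bimap \<Rightarrow> 'k bimap \<Rightarrow> bool" where
  "lie_isomorphic n B B' \<longleftrightarrow>
     (\<exists>f. linear_map n f \<and> bij_betw f (V n) (V n) \<and>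
          (\<forall>x\<in>V n. \<forall>y\<in>V n. f (B x y) = B' (f x) (f y)))"


definition Vbracket :: "nat \<Rightarrow> ('k::field) bimap" where
  "Vbracket n x y =
     (\<Sum>i\<in>{1..n}. \<Sum>j\<in>{1..n}.
        (x i * y j) *\<^sub>V (if i + j \<le> n then (of_nat j - of_nat i) *\<^sub>V e (i + j) else 0))"

definition homogeneous :: "nat \<Rightarrow> nat \<Rightarrow> ('k::field) bimap \<Rightarrow> bool" where
  "homogeneous n l B \<longleftrightarrow>
     bilinear_map n B \<and>
     (\<exists>c. \<forall>i\<in>{1..n}. \<forall>j\<in>{1..n}.
        B (e i) (e j) = (if i + j + l \<le> n then c i j *\<^sub>V e (i + j + l) else 0))"

text \<open>The sum over all \<open>l \<ge> 1\<close> is cut off at \<open>n\<close>: homogeneous maps of degree \<open>l > n\<close> vanish.\<close>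

definition filtered_deformation :: "nat \<Rightarrow> ('k::field) bimap \<Rightarrow> bool" where
  "filtered_deformation n \<Psi> \<longleftrightarrow>
     bilinear_map n \<Psi> \<and> skew_symmetric n \<Psi> \<and>
     (\<exists>\<Psi>l. (\<forall>l\<ge>1. homogeneous n l (\<Psi>l l)) \<and>
           (\<forall>x\<in>V n. \<forall>y\<in>V n. \<Psi> x y = (\<Sum>l\<in>{1..n}. \<Psi>l l x y))) \<and>
     lie_bracket n (Vbracket n + \<Psi>)"

definition deformed_brackets :: "nat \<Rightarrow> ('k::field) bimap set" where
  "deformed_brackets n = {Vbracket n + \<Psi> | \<Psi>. filtered_deformation n \<Psi>}"

definition iso_rel :: "nat \<Rightarrow> (('k::field) bimap \<times> 'k bimap) set" where
  "iso_rel n = {(B, B'). B \<in> deformed_brackets n \<and> B' \<in> deformed_brackets n \<and> lie_isomorphic n B B'}"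

definition moduli_space :: "nat \<Rightarrow> ('k::field) bimap set set" where
  "moduli_space n = deformed_brackets n // iso_rel n"


definition wedge :: "nat \<Rightarrow> nat \<Rightarrow> ('k::field) vect \<Rightarrow> 'k vect \<Rightarrow> 'k" where
  "wedge p q x y = x p * y q - y p * x q"

definition P1 :: "nat \<Rightarrow> 'k::field" where
  "P1 j = 1/21 * (5 * of_nat (j choose 2) + 3 * of_nat j - 6)"
definition P2 :: "nat \<Rightarrow> 'k::field" where
  "P2 j = - (1/21) * (4 * of_nat (j choose 2) + 15 * of_nat j - 30)"
definition P3 :: "nat \<Rightarrow> 'k::field" where
  "P3 j = - (1/21) * (13 * of_nat (j choose 2) - 30 * of_nat j + 60)"

definition Q1 :: "nat \<Rightarrow> 'k::field" where
  "Q1 j = 1/28 * (3 * of_nat ((j+1) choose 3) + 4 * of_nat ((j+1) choose 2) - 4 * of_nat (j+1))"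
definition Q2 :: "nat \<Rightarrow> 'k::field" where
  "Q2 j = 1/14 * (of_nat ((j+1) choose 3) - 8 * of_nat ((j+1) choose 2) + 8 * of_nat (j+1))"
definition Q3 :: "nat \<Rightarrow> 'k::field" where
  "Q3 j = 1/28 * (- 13 * of_nat ((j+1) choose 3) + 20 * of_nat ((j+1) choose 2) - 20 * of_nat (j+1))"

definition Z1 :: "nat \<Rightarrow> 'k::field" where
  "Z1 j = 1/22 * of_nat ((j+2) choose 4) + 23/231 * of_nat ((j+2) choose 3)
        - 7/198 * of_nat ((j+2) choose 2) - 59/693 * of_nat (j+2) + 37/231"
definition Z2 :: "nat \<Rightarrow> 'k::field" where
  "Z2 j = 17/154 * of_nat ((j+2) choose 4) - 62/231 * of_nat ((j+2) choose 3)
        - 53/1386 * of_nat ((j+2) choose 2) + 59/99 * of_nat (j+2) - 37/33"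
definition Z3 :: "nat \<Rightarrow> 'k::field" where
  "Z3 j = - (29/154) * of_nat ((j+2) choose 4) - 4/77 * of_nat ((j+2) choose 3)
        + 317/462 * of_nat ((j+2) choose 2) - 59/33 * of_nat (j+2) + 37/11"
definition Z4 :: "nat \<Rightarrow> 'k::field" where
  "Z4 j = - (47/154) * of_nat ((j+2) choose 4) + 185/231 * of_nat ((j+2) choose 3)
        - 2245/1386 * of_nat ((j+2) choose 2) + 295/99 * of_nat (j+2) - 185/33"

definition xi0 :: "('k::field) vect \<Rightarrow> 'k vect \<Rightarrow> 'k" where
  "xi0 x y = wedge 2 5 x y - 3 * wedge 3 4 x y"
definition xi1 :: "nat \<Rightarrow> ('k::field) vect \<Rightarrow> 'k vect \<Rightarrow> 'k" where
  "xi1 j x y = (of_nat j - 1) / 2 * (wedge 2 6 x y - 2 * wedge 3 5 x y)"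
definition xi2 :: "nat \<Rightarrow> ('k::field) vect \<Rightarrow> 'k vect \<Rightarrow> 'k" where
  "xi2 j x y = P1 j * wedge 2 7 x y + P2 j * wedge 3 6 x y + P3 j * wedge 4 5 x y"
definition xi3 :: "nat \<Rightarrow> ('k::field) vect \<Rightarrow> 'k vect \<Rightarrow> 'k" where
  "xi3 j x y = Q1 j * wedge 2 8 x y + Q2 j * wedge 3 7 x y + Q3 j * wedge 4 6 x y"
definition xi4 :: "nat \<Rightarrow> ('k::field) vect \<Rightarrow> 'k vect \<Rightarrow> 'k" where
  "xi4 j x y = Z1 j * wedge 2 9 x y + Z2 j * wedge 3 8 x y
             + Z3 j * wedge 4 7 x y + Z4 j * wedge 5 6 x y"

text \<open>\<open>xi p j\<close> is only meant for \<open>p \<le> 4\<close>; larger indices never occur below.\<close>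

definition xi :: "nat \<Rightarrow> nat \<Rightarrow> ('k::field) vect \<Rightarrow> 'k vect \<Rightarrow> 'k" where
  "xi p j = (if p = 1 then xi1 j else if p = 2 then xi2 j else if p = 3 then xi3 j else xi4 j)"

text \<open>\<open>psi n (7 + s)\<close> is the basic cocycle \<open>\<psi>\<close> with indices \<open>n\<close> and \<open>7 + s\<close>, for \<open>s = 0, \<dots>, 4\<close>.\<close>

definition psi :: "nat \<Rightarrow> nat \<Rightarrow> ('k::field) bimap" where
  "psi n r = (let s = r - 7 in
     (\<lambda>x y. xi0 x y *\<^sub>V e (n - s) + (\<Sum>p\<in>{1..s}. xi p (n - s) x y *\<^sub>V e (n - s + p))))"

type_synonym 'k quint = "'k \<times> 'k \<times> 'k \<times> 'k \<times> 'k"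

fun Psi :: "nat \<Rightarrow> ('k::field) quint \<Rightarrow> 'k bimap" where
  "Psi n (x1, x2, x3, x4, x5) = (\<lambda>u v.
     x1 *\<^sub>V psi n 11 u v + x2 *\<^sub>V psi n 10 u v + x3 *\<^sub>V psi n 9 u v
     + x4 *\<^sub>V psi n 8 u v + x5 *\<^sub>V psi n 7 u v)"


fun rho :: "nat \<Rightarrow> 'k::field \<Rightarrow> 'k quint \<Rightarrow> 'k quint" where
  "rho n \<alpha> (x1, x2, x3, x4, x5) =
     (\<alpha>^(n-11) * x1, \<alpha>^(n-10) * x2, \<alpha>^(n-9) * x3, \<alpha>^(n-8) * x4, \<alpha>^(n-7) * x5)"

definition orbit :: "nat \<Rightarrow> ('k::field) quint \<Rightarrow> 'k quint set" where
  "orbit n x = {rho n \<alpha> x | \<alpha>. \<alpha> \<noteq> 0}"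

definition orbit_space :: "nat \<Rightarrow> ('k::field) quint set set" where
  "orbit_space n = range (orbit n)"

end

theory Submission
  imports Defs
begin

text \<open>
  Write \<open>e\<^sub>i\<close> for the basis and \<open>F\<^sub>a\<close> for the span of the \<open>e\<^sub>i\<close> with \<open>i \<ge> a\<close>. A bracket \<open>[,] + \<Psi>\<close>
  with \<open>\<Psi>\<close> of positive degree satisfies \<open>[e\<^sub>i, e\<^sub>j] = (j - i) e\<^sub>i\<^sub>+\<^sub>j\<close> modulo \<open>F\<^sub>i\<^sub>+\<^sub>j\<^sub>+\<^sub>1\<close>, and this
  leading behaviour (locale \<open>filtered_bracket\<close>) is all that the classification needs to know.

  The undeformed algebra is generated by \<open>e\<^sub>1\<close> and \<open>e\<^sub>2\<close>, because \<open>[e\<^sub>1, e\<^sub>j] = (j - 1) e\<^sub>j\<^sub>+\<^sub>1\<close>; up to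
  weight \<open>n\<close> it is presented by the two relations \<open>[e\<^sub>2, e\<^sub>3] = e\<^sub>5\<close> and \<open>[e\<^sub>2, e\<^sub>5] = 3 e\<^sub>7\<close>. A pair \<open>u\<close>, \<open>v\<close>
  with leading terms \<open>e\<^sub>1\<close>, \<open>e\<^sub>2\<close> generates a deformation in the same way, and the deformation is
  described by how far the corresponding elements are from satisfying the two relations.

  \<^item> Existence of a normal form (\<open>normal_form\<close>). A change of \<open>u\<close> and \<open>v\<close> by the same amount \<open>t\<close> in degree
    \<open>l\<close> changes the first relation in degree \<open>l\<close> by a nonzero multiple of \<open>t\<close> (\<open>relation5_change\<close>), so \<open>u\<close> and \<open>v\<close> can be chosen
    such that it holds exactly. The linear map given by the generated elements then compares a bracket
    \<open>[,] + \<Psi>\<^sub>x\<close> from the family in the theorem with the given deformation. Its failure to be a homomorphism is a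
    2-cocycle, whose leading coefficients form a graded cocycle of positive degree that vanishes on
    \<open>e\<^sub>1\<close> and on the first relation. Such a cocycle is determined by its value on \<open>(e\<^sub>2, e\<^sub>5)\<close>
    (\<open>vanishing\<close>), and this value is zero as soon as the cocycle is defined up to weight 12 (up to weight 15 in degree
    1, \<open>two_five\<close>). Hence only the five coefficients of \<open>e\<^sub>n\<^sub>-\<^sub>4, \<dots>, e\<^sub>n\<close> in \<open>[e\<^sub>2, e\<^sub>5]\<close> are free, and these
    are exactly the coefficients of the five basic cocycles.
  \<^item> The family consists of Lie algebras (\<open>filtered_deformation_Psi\<close>). The linear part of the Jacobi
    identity is a finite check in weights at most 11 with coefficients polynomial in \<open>n\<close>; the quadratic part vanishes
    since \<open>\<Psi>\<^sub>x\<close> takes values in \<open>F\<^sub>n\<^sub>-\<^sub>4\<close> and kills \<open>F\<^sub>1\<^sub>0\<close>.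
  \<^item> Uniqueness (\<open>model_isomorphic_iff\<close>). An isomorphism within the family respects the
    filtration and acts on the graded pieces by powers of one scalar \<open>\<alpha>\<close> (\<open>isomorphism_diagonal\<close>); dividing by the dilation
    \<open>e\<^sub>k \<mapsto> \<alpha>\<^sup>k e\<^sub>k\<close> accounts for the action of \<open>\<alpha>\<close> on the parameters. The first relation forces what remains to
    agree, degree by degree, with inner automorphisms, and after removing them it fixes all \<open>e\<^sub>j\<close> with \<open>j \<ge> 5\<close>,
    hence the parameters (\<open>unipotent_rigidity\<close>).
\<close>

section \<open>Cocycles of positive degree below a weight bound\<close>

text \<open>
  A cochain of degree \<open>l\<close> sends \<open>(e\<^sub>i, e\<^sub>j)\<close> to \<open>c i j\<close> times \<open>e\<^sub>i\<^sub>+\<^sub>j\<^sub>+\<^sub>l\<close>, which is only visible while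
  \<open>i + j \<le> M\<close> with \<open>M = n - l\<close>. Assumption \<open>jac\<close> is the coefficient in the cocycle identity on
  \<open>e\<^sub>i, e\<^sub>j, e\<^sub>k\<close>; the last two assumptions normalise the cochain on the generators and on the first relation.
\<close>
locale truncated_cocycle =
  fixes M l :: nat and c :: "nat \<Rightarrow> nat \<Rightarrow> 'k::field_char_0"
  assumes skew: "\<lbrakk>1 \<le> i; 1 \<le> j; i + j \<le> M\<rbrakk> \<Longrightarrow> c j i = - c i j"
    and jac: "\<lbrakk>1 \<le> i; 1 \<le> j; 1 \<le> k; i + j + k \<le> M\<rbrakk> \<Longrightarrow>
      (of_nat k - of_nat i - of_nat j - of_nat l) * c i j + (of_nat j - of_nat i) * c (i + j) k
      + (of_nat i - of_nat j - of_nat k - of_nat l) * c j k + (of_nat k - of_nat j) * c (j + k) i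
      + (of_nat j - of_nat k - of_nat i - of_nat l) * c k i + (of_nat i - of_nat k) * c (k + i) j = 0"
    and one: "\<lbrakk>1 \<le> j; 1 + j \<le> M\<rbrakk> \<Longrightarrow> c 1 j = 0"
    and two_three: "5 \<le> M \<Longrightarrow> c 2 3 = 0"
begin

lemma diag: "\<lbrakk>1 \<le> i; i + i \<le> M\<rbrakk> \<Longrightarrow> c i i = 0"
  using skew[of i i] by simp

text \<open>
  The cocycle identity with \<open>e\<^sub>1\<close> as one argument: the cochain commutes with \<open>ad e\<^sub>1\<close>. It passes from one weight
  \<open>i + j\<close> to the next.
\<close>
lemma shift:
  assumes "1 \<le> i" "1 \<le> j" "1 + i + j \<le> M"
  shows "of_nat (i - 1) * c (i + 1) j + of_nat (j - 1) * c i (j + 1) = of_nat (i + j - 1 + l) * c i j"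
proof -
  have "c 1 i = 0" "c j 1 = 0" "c (i + j) 1 = 0" "c (j + 1) i = - c i (j + 1)"
    using assms one[of i] one[of j] one[of "i + j"] skew[of 1 j] skew[of 1 "i + j"] skew[of i "j + 1"]
    by auto
  moreover have "of_nat (i - 1) = (of_nat i - 1 :: 'k)" "of_nat (j - 1) = (of_nat j - 1 :: 'k)"
      "of_nat (i + j - 1 + l) = (of_nat i + of_nat j + of_nat l - 1 :: 'k)"
    using assms by (simp_all add: of_nat_diff)
  ultimately show ?thesis
    using jac[of 1 i j] assms by (simp add: algebra_simps)
qed

text \<open>
  If all lower weights vanish, \<open>shift\<close> is a two-term recursion with nonzero factors along weight \<open>m\<close>, so the entries
  of that weight are zero together.
\<close>
lemma vanish_row:
  assumes lower: "\<And>i j. \<lbrakk>1 \<le> i; 1 \<le> j; i + j < m\<rbrakk> \<Longrightarrow> c i j = 0"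
    and m: "m \<le> M" and a: "2 \<le> a" "a + 2 \<le> m"
  shows "c a (m - a) = 0 \<longleftrightarrow> c 2 (m - 2) = 0"
  using a
proof (induction a rule: dec_induct)
  case (step a)
  define b where "b = m - 1 - a"
  have b: "2 \<le> b" "m - a = b + 1" "m - Suc a = b" "a + b + 1 = m"
    using step by (auto simp: b_def)
  have "of_nat (a - 1) * c (a + 1) b + of_nat (b - 1) * c a (b + 1) = 0"
    using shift[of a b] lower[of a b] b m step.hyps by simp
  moreover have "of_nat (a - 1) \<noteq> (0::'k)" "of_nat (b - 1) \<noteq> (0::'k)"
    using b step.hyps by auto
  ultimately have "c (a + 1) b = 0 \<longleftrightarrow> c a (b + 1) = 0"
    by (metis add.commute add.right_neutral mult_eq_0_iff)
  then show ?case
    using step b by simp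
qed simp

text \<open>
  By \<open>vanish_row\<close> each weight has one free parameter. Skewness kills it in even weights, the two
  normalisations kill it in weights 5 and 7, and in odd weights \<open>m \<ge> 9\<close> the identity on
  \<open>(e\<^sub>2, e\<^sub>3, e\<^sub>m\<^sub>-\<^sub>5)\<close> multiplies it by a sum of positive terms. This is the statement that weights 5 and 7 carry
  all relations of the algebra.
\<close>
theorem vanishing:
  assumes two_five: "7 \<le> M \<Longrightarrow> c 2 5 = 0"
    and "1 \<le> i" "1 \<le> j" "i + j \<le> M"
  shows "c i j = 0"
  using assms(2-)
proof (induction "i + j" arbitrary: i j rule: less_induct)
  case less
  define m where "m = i + j"
  have m: "m \<le> M" using less.prems m_def by simp
  have lower: "c i' j' = 0" if "1 \<le> i'" "1 \<le> j'" "i' + j' < m" for i' j'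
    using less.hyps[of i' j'] that less.prems by (simp add: m_def)
  note row = vanish_row[OF lower m]
  consider "i = 1 \<or> j = 1" | "2 \<le> i" "2 \<le> j"
    using less.prems by linarith
  then show ?case
  proof cases
    case 1
    then show ?thesis
      using one[of j] one[of i] skew[of j i] less.prems by (auto simp: add.commute)
  next
    case 2
    have "c 2 (m - 2) = 0"
    proof (cases "even m")
      case True
      then obtain h where h: "m = h + h" by (metis evenE mult_2)
      have "c h (m - h) = 0" using diag[of h] h m 2 m_def by auto
      then show ?thesis using row[of h] h 2 m_def by auto
    next
      case False
      have "m \<noteq> 4" "m \<noteq> 6" "m \<noteq> 8" using False by auto
      then consider "m = 5" | "m = 7" | "9 \<le> m"
        using 2 m_def by linarith
      then show ?thesis
      proof cases
        case 1
        then show ?thesis using two_three m by simp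
      next
        case 2
        then show ?thesis using two_five m by simp
      next
        case 3
        \<comment> \<open>With this shift all subtractions of naturals disappear and the coefficients are visibly positive.\<close>
        then obtain q where q: "m = q + 9" by (metis add.commute le_Suc_ex)
        have d: "c 3 (q + 6) + of_nat (q + 5) * c 2 (q + 7) = 0"
            "2 * c 4 (q + 5) + of_nat (q + 4) * c 3 (q + 6) = 0"
            "3 * c 5 (q + 4) + of_nat (q + 3) * c 4 (q + 5) = 0"
          using shift[of 2 "q + 6"] shift[of 3 "q + 5"] shift[of 4 "q + 4"]
            lower[of 2 "q + 6"] lower[of 3 "q + 5"] lower[of 4 "q + 4"] q m
          by (simp_all add: numeral_eq_Suc)
        have "c 5 (q + 4) - of_nat (q + 1) * c 2 (q + 7) + of_nat (q + 2) * c 3 (q + 6) = 0"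
          using jac[of 2 3 "q + 4"] lower[of 2 3] lower[of 3 "q + 4"] lower[of "q + 4" 2]
            skew[of 2 "q + 7"] skew[of 3 "q + 6"] q m
          by (simp add: algebra_simps numeral_eq_Suc)
        then have "((of_nat q + 5) * (of_nat q + 4) * (of_nat q + 3) + 6 * (of_nat q + 1)
            + 6 * (of_nat q + 2) * (of_nat q + 5)) * c 2 (q + 7) = 0"
          using d unfolding of_nat_add of_nat_numeral of_nat_1 by algebra
        moreover have "(of_nat q + 5) * (of_nat q + 4) * (of_nat q + 3) + 6 * (of_nat q + 1)
            + 6 * (of_nat q + 2) * (of_nat q + 5)
          = (of_nat ((q + 5) * (q + 4) * (q + 3) + 6 * (q + 1) + 6 * (q + 2) * (q + 5)) :: 'k)"
          by simp
        moreover have "\<dots> \<noteq> 0" unfolding of_nat_eq_0_iff by simp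
        ultimately have "c 2 (q + 7) = 0" by (metis mult_eq_0_iff)
        moreover have "m - 2 = q + 7" using q by simp
        ultimately show ?thesis by simp
      qed
    qed
    then show ?thesis using row[of i] 2 m_def by simp
  qed
qed

text \<open>
  The recursion of \<open>shift\<close>, solved weight by weight in terms of \<open>b = c 2 5\<close>. In even weights skewness supplies
  the missing initial value, in weights 9 and 11 the identity on \<open>(e\<^sub>2, e\<^sub>3, e\<^sub>4)\<close> and
  \<open>(e\<^sub>2, e\<^sub>3, e\<^sub>6)\<close> does. Up to weight 11 the solution is given by the polynomials in the basic cocycles, at
  \<open>j = l + 7\<close>. Weight 12 is the first one with an equation to spare, the identity on
  \<open>(e\<^sub>2, e\<^sub>3, e\<^sub>7)\<close>, and yields the last claim.
\<close>
lemma coefficients: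
  assumes M: "12 \<le> M"
  defines "L \<equiv> of_nat l" and "b \<equiv> c 2 5"
  shows "56 * c 2 8 = (496 + 198*L + 25*L^2 + L^3) * b"
    and "11088 * c 3 8 = (- 63984 - 7582*L + 4969*L^2 + 1034*L^3 + 51*L^4) * b"
    and "110880 * c 2 10 = (1733280 + 961028*L + 201520*L^2 + 19975*L^3 + 940*L^4 + 17*L^5) * b"
    and "55440 * c 3 9 = (- 162720 + 108828*L + 84260*L^2 + 17075*L^3 + 1360*L^4 + 37*L^5) * b"
    and "27720 * c 4 8 = (- 515040 - 365204*L - 94820*L^2 - 10745*L^3 - 450*L^4 - L^5) * b"
    and "55440 * c 5 7 = (- 918240 - 787724*L - 276540*L^2 - 48195*L^3 - 4160*L^4 - 141*L^5) * b"
    and "(L - 1) * (L^4 + 11 * L^3 + 64 * L^2 + 108 * L + 288) * b = 0"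
proof -
  have c2_3: "c 2 3 = 0" using two_three M by simp
  have c2_4: "c 2 4 = 0"
    using shift[of 2 3] diag[of 3] c2_3 M by simp
  have c2_5: "c 2 5 = b" by (simp add: b_def)
  have c3_4: "c 3 4 = - 3 * b"
    using shift[of 2 4] c2_4 M by (simp add: b_def eq_neg_iff_add_eq_0)
  have d2_5: "c 3 5 + 4 * c 2 6 = (6 + L) * c 2 5"
    using shift[of 2 5] M by (simp add: L_def)
  have d3_4: "3 * c 3 5 = (6 + L) * c 3 4"
    using shift[of 3 4] M diag[of 4] by (simp add: L_def)
  have c3_5: "c 3 5 = (- 6 - L) * b"
    using d3_4 c3_4 by algebra
  have c2_6: "2 * c 2 6 = (6 + L) * b"
    using d2_5 c2_5 c3_5 by algebra
  have d2_6: "c 3 6 + 5 * c 2 7 = (7 + L) * c 2 6"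
    using shift[of 2 6] M by (simp add: L_def)
  have d3_5: "2 * c 4 5 + 4 * c 3 6 = (7 + L) * c 3 5"
    using shift[of 3 5] M by (simp add: L_def)
  have j9: "- c 4 5 - (5 + L) * c 3 4 - c 2 7 + (3 + L) * c 2 4 + 2 * c 3 6 = 0"
    using jac[of 2 3 4] skew[of 2 4] skew[of 2 7] skew[of 3 6] skew[of 4 5] c2_3 M by (simp add: L_def algebra_simps)
  have c2_7: "42 * c 2 7 = (240 + 71*L + 5*L^2) * b"
    using d2_6 d3_5 j9 c2_6 c3_5 c3_4 c2_4 by algebra
  have c3_6: "21 * c 3 6 = (- 159 - 41*L - 2*L^2) * b"
    using d2_6 c2_6 c2_7 by algebra
  have c4_5: "42 * c 4 5 = (- 246 - 109*L - 13*L^2) * b"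
    using d3_5 c3_5 c3_6 by algebra
  have d2_7: "c 3 7 + 6 * c 2 8 = (8 + L) * c 2 7"
    using shift[of 2 7] M by (simp add: L_def)
  have d3_6: "2 * c 4 6 + 5 * c 3 7 = (8 + L) * c 3 6"
    using shift[of 3 6] M by (simp add: L_def)
  have d4_5: "4 * c 4 6 = (8 + L) * c 4 5"
    using shift[of 4 5] M diag[of 5] by (simp add: L_def)
  have c4_6: "168 * c 4 6 = (- 1968 - 1118*L - 213*L^2 - 13*L^3) * b"
    using d4_5 c4_5 by algebra
  have c3_7: "84 * c 3 7 = (- 624 - 166*L - 3*L^2 + L^3) * b"
    using d3_6 c3_6 c4_6 by algebra
  have c2_8: "56 * c 2 8 = (496 + 198*L + 25*L^2 + L^3) * b"
    using d2_7 c2_7 c3_7 by algebra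
  have d2_8: "c 3 8 + 7 * c 2 9 = (9 + L) * c 2 8"
    using shift[of 2 8] M by (simp add: L_def)
  have d3_7: "2 * c 4 7 + 6 * c 3 8 = (9 + L) * c 3 7"
    using shift[of 3 7] M by (simp add: L_def)
  have d4_6: "3 * c 5 6 + 5 * c 4 7 = (9 + L) * c 4 6"
    using shift[of 4 6] M by (simp add: L_def)
  have j11: "c 5 6 - (7 + L) * c 3 6 - 3 * c 2 9 + (5 + L) * c 2 6 + 4 * c 3 8 = 0"
    using jac[of 2 3 6] skew[of 2 6] skew[of 2 9] skew[of 3 8] c2_3 M by (simp add: L_def algebra_simps)
  have c2_9: "11088 * c 2 9 = (135408 + 65518*L + 11255*L^2 + 814*L^3 + 21*L^4) * b"
    using d2_8 d3_7 d4_6 j11 c2_8 c3_7 c4_6 c3_6 c2_6 by algebra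
  have c3_8: "11088 * c 3 8 = (- 63984 - 7582*L + 4969*L^2 + 1034*L^3 + 51*L^4) * b"
    using d2_8 c2_8 c2_9 by algebra
  have c4_7: "3696 * c 4 7 = (- 59568 - 39014*L - 9215*L^2 - 902*L^3 - 29*L^4) * b"
    using d3_7 c3_7 c3_8 by algebra
  have c5_6: "11088 * c 5 6 = (- 91824 - 69590*L - 20695*L^2 - 2750*L^3 - 141*L^4) * b"
    using d4_6 c4_6 c4_7 by algebra
  have d2_9: "c 3 9 + 8 * c 2 10 = (10 + L) * c 2 9"
    using shift[of 2 9] M by (simp add: L_def)
  have d3_8: "2 * c 4 8 + 7 * c 3 9 = (10 + L) * c 3 8"
    using shift[of 3 8] M by (simp add: L_def)
  have d4_7: "3 * c 5 7 + 6 * c 4 8 = (10 + L) * c 4 7"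
    using shift[of 4 7] M by (simp add: L_def)
  have d5_6: "5 * c 5 7 = (10 + L) * c 5 6"
    using shift[of 5 6] M diag[of 6] by (simp add: L_def)
  have j12: "c 5 7 - (8 + L) * c 3 7 - 4 * c 2 10 + (6 + L) * c 2 7 + 5 * c 3 9 = 0"
    using jac[of 2 3 7] skew[of 2 7] skew[of 2 10] skew[of 3 9] c2_3 M by (simp add: L_def algebra_simps)
  have c5_7: "55440 * c 5 7 = (- 918240 - 787724*L - 276540*L^2 - 48195*L^3 - 4160*L^4 - 141*L^5) * b"
    using d5_6 c5_6 by algebra
  have c4_8: "27720 * c 4 8 = (- 515040 - 365204*L - 94820*L^2 - 10745*L^3 - 450*L^4 - L^5) * b"
    using d4_7 c4_7 c5_7 by algebra
  have c3_9: "55440 * c 3 9 = (- 162720 + 108828*L + 84260*L^2 + 17075*L^3 + 1360*L^4 + 37*L^5) * b"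
    using d3_8 c3_8 c4_8 by algebra
  have c2_10: "110880 * c 2 10 = (1733280 + 961028*L + 201520*L^2 + 19975*L^3 + 940*L^4 + 17*L^5) * b"
    using d2_9 c2_9 c3_9 by algebra
  show "56 * c 2 8 = (496 + 198*L + 25*L^2 + L^3) * b" by (fact c2_8)
  show "11088 * c 3 8 = (- 63984 - 7582*L + 4969*L^2 + 1034*L^3 + 51*L^4) * b" by (fact c3_8)
  show "110880 * c 2 10 = (1733280 + 961028*L + 201520*L^2 + 19975*L^3 + 940*L^4 + 17*L^5) * b" by (fact c2_10)
  show "55440 * c 3 9 = (- 162720 + 108828*L + 84260*L^2 + 17075*L^3 + 1360*L^4 + 37*L^5) * b" by (fact c3_9)
  show "27720 * c 4 8 = (- 515040 - 365204*L - 94820*L^2 - 10745*L^3 - 450*L^4 - L^5) * b" by (fact c4_8)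
  show "55440 * c 5 7 = (- 918240 - 787724*L - 276540*L^2 - 48195*L^3 - 4160*L^4 - 141*L^5) * b" by (fact c5_7)
  show "(L - 1) * (L^4 + 11 * L^3 + 64 * L^2 + 108 * L + 288) * b = 0"
    using j12 c5_7 c3_7 c2_10 c2_7 c3_9 by algebra
qed

text \<open>
  In degree 1 the obstruction in weight 12 is trivial because of its factor \<open>L - 1\<close>. The next overdetermined weight
  with a nontrivial obstruction is 15, on \<open>(e\<^sub>2, e\<^sub>5, e\<^sub>8)\<close>. Degree 1 allows weights up to
  \<open>n - 1\<close>, which is where the bound \<open>n \<ge> 16\<close> in the theorem comes from.
\<close>
lemma two_five_degree_one:
  assumes l: "l = 1" and M: "15 \<le> M"
  shows "c 2 5 = 0"
proof -
  define b where "b = c 2 5"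
  have M12: "12 \<le> M" using M by simp
  have c2_3: "c 2 3 = 0" using two_three M by simp
  have c2_8: "7 * c 2 8 = 90 * b" and c3_8: "1386 * c 3 8 = - 8189 * b"
    and c2_10: "36 * c 2 10 = 947 * b" and c3_9: "42 * c 3 9 = 37 * b"
    and c4_8: "126 * c 4 8 = - 4483 * b" and c5_7: "126 * c 5 7 = - 4625 * b"
    using coefficients[OF M12] by (simp_all add: b_def l)
  have d2_10: "c 3 10 + 9 * c 2 11 = 12 * c 2 10"
    using shift[of 2 10] M by (simp add: l)
  have d3_9: "2 * c 4 9 + 8 * c 3 10 = 12 * c 3 9"
    using shift[of 3 9] M by (simp add: l)
  have d4_8: "3 * c 5 8 + 7 * c 4 9 = 12 * c 4 8"
    using shift[of 4 8] M by (simp add: l)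
  have d5_7: "4 * c 6 7 + 6 * c 5 8 = 12 * c 5 7"
    using shift[of 5 7] M by (simp add: l)
  have j13: "c 5 8 - 10 * c 3 8 - 5 * c 2 11 + 8 * c 2 8 + 6 * c 3 10 = 0"
    using jac[of 2 3 8] skew[of 2 8] skew[of 2 11] skew[of 3 10] c2_3 M by (simp add: l algebra_simps)
  have c2_11: "99099 * c 2 11 = 3359326 * b"
    using d2_10 d3_9 d4_8 d5_7 j13 c2_10 c3_9 c4_8 c5_7 c3_8 c2_8 by algebra
  have c3_10: "33033 * c 3 10 = 349439 * b"
    using d2_10 c2_10 c2_11 by algebra
  have c4_9: "33033 * c 4 9 = - 1223153 * b"
    using d3_9 c3_9 c3_10 by algebra
  have c5_8: "33033 * c 5 8 = - 1847149 * b"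
    using d4_8 c4_8 c4_9 by algebra
  have c6_7: "33033 * c 6 7 = - 866839 * b"
    using d5_7 c5_7 c5_8 by algebra
  have d2_11: "c 3 11 + 10 * c 2 12 = 13 * c 2 11"
    using shift[of 2 11] M by (simp add: l)
  have d3_10: "2 * c 4 10 + 9 * c 3 11 = 13 * c 3 10"
    using shift[of 3 10] M by (simp add: l)
  have d4_9: "3 * c 5 9 + 8 * c 4 10 = 13 * c 4 9"
    using shift[of 4 9] M by (simp add: l)
  have d5_8: "4 * c 6 8 + 7 * c 5 9 = 13 * c 5 8"
    using shift[of 5 8] M by (simp add: l)
  have d6_7: "6 * c 6 8 = 13 * c 6 7"
    using shift[of 6 7] M diag[of 7] by (simp add: l)
  have c6_8: "15246 * c 6 8 = - 866839 * b"
    using d6_7 c6_7 by algebra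
  have c5_9: "7623 * c 5 9 = - 543967 * b"
    using d5_8 c5_8 c6_8 by algebra
  have c4_10: "10164 * c 4 10 = - 339593 * b"
    using d4_9 c4_9 c5_9 by algebra
  have c3_11: "2178 * c 3 11 = 49451 * b"
    using d3_10 c3_10 c4_10 by algebra
  have c2_12: "3388 * c 2 12 = 141611 * b"
    using d2_11 c2_11 c3_11 by algebra
  have d2_12: "c 3 12 + 11 * c 2 13 = 14 * c 2 12"
    using shift[of 2 12] M by (simp add: l)
  have d3_11: "2 * c 4 11 + 10 * c 3 12 = 14 * c 3 11"
    using shift[of 3 11] M by (simp add: l)
  have d4_10: "3 * c 5 10 + 9 * c 4 11 = 14 * c 4 10"
    using shift[of 4 10] M by (simp add: l)
  have d5_9: "4 * c 6 9 + 8 * c 5 10 = 14 * c 5 9"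
    using shift[of 5 9] M by (simp add: l)
  have d6_8: "5 * c 7 8 + 7 * c 6 9 = 14 * c 6 8"
    using shift[of 6 8] M by (simp add: l)
  have j15: "c 5 10 - 12 * c 3 10 - 7 * c 2 13 + 10 * c 2 10 + 8 * c 3 12 = 0"
    using jac[of 2 3 10] skew[of 2 10] skew[of 2 13] skew[of 3 12] c2_3 M by (simp add: l algebra_simps)
  have c2_13: "2576574 * c 2 13 = 128455003 * b"
    using d2_12 d3_11 d4_10 d5_9 d6_8 j15 c2_12 c3_11 c4_10 c5_9 c6_8 c3_10 c2_10 by algebra
  have c3_12: "1288287 * c 3 12 = 47363642 * b"
    using d2_12 c2_12 c2_13 by algebra
  have c4_11: "858858 * c 4 11 = - 21377563 * b"
    using d3_11 c3_11 c3_12 by algebra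
  have c5_10: "1288287 * c 5 10 = - 104670226 * b"
    using d4_10 c4_10 c4_11 by algebra
  have c6_9: "858858 * c 6 9 = - 74944019 * b"
    using d5_9 c5_9 c5_10 by algebra
  have c7_8: "368082 * c 7 8 = - 13631905 * b"
    using d6_8 c6_8 c6_9 by algebra
  have j258: "3 * c 7 8 - 12 * c 5 8 - 3 * c 2 13 + 6 * c 2 8 + 6 * c 5 10 = 0"
    using jac[of 2 5 8] skew[of 2 8] skew[of 2 13] skew[of 5 10] M by (simp add: l algebra_simps)
  have "b = 0"
    using j258 c7_8 c5_8 c2_13 c2_8 c5_10 by algebra
  then show ?thesis by (simp add: b_def)
qed

theorem two_five:
  assumes "12 \<le> M" "1 \<le> l" "l = 1 \<Longrightarrow> 15 \<le> M"
  shows "c 2 5 = 0"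
proof (cases "l = 1")
  case False
  define d :: nat where "d = l - 1"
  have "of_nat (d * (l^4 + 11 * l^3 + 64 * l^2 + 108 * l + 288)) * c 2 5 = 0"
    using coefficients(7)[OF assms(1)] assms(2) by (simp add: d_def of_nat_diff)
  moreover have "d * (l^4 + 11 * l^3 + 64 * l^2 + 108 * l + 288) \<noteq> 0"
    using False assms(2) by (simp add: d_def)
  ultimately show ?thesis
    by (metis mult_eq_0_iff of_nat_eq_0_iff)
qed (use assms two_five_degree_one in simp)

end

section \<open>Linear algebra on the truncated coordinate space\<close>

lemma scale_apply [simp]: "(c *\<^sub>V x) k = c * x k"
  by (simp add: scale_def)

lemma sum_apply [simp]: "(\<Sum>i\<in>A. f i) k = (\<Sum>i\<in>A. f i k)" for f :: "'a \<Rightarrow> nat \<Rightarrow> 'k::comm_monoid_add"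
  by (induction A rule: infinite_finite_induct) auto

lemma e_apply: "e i k = (if k = i then 1 else 0)"
  by (simp add: e_def)

text \<open>
  The filtration by degree. The value of \<open>x \<in> Fil n a\<close> at \<open>a\<close> is its leading coefficient. Since
  \<open>Fil n (n + 1) = 0\<close>, proving membership for growing \<open>a\<close> one step at a time proves equalities.
\<close>
definition Fil :: "nat \<Rightarrow> nat \<Rightarrow> ('k::field) vect set" where
  "Fil n a = {x \<in> V n. \<forall>k<a. x k = 0}"

lemma V_eq_Fil: "V n = Fil n 1"
  by (auto simp: Fil_def V_def)

lemma V_outside: "x \<in> V n \<Longrightarrow> k \<notin> {1..n} \<Longrightarrow> x k = 0"
  by (simp add: V_def)

lemma V_0 [simp]: "0 \<in> V n" and V_add [simp]: "x \<in> V n \<Longrightarrow> y \<in> V n \<Longrightarrow> x + y \<in> V n"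
  and V_diff [simp]: "x \<in> V n \<Longrightarrow> y \<in> V n \<Longrightarrow> x - y \<in> V n"
  and V_uminus [simp]: "x \<in> V n \<Longrightarrow> - x \<in> V n"
  and V_scale [simp]: "x \<in> V n \<Longrightarrow> c *\<^sub>V x \<in> V n"
  and V_e [simp]: "1 \<le> i \<Longrightarrow> i \<le> n \<Longrightarrow> e i \<in> V n"
  by (auto simp: V_def e_def)

lemma V_sum: "(\<And>i. i \<in> A \<Longrightarrow> f i \<in> V n) \<Longrightarrow> (\<Sum>i\<in>A. f i) \<in> V n"
  by (induction A rule: infinite_finite_induct) auto

lemma Fil_V: "x \<in> Fil n a \<Longrightarrow> x \<in> V n"
  by (simp add: Fil_def)

lemma Fil_below: "x \<in> Fil n a \<Longrightarrow> k < a \<Longrightarrow> x k = 0"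
  by (simp add: Fil_def)

lemma Fil_0 [simp]: "0 \<in> Fil n a"
  and Fil_add: "x \<in> Fil n a \<Longrightarrow> y \<in> Fil n a \<Longrightarrow> x + y \<in> Fil n a"
  and Fil_diff: "x \<in> Fil n a \<Longrightarrow> y \<in> Fil n a \<Longrightarrow> x - y \<in> Fil n a"
  and Fil_scale: "x \<in> Fil n a \<Longrightarrow> c *\<^sub>V x \<in> Fil n a"
  and Fil_e: "1 \<le> i \<Longrightarrow> i \<le> n \<Longrightarrow> a \<le> i \<Longrightarrow> e i \<in> Fil n a"
  and Fil_mono: "x \<in> Fil n b \<Longrightarrow> a \<le> b \<Longrightarrow> x \<in> Fil n a"
  by (auto simp: Fil_def e_apply)

lemma Fil_sum: "(\<And>i. i \<in> A \<Longrightarrow> f i \<in> Fil n a) \<Longrightarrow> (\<Sum>i\<in>A. f i) \<in> Fil n a"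
  by (induction A rule: infinite_finite_induct) (auto intro: Fil_add)

lemma Fil_beyond: "x \<in> Fil n a \<Longrightarrow> n < a \<Longrightarrow> x = 0"
  by (rule ext) (metis Fil_below Fil_V V_outside atLeastAtMost_iff leI order_le_less_trans zero_fun_apply)

lemma Fil_Suc: "x \<in> Fil n a \<Longrightarrow> x a = 0 \<Longrightarrow> x \<in> Fil n (Suc a)"
  by (auto simp: Fil_def less_Suc_eq)

lemma Fil_SucI: "x \<in> Fil n a \<Longrightarrow> (1 \<le> a \<Longrightarrow> a \<le> n \<Longrightarrow> x a = 0) \<Longrightarrow> x \<in> Fil n (Suc a)"
  by (metis Fil_Suc Fil_V V_outside atLeastAtMost_iff)

lemma V_expand: "x \<in> V n \<Longrightarrow> x = (\<Sum>i=1..n. x i *\<^sub>V e i)"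
  by (rule ext) (auto simp: e_apply V_outside if_distrib cong: if_cong)

subsection \<open>Linear maps\<close>

lemma linear_mapD:
  assumes "linear_map n f"
  shows linear_map_V: "x \<in> V n \<Longrightarrow> f x \<in> V n"
    and linear_map_add: "x \<in> V n \<Longrightarrow> y \<in> V n \<Longrightarrow> f (x + y) = f x + f y"
    and linear_map_scale: "x \<in> V n \<Longrightarrow> f (c *\<^sub>V x) = c *\<^sub>V f x"
  using assms by (auto simp: linear_map_def)

lemma scale_zero_left [simp]: "0 *\<^sub>V x = 0" and scale_zero_right [simp]: "c *\<^sub>V 0 = 0"
  and scale_one [simp]: "1 *\<^sub>V x = x" and scale_minus_one: "(- 1) *\<^sub>V x = - x"
  by (auto simp: fun_eq_iff)

lemma linear_map_0:
  assumes "linear_map n f" shows "f 0 = 0"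
  using linear_map_scale[OF assms, of 0 0] by simp

lemma linear_map_uminus:
  assumes "linear_map n f" "x \<in> V n" shows "f (- x) = - f x"
  using linear_map_scale[OF assms, of "- 1"] by (simp add: scale_minus_one)

lemma linear_map_diff:
  assumes "linear_map n f" "x \<in> V n" "y \<in> V n" shows "f (x - y) = f x - f y"
  using linear_map_add[OF assms(1,2), of "- y"] linear_map_uminus[OF assms(1,3)] assms(3)
  by simp

lemma linear_map_sum:
  assumes "linear_map n f" "\<And>i. i \<in> A \<Longrightarrow> g i \<in> V n"
  shows "f (\<Sum>i\<in>A. g i) = (\<Sum>i\<in>A. f (g i))"
  using assms(2)
  by (induction A rule: infinite_finite_induct)
    (auto simp: linear_map_0[OF assms(1)] linear_map_add[OF assms(1)] V_sum)

lemma linear_map_expand: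
  assumes "linear_map n f" "x \<in> V n"
  shows "f x = (\<Sum>i=1..n. x i *\<^sub>V f (e i))"
proof -
  have "f x = f (\<Sum>i=1..n. x i *\<^sub>V e i)" using V_expand[OF assms(2)] by simp
  also have "\<dots> = (\<Sum>i=1..n. f (x i *\<^sub>V e i))"
    by (rule linear_map_sum[OF assms(1)]) auto
  also have "\<dots> = (\<Sum>i=1..n. x i *\<^sub>V f (e i))"
    using linear_map_scale[OF assms(1)] by simp
  finally show ?thesis .
qed

lemma linear_map_eqI:
  assumes "linear_map n f" "linear_map n g" "\<And>i. 1 \<le> i \<Longrightarrow> i \<le> n \<Longrightarrow> f (e i) = g (e i)" "x \<in> V n"
  shows "f x = g x"
  using linear_map_expand[OF assms(1,4)] linear_map_expand[OF assms(2,4)] assms(3) by simp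

lemma linear_map_comp:
  assumes "linear_map n f" "linear_map n g" shows "linear_map n (\<lambda>x. f (g x))"
  using assms by (auto simp: linear_map_def)

lemma linear_map_plus:
  assumes "linear_map n f" "linear_map n g" shows "linear_map n (\<lambda>x. f x + g x)"
  using assms by (auto simp: linear_map_def fun_eq_iff algebra_simps)

lemma linear_map_minus:
  assumes "linear_map n f" "linear_map n g" shows "linear_map n (\<lambda>x. f x - g x)"
  using assms by (auto simp: linear_map_def fun_eq_iff algebra_simps)

lemma linear_map_neg:
  assumes "linear_map n f" shows "linear_map n (\<lambda>x. - f x)"
  using assms by (auto simp: linear_map_def fun_eq_iff algebra_simps)

lemma linear_map_smult:
  assumes "linear_map n f" shows "linear_map n (\<lambda>x. c *\<^sub>V f x)"
  using assms by (auto simp: linear_map_def fun_eq_iff algebra_simps)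

lemma linear_map_summation:
  assumes "\<And>i. i \<in> A \<Longrightarrow> linear_map n (f i)"
  shows "linear_map n (\<lambda>x. \<Sum>i\<in>A. f i x)"
  using assms
proof (induction A rule: infinite_finite_induct)
  case (insert a A)
  have "linear_map n (\<lambda>x. f a x + (\<Sum>i\<in>A. f i x))"
    by (rule linear_map_plus[OF insert.prems[of a] insert.IH[OF insert.prems]]) blast+
  then show ?case by (simp only: sum.insert[OF insert.hyps])
qed (auto simp: linear_map_def)

lemma linear_map_ident: "linear_map n (\<lambda>x. x)"
  by (simp add: linear_map_def)

lemma linear_map_zero: "linear_map n (\<lambda>x. 0)"
  by (simp add: linear_map_def)

definition extend :: "nat \<Rightarrow> (nat \<Rightarrow> ('k::field) vect) \<Rightarrow> 'k vect \<Rightarrow> 'k vect" where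
  "extend n E x = (\<Sum>i=1..n. x i *\<^sub>V E i)"

lemma extend_e: "1 \<le> i \<Longrightarrow> i \<le> n \<Longrightarrow> extend n E (e i) = E i"
  by (rule ext) (simp add: extend_def e_apply if_distrib if_distribR cong: if_cong)

lemma linear_map_extend:
  assumes "\<And>i. 1 \<le> i \<Longrightarrow> i \<le> n \<Longrightarrow> E i \<in> V n"
  shows "linear_map n (extend n E)"
  unfolding linear_map_def extend_def
  using assms
  by (auto simp: fun_eq_iff algebra_simps sum.distrib sum_distrib_left intro!: V_sum)

subsection \<open>Bilinear maps\<close>

lemma bilinear_mapD:
  assumes "bilinear_map n B"
  shows bilinear_left: "y \<in> V n \<Longrightarrow> linear_map n (\<lambda>x. B x y)"
    and bilinear_right: "x \<in> V n \<Longrightarrow> linear_map n (\<lambda>y. B x y)"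
    and bilinear_V: "x \<in> V n \<Longrightarrow> y \<in> V n \<Longrightarrow> B x y \<in> V n"
  using assms by (auto simp: bilinear_map_def linear_map_def)

lemma bilinear_expand:
  assumes B: "bilinear_map n B" and "x \<in> V n" "y \<in> V n"
  shows "B x y k = (\<Sum>i=1..n. \<Sum>j=1..n. x i * y j * B (e i) (e j) k)"
proof -
  have "B x y = (\<Sum>i=1..n. x i *\<^sub>V B (e i) y)"
    by (rule linear_map_expand[OF bilinear_left[OF B]]) (use assms in auto)
  also have "\<dots> = (\<Sum>i=1..n. x i *\<^sub>V (\<Sum>j=1..n. y j *\<^sub>V B (e i) (e j)))"
    by (intro sum.cong refl arg_cong[of _ _ "scale _"] linear_map_expand[OF bilinear_right[OF B]])
      (use assms in auto)
  finally show ?thesis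
    by (simp add: sum_distrib_left mult.assoc)
qed

lemma bilinear_eqI:
  assumes "bilinear_map n B" "bilinear_map n B'"
    "\<And>i j. \<lbrakk>1 \<le> i; i \<le> n; 1 \<le> j; j \<le> n\<rbrakk> \<Longrightarrow> B (e i) (e j) = B' (e i) (e j)"
    "x \<in> V n" "y \<in> V n"
  shows "B x y = B' x y"
  by (rule ext) (simp add: bilinear_expand[OF assms(1,4,5)] bilinear_expand[OF assms(2,4,5)] assms(3))

text \<open>
  In the expansion over the basis, the pair of the two leading basis vectors is the only one that reaches degree
  \<open>a + b + l\<close>, and no pair reaches a lower degree.
\<close>
lemma bilinear_filtered:
  assumes B: "bilinear_map n B"
    and raise: "\<And>i j. \<lbrakk>1 \<le> i; i \<le> n; 1 \<le> j; j \<le> n\<rbrakk> \<Longrightarrow> B (e i) (e j) \<in> Fil n (i + j + l)"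
    and x: "x \<in> Fil n a" and y: "y \<in> Fil n b"
  shows "B x y \<in> Fil n (a + b + l)"
    and "B x y (a + b + l) = x a * y b * B (e a) (e b) (a + b + l)"
proof -
  have term0: "x i * y j * B (e i) (e j) k = 0"
    if "i \<in> {1..n}" "j \<in> {1..n}" "k \<le> a + b + l" "k < a + b + l \<or> i \<noteq> a \<or> j \<noteq> b" for i j k
  proof (cases "a \<le> i \<and> b \<le> j")
    case True
    then have "k < i + j + l" using that by auto
    then show ?thesis using Fil_below[OF raise[of i j]] that by simp
  next
    case False
    then show ?thesis using Fil_below[OF x, of i] Fil_below[OF y, of j] by auto
  qed
  note ex = bilinear_expand[OF B Fil_V[OF x] Fil_V[OF y]]
  show "B x y \<in> Fil n (a + b + l)"
    unfolding Fil_def using bilinear_V[OF B Fil_V[OF x] Fil_V[OF y]]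
    by (auto simp: ex intro!: sum.neutral term0)
  show "B x y (a + b + l) = x a * y b * B (e a) (e b) (a + b + l)"
  proof (cases "a \<in> {1..n} \<and> b \<in> {1..n}")
    case True
    have "B x y (a + b + l) = (\<Sum>i=1..n. if i = a then x a * y b * B (e a) (e b) (a + b + l) else 0)"
      unfolding ex
    proof (rule sum.cong[OF refl])
      fix i assume i: "i \<in> {1..n}"
      have "(\<Sum>j=1..n. x i * y j * B (e i) (e j) (a + b + l))
        = (\<Sum>j=1..n. if j = b then (if i = a then x a * y b * B (e a) (e b) (a + b + l) else 0) else 0)"
        by (rule sum.cong[OF refl]) (use i term0 in auto)
      then show "(\<Sum>j=1..n. x i * y j * B (e i) (e j) (a + b + l))
        = (if i = a then x a * y b * B (e a) (e b) (a + b + l) else 0)"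
        using True by simp
    qed
    then show ?thesis using True by simp
  next
    case False
    then have "x a * y b = 0"
      using V_outside[OF Fil_V[OF x], of a] V_outside[OF Fil_V[OF y], of b] by auto
    moreover have "B x y (a + b + l) = 0"
      unfolding ex by (intro sum.neutral ballI term0) (use False in auto)
    ultimately show ?thesis by simp
  qed
qed

section \<open>Filtered Lie brackets and their generators\<close>

lemma Fil_degree_0: "x \<in> V n \<Longrightarrow> x \<in> Fil n 0"
  by (simp add: Fil_def)

lemma linear_map_leading:
  assumes f: "linear_map n f"
    and tri: "\<And>i. \<lbrakk>1 \<le> i; i \<le> n\<rbrakk> \<Longrightarrow> f (e i) \<in> Fil n i"
    and x: "x \<in> Fil n a"
  shows "f x \<in> Fil n a" and "f x a = x a * f (e a) a"
proof -
  have ex: "f x k = (\<Sum>i=1..n. x i * f (e i) k)" for k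
    using linear_map_expand[OF f Fil_V[OF x]] by simp
  have z: "x i * f (e i) k = 0" if "i \<in> {1..n}" "k \<le> a" "k < a \<or> i \<noteq> a" for i k
    using that Fil_below[OF x, of i] Fil_below[OF tri[of i], of k] by (cases "i < a") auto
  show "f x \<in> Fil n a"
    using linear_map_V[OF f Fil_V[OF x]] by (auto simp: Fil_def ex intro!: sum.neutral z)
  show "f x a = x a * f (e a) a"
  proof (cases "a \<in> {1..n}")
    case True
    have "f x a = (\<Sum>i=1..n. if i = a then x a * f (e a) a else 0)"
      unfolding ex by (rule sum.cong[OF refl]) (use z in auto)
    then show ?thesis using True by simp
  next
    case False
    then show ?thesis
      using V_outside[OF linear_map_V[OF f Fil_V[OF x]], of a] V_outside[OF Fil_V[OF x], of a] by simp
  qed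
qed

text \<open>
  The linear maps that induce the identity on the graded pieces of the filtration.
\<close>
locale unitriangular =
  fixes n :: nat and f :: "('k::field) vect \<Rightarrow> 'k vect"
  assumes linear: "linear_map n f"
    and basis_Fil: "\<lbrakk>1 \<le> i; i \<le> n\<rbrakk> \<Longrightarrow> f (e i) \<in> Fil n i"
    and basis_lead: "\<lbrakk>1 \<le> i; i \<le> n\<rbrakk> \<Longrightarrow> f (e i) i = 1"
begin

lemma Fil_image: "x \<in> Fil n a \<Longrightarrow> f x \<in> Fil n a"
  by (rule linear_map_leading(1)[OF linear basis_Fil])

lemma lead: "x \<in> Fil n a \<Longrightarrow> f x a = x a"
proof (cases "a \<in> {1..n}")
  case True
  moreover assume "x \<in> Fil n a"
  ultimately show ?thesis
    using linear_map_leading(2)[OF linear basis_Fil, of x a] basis_lead[of a] by simp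
next
  case False
  moreover assume "x \<in> Fil n a"
  ultimately show ?thesis
    using V_outside[OF Fil_V[OF Fil_image], of x a] V_outside[OF Fil_V, of x n a a] by simp
qed

lemma inj: "inj_on f (V n)"
proof (rule inj_onI)
  fix x y assume xy: "x \<in> V n" "y \<in> V n" "f x = f y"
  define z where "z = x - y"
  have z: "z \<in> V n" "f z = 0"
    using linear_map_diff[OF linear] xy by (auto simp: z_def)
  have "z \<in> Fil n a" for a
  proof (induction a)
    case 0
    show ?case by (rule Fil_degree_0[OF z(1)])
  next
    case (Suc a)
    then show ?case using lead[OF Suc] z(2) by (auto intro: Fil_Suc)
  qed
  from Fil_beyond[OF this[of "Suc n"]] show "x = y" by (simp add: z_def)
qed

lemma surj_Fil: "y \<in> Fil n a \<Longrightarrow> \<exists>x\<in>Fil n a. f x = y"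
proof (induction "Suc n - a" arbitrary: a y)
  case 0
  then have "y = 0" using Fil_beyond[of y n a] by simp
  then show ?case using linear_map_0[OF linear] Fil_0 by blast
next
  case (Suc d)
  define x0 where "x0 = y a *\<^sub>V e a"
  have x0: "x0 \<in> Fil n a"
  proof (cases "a \<in> {1..n}")
    case True
    then show ?thesis unfolding x0_def by (intro Fil_scale Fil_e) auto
  next
    case False
    then show ?thesis using V_outside[OF Fil_V[OF Suc.prems], of a] by (simp add: x0_def)
  qed
  have "y - f x0 \<in> Fil n (Suc a)"
    by (rule Fil_Suc) (use Suc Fil_image[OF x0] lead[OF x0] in \<open>auto simp: x0_def e_apply intro: Fil_diff\<close>)
  moreover have "d = Suc n - Suc a" using Suc.hyps(2) by arith
  ultimately obtain z where z: "z \<in> Fil n (Suc a)" "f z = y - f x0"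
    using Suc.hyps(1) by blast
  have "f (x0 + z) = y"
    using z linear_map_add[OF linear Fil_V[OF x0] Fil_V[OF z(1)]] by simp
  moreover have "x0 + z \<in> Fil n a"
    using x0 Fil_mono[OF z(1), of a] by (auto intro: Fil_add)
  ultimately show ?case by blast
qed

lemma bij: "bij_betw f (V n) (V n)"
  unfolding bij_betw_def
  using inj linear_map_V[OF linear] surj_Fil[of _ 1] by (force simp: V_eq_Fil)

end

text \<open>
  Prescribing only the leading terms makes the notion independent of how the remainder splits into homogeneous
  components. The arguments by leading coefficients below see nothing else.
\<close>
locale filtered_bracket =
  fixes n :: nat and B :: "('k::field_char_0) bimap"
  assumes lie: "lie_bracket n B"
    and basis_Fil: "\<lbrakk>1 \<le> i; i \<le> n; 1 \<le> j; j \<le> n\<rbrakk> \<Longrightarrow> B (e i) (e j) \<in> Fil n (i + j)"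
    and basis_lead: "\<lbrakk>1 \<le> i; 1 \<le> j; i + j \<le> n\<rbrakk> \<Longrightarrow> B (e i) (e j) (i + j) = of_nat j - of_nat i"
begin

lemma bilinear: "bilinear_map n B"
  using lie by (simp add: lie_bracket_def)

lemmas left = bilinear_left[OF bilinear] and right = bilinear_right[OF bilinear]
  and closed = bilinear_V[OF bilinear]

lemma alternating: "x \<in> V n \<Longrightarrow> B x x = 0"
  using lie by (simp add: lie_bracket_def)

lemma jacobi: "\<lbrakk>x \<in> V n; y \<in> V n; z \<in> V n\<rbrakk> \<Longrightarrow> B x (B y z) + B y (B z x) + B z (B x y) = 0"
  using lie by (simp add: lie_bracket_def)

lemma skew: assumes "x \<in> V n" "y \<in> V n" shows "B y x = - B x y"
proof -
  have "0 = B (x + y) (x + y)" using assms alternating[of "x + y"] by simp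
  also have "\<dots> = B x y + B y x"
    using assms by (simp add: linear_map_add[OF left] linear_map_add[OF right] alternating[OF assms(1)]
        alternating[OF assms(2)])
  finally show ?thesis by (simp add: eq_neg_iff_add_eq_0 add.commute)
qed

lemma bracket_Fil: "x \<in> Fil n a \<Longrightarrow> y \<in> Fil n b \<Longrightarrow> B x y \<in> Fil n (a + b)"
  using bilinear_filtered(1)[OF bilinear, where l=0] basis_Fil by simp

lemma bracket_lead:
  assumes "x \<in> Fil n a" "y \<in> Fil n b" "a + b \<le> n"
  shows "B x y (a + b) = (of_nat b - of_nat a) * x a * y b"
proof (cases "1 \<le> a \<and> 1 \<le> b")
  case True
  then show ?thesis
    using bilinear_filtered(2)[OF bilinear, where l=0] basis_Fil basis_lead assms by simp
next
  case False
  then have "a = 0 \<or> b = 0" by auto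
  then have "x a * y b = 0"
    using V_outside[OF Fil_V[OF assms(1)], of 0] V_outside[OF Fil_V[OF assms(2)], of 0] by auto
  then show ?thesis
    using bilinear_filtered(2)[OF bilinear, where l=0 and x=x and y=y and a=a and b=b]
      basis_Fil assms by auto
qed

text \<open>
  The bracket of the two perturbations has degree \<open>2 * l\<close>, so in degree \<open>l\<close> only the two first-order terms remain.
\<close>
lemma bracket_change:
  assumes x: "x \<in> Fil n a" "x' - x \<in> Fil n (a + l)"
    and y: "y \<in> Fil n b" "y' - y \<in> Fil n (b + l)"
  shows "B x' y' - B x y \<in> Fil n (a + b + l)"
    and "1 \<le> l \<Longrightarrow> a + b + l \<le> n \<Longrightarrow> (B x' y' - B x y) (a + b + l)
      = (of_nat b - of_nat a - of_nat l) * (x' - x) (a + l) * y b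
        + (of_nat b + of_nat l - of_nat a) * x a * (y' - y) (b + l)"
proof -
  define p q where "p = x' - x" and "q = y' - y"
  have p: "p \<in> Fil n (a + l)" and q: "q \<in> Fil n (b + l)" using x y by (auto simp: p_def q_def)
  note mem = Fil_V[OF x(1)] Fil_V[OF p] Fil_V[OF y(1)] Fil_V[OF q]
  have eq: "B x' y' - B x y = B p y + B x q + B p q"
  proof -
    have "x' = x + p" "y' = y + q" by (auto simp: p_def q_def)
    then show ?thesis
      using mem by (simp add: linear_map_add[OF left] linear_map_add[OF right])
  qed
  have f: "B p y \<in> Fil n (a + b + l)" "B x q \<in> Fil n (a + b + l)" "B p q \<in> Fil n (a + b + l + l)"
    using bracket_Fil[OF p y(1)] bracket_Fil[OF x(1) q] bracket_Fil[OF p q] by (simp_all add: ac_simps)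
  then show "B x' y' - B x y \<in> Fil n (a + b + l)"
    unfolding eq using Fil_mono[OF f(3), of "a + b + l"] by (auto intro: Fil_add)
  assume l: "1 \<le> l" "a + b + l \<le> n"
  then have "B p q (a + b + l) = 0" using Fil_below[OF f(3)] by simp
  then show "(B x' y' - B x y) (a + b + l)
      = (of_nat b - of_nat a - of_nat l) * (x' - x) (a + l) * y b
        + (of_nat b + of_nat l - of_nat a) * x a * (y' - y) (b + l)"
    using bracket_lead[OF p y(1)] bracket_lead[OF x(1) q] l
    by (simp add: eq p_def[symmetric] q_def[symmetric] ac_simps diff_diff_eq)
qed

end

text \<open>
  The role of \<open>e\<^sub>j\<close> for the generators \<open>u\<close>, \<open>v\<close> in place of \<open>e\<^sub>1\<close>, \<open>e\<^sub>2\<close>: the factor is such that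
  \<open>B u E\<^sub>j = (j - 1) E\<^sub>j\<^sub>+\<^sub>1\<close> for \<open>j \<ge> 2\<close>. The value at 0 is arbitrary.
\<close>
fun generated :: "('k::field) bimap \<Rightarrow> 'k vect \<Rightarrow> 'k vect \<Rightarrow> nat \<Rightarrow> 'k vect" where
  "generated B u v 0 = 0"
| "generated B u v (Suc 0) = u"
| "generated B u v (Suc (Suc 0)) = v"
| "generated B u v (Suc (Suc (Suc j))) =
     (1 / of_nat (Suc j)) *\<^sub>V B u (generated B u v (Suc (Suc j)))"

lemma generated_12 [simp]: "generated B u v 1 = u" "generated B u v 2 = v"
  by (simp_all add: numeral_eq_Suc)

definition adapted :: "nat \<Rightarrow> ('k::field) vect \<Rightarrow> 'k vect \<Rightarrow> bool" where
  "adapted n u v \<longleftrightarrow> u \<in> Fil n 1 \<and> u 1 = 1 \<and> v \<in> Fil n 2 \<and> v 2 = 1"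

context filtered_bracket
begin

lemma generated_step:
  assumes "2 \<le> j"
  shows "B u (generated B u v j) = of_nat (j - 1) *\<^sub>V generated B u v (Suc j)"
proof -
  obtain i where "j = Suc (Suc i)" using assms by (metis add_2_eq_Suc le_Suc_ex)
  then show ?thesis by (simp add: fun_eq_iff del: of_nat_Suc)
qed

lemma generated_leading:
  assumes uv: "adapted n u v" and "1 \<le> j"
  shows "generated B u v j \<in> Fil n j \<and> (j \<le> n \<longrightarrow> generated B u v j j = 1)"
  using assms(2)
proof (induction j rule: less_induct)
  case (less j)
  consider "j = 1" | "j = 2" | i where "j = Suc i" "2 \<le> i"
    using less.prems by (metis One_nat_def Suc_leI le_neq_implies_less not0_implies_Suc not_less_eq_eq numeral_2_eq_2 zero_less_Suc)
  then show ?case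
  proof cases
    case 3
    let ?E = "generated B u v"
    have i: "?E i \<in> Fil n i" "i \<le> n \<longrightarrow> ?E i i = 1" using less.IH[of i] 3 by auto
    have u: "u \<in> Fil n 1" "u 1 = 1" using uv by (auto simp: adapted_def)
    have Ej: "?E j = (1 / of_nat (i - 1)) *\<^sub>V B u (?E i)"
      using generated_step[OF 3(2), of u v] 3 by (simp add: fun_eq_iff)
    have "B u (?E i) \<in> Fil n j" using bracket_Fil[OF u(1) i(1)] 3 by simp
    moreover have "B u (?E i) j = of_nat (i - 1)" if "j \<le> n"
      using bracket_lead[OF u(1) i(1)] i u 3 that by (simp add: of_nat_diff)
    ultimately show ?thesis
      unfolding Ej using 3 by (intro conjI Fil_scale) auto
  qed (use uv in \<open>auto simp: adapted_def\<close>)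
qed

text \<open>
  The defect of the relation \<open>[e\<^sub>2, e\<^sub>3] = e\<^sub>5\<close> for the elements generated by \<open>u\<close> and \<open>v\<close>.
\<close>
definition relation5 :: "'k vect \<Rightarrow> 'k vect \<Rightarrow> 'k vect" where
  "relation5 u v = B v (generated B u v 3) - generated B u v 5"

lemma generated_change:
  assumes uv: "adapted n u v" and "1 \<le> l"
    and "u' - u \<in> Fil n (1 + l)" "v' - v \<in> Fil n (2 + l)" and "1 \<le> j"
  shows "generated B u' v' j - generated B u v j \<in> Fil n (j + l)"
proof -
  let ?E = "generated B u v" and ?E' = "generated B u' v'"
  define D where "D i = ?E' i - ?E i" for i
  have D12: "D 1 = u' - u" "D 2 = v' - v" by (simp_all add: D_def)
  have "D j \<in> Fil n (j + l)"
    using \<open>1 \<le> j\<close>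
  proof (induction j rule: less_induct)
    case (less j)
    consider "j = 1" | "j = 2" | i where "j = Suc i" "2 \<le> i"
      using less.prems by (metis One_nat_def Suc_leI le_neq_implies_less not0_implies_Suc not_less_eq_eq numeral_2_eq_2 zero_less_Suc)
    then show ?case
    proof cases
      case 1
      then show ?thesis using D12(1) assms(3) by metis
    next
      case 2
      then show ?thesis using D12(2) assms(4) by metis
    next
      case 3
      have "?E' i - ?E i \<in> Fil n (i + l)"
        using less.IH[of i] 3 by (simp flip: D_def)
      then have "B u' (?E' i) - B u (?E i) \<in> Fil n (1 + i + l)"
        by (intro bracket_change) (use uv assms 3 generated_leading[OF uv, of i] in \<open>auto simp: adapted_def\<close>)
      moreover have "D j = (1 / of_nat (i - 1)) *\<^sub>V (B u' (?E' i) - B u (?E i))"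
        using generated_step[OF 3(2), of u v] generated_step[OF 3(2), of u' v'] 3
        by (simp add: D_def fun_eq_iff field_simps)
      ultimately show ?thesis using 3 by (metis Fil_scale add.commute plus_1_eq_Suc)
    qed
  qed
  then show ?thesis by (simp only: D_def)
qed

lemma generated_change_lead:
  assumes uv: "adapted n u v" and l: "1 \<le> l"
    and d: "u' - u \<in> Fil n (1 + l)" "v' - v \<in> Fil n (2 + l)" and j: "2 \<le> j" "Suc j + l \<le> n"
  shows "of_nat (j - 1) * (generated B u' v' (Suc j) - generated B u v (Suc j)) (Suc j + l)
    = (of_nat j - 1 - of_nat l) * (u' - u) (1 + l)
      + (of_nat j + of_nat l - 1) * (generated B u' v' j - generated B u v j) (j + l)"
proof -
  let ?E = "generated B u v" and ?E' = "generated B u' v'"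
  have u: "u \<in> Fil n 1" "u 1 = 1" using uv by (auto simp: adapted_def)
  have E: "?E j \<in> Fil n j" "?E j j = 1" using generated_leading[OF uv, of j] j by auto
  have "(B u' (?E' j) - B u (?E j)) (1 + j + l)
    = (of_nat j - of_nat 1 - of_nat l) * (u' - u) (1 + l) * ?E j j
      + (of_nat j + of_nat l - of_nat 1) * u 1 * (?E' j - ?E j) (j + l)"
    by (rule bracket_change(2)) (use u d E l j generated_change[OF uv l d] in auto)
  moreover have "B u' (?E' j) - B u (?E j) = of_nat (j - 1) *\<^sub>V (?E' (Suc j) - ?E (Suc j))"
    using generated_step[OF j(1), of u v] generated_step[OF j(1), of u' v'] by (simp add: fun_eq_iff algebra_simps)
  ultimately show ?thesis using u E by simp
qed

text \<open>
  With \<open>t\<close>, \<open>s\<close> the changes of the generators in degree \<open>l\<close>, the right-hand side is zero exactly when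
  \<open>(t, s)\<close> is a multiple of \<open>(1 - l, 2 - l)\<close>, that is, when the change agrees with a multiple of \<open>ad e\<^sub>l\<close>.
\<close>
lemma relation5_change:
  assumes uv: "adapted n u v" and l: "1 \<le> l"
    and d: "u' - u \<in> Fil n (1 + l)" "v' - v \<in> Fil n (2 + l)"
  shows "relation5 u' v' - relation5 u v \<in> Fil n (5 + l)"
    and "5 + l \<le> n \<Longrightarrow> 6 * (relation5 u' v' - relation5 u v) (5 + l)
      = (of_nat l ^ 2 + of_nat l + 6)
        * ((of_nat l - 2) * (u' - u) (1 + l) - (of_nat l - 1) * (v' - v) (2 + l))"
proof -
  let ?E = "generated B u v" and ?E' = "generated B u' v'"
  have v: "v \<in> Fil n 2" "v 2 = 1" using uv by (auto simp: adapted_def)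
  note ch = generated_change[OF uv l d]
  have E3: "?E 3 \<in> Fil n 3" "3 \<le> n \<Longrightarrow> ?E 3 3 = 1" using generated_leading[OF uv, of 3] by auto
  have eq: "relation5 u' v' - relation5 u v = (B v' (?E' 3) - B v (?E 3)) - (?E' 5 - ?E 5)"
    by (simp add: relation5_def)
  have "B v' (?E' 3) - B v (?E 3) \<in> Fil n (2 + 3 + l)"
    by (rule bracket_change) (use v d E3 ch in auto)
  then show "relation5 u' v' - relation5 u v \<in> Fil n (5 + l)"
    unfolding eq using ch[of 5] Fil_diff by fastforce
  assume n: "5 + l \<le> n"
  define t s d3 d4 d5 L where "t = (u' - u) (1 + l)" and "s = (v' - v) (2 + l)"
    and "d3 = (?E' 3 - ?E 3) (3 + l)" and "d4 = (?E' 4 - ?E 4) (4 + l)"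
    and "d5 = (?E' 5 - ?E 5) (5 + l)" and "L = (of_nat l :: 'k)"
  note defs = t_def s_def d3_def d4_def d5_def L_def
  have r: "d3 = (1 - L) * t + (1 + L) * s" "2 * d4 = (2 - L) * t + (2 + L) * d3"
    "3 * d5 = (3 - L) * t + (3 + L) * d4"
    using generated_change_lead[OF uv l d, of 2] generated_change_lead[OF uv l d, of 3]
      generated_change_lead[OF uv l d, of 4] n
    unfolding defs by (simp_all add: eval_nat_numeral algebra_simps)
  have "(B v' (?E' 3) - B v (?E 3)) (2 + 3 + l)
    = (of_nat 3 - of_nat 2 - of_nat l) * (v' - v) (2 + l) * ?E 3 3
      + (of_nat 3 + of_nat l - of_nat 2) * v 2 * (?E' 3 - ?E 3) (3 + l)"
    by (rule bracket_change(2)) (use v d E3 l n ch in auto)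
  then have "(relation5 u' v' - relation5 u v) (5 + l) = (1 - L) * s + (1 + L) * d3 - d5"
    unfolding eq using v E3 n unfolding defs by simp
  then have "6 * (relation5 u' v' - relation5 u v) (5 + l) = (L^2 + L + 6) * ((L - 2) * t - (L - 1) * s)"
    using r by algebra
  then show "6 * (relation5 u' v' - relation5 u v) (5 + l)
      = (of_nat l ^ 2 + of_nat l + 6)
        * ((of_nat l - 2) * (u' - u) (1 + l) - (of_nat l - 1) * (v' - v) (2 + l))"
    by (simp add: defs)
qed

lemma degree_factor_nonzero: "of_nat l ^ 2 + of_nat l + 6 \<noteq> (0::'k)"
proof -
  have "of_nat l ^ 2 + of_nat l + 6 = (of_nat (l ^ 2 + l + 6) :: 'k)" by simp
  then show ?thesis by (metis add_is_0 of_nat_eq_0_iff zero_neq_numeral)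
qed

text \<open>
  Changing both generators by the same amount \<open>t\<close> changes the relation by a nonzero multiple of
  \<open>((l - 2) - (l - 1)) t = - t\<close>, in every degree. So its coefficients can be removed one after the other.
\<close>
theorem adapted_pair_exists:
  assumes n: "5 \<le> n"
  obtains u v where "adapted n u v" "relation5 u v = 0"
proof -
  have "\<exists>u v. adapted n u v \<and> relation5 u v \<in> Fil n (5 + l)" if "1 \<le> l" for l
    using that
  proof (induction l rule: dec_induct)
    case base
    have uv: "adapted n (e 1) (e 2)" using n by (auto simp: adapted_def e_apply intro!: Fil_e)
    have e2: "e 2 \<in> Fil n 2" "e 2 2 = (1::'k)" using uv by (auto simp: adapted_def)
    have "relation5 (e 1) (e 2) \<in> Fil n 5" "relation5 (e 1) (e 2) 5 = 0"
      using e2 bracket_Fil[of "e 2" 2 "generated B (e 1) (e 2) 3" 3]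
        bracket_lead[of "e 2" 2 "generated B (e 1) (e 2) 3" 3]
        generated_leading[OF uv, of 3] generated_leading[OF uv, of 5] n
      by (auto simp: relation5_def intro: Fil_diff)
    from Fil_Suc[OF this] uv show ?case by auto
  next
    case (step l)
    then obtain u v where uv: "adapted n u v" and r: "relation5 u v \<in> Fil n (5 + l)" by blast
    show ?case
    proof (cases "5 + l \<le> n")
      case False
      then have "relation5 u v = 0" using Fil_beyond[OF r] by simp
      then show ?thesis using uv by (metis Fil_0)
    next
      case True
      \<comment> \<open>The two constants are those of \<open>relation5_change\<close>.\<close>
      define t where "t = 6 * relation5 u v (5 + l) / (of_nat l ^ 2 + of_nat l + 6)"
      define u' v' where "u' = u + t *\<^sub>V e (1 + l)" and "v' = v + t *\<^sub>V e (2 + l)"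
      have d: "u' - u \<in> Fil n (1 + l)" "v' - v \<in> Fil n (2 + l)"
        using True by (auto simp: u'_def v'_def intro!: Fil_scale Fil_e)
      have uv': "adapted n u' v'"
        using uv step True unfolding adapted_def u'_def v'_def
        by (auto simp: e_apply intro!: Fil_add Fil_scale Fil_e)
      have "(relation5 u' v' - relation5 u v) (5 + l) = - relation5 u v (5 + l)"
      proof -
        have "6 * (relation5 u' v' - relation5 u v) (5 + l)
          = - ((of_nat l ^ 2 + of_nat l + 6) * t)"
          using relation5_change(2)[OF uv step(1) d True]
          by (simp add: u'_def v'_def e_apply algebra_simps)
        also have "\<dots> = - (6 * relation5 u v (5 + l))"
          using degree_factor_nonzero[of l] by (simp add: t_def)
        finally show ?thesis by simp
      qed
      then have "relation5 u' v' (5 + l) = 0" by simp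
      moreover have "relation5 u' v' \<in> Fil n (5 + l)"
        using Fil_add[OF r relation5_change(1)[OF uv step(1) d]] by simp
      ultimately have "relation5 u' v' \<in> Fil n (5 + Suc l)"
        using Fil_Suc[of "relation5 u' v'" n "5 + l"] by simp
      then show ?thesis using uv' by blast
    qed
  qed
  from this[of n] n obtain u v where uv: "adapted n u v" and r: "relation5 u v \<in> Fil n (5 + n)"
    by auto
  show thesis by (rule that[OF uv Fil_beyond[OF r]]) simp
qed

end

section \<open>The bracket of V and its deformations\<close>

lemma bilinear_map_from_basis:
  assumes "\<And>i j. \<lbrakk>1 \<le> i; i \<le> n; 1 \<le> j; j \<le> n\<rbrakk> \<Longrightarrow> b i j \<in> V n"
  shows "bilinear_map n (\<lambda>x y. \<Sum>i\<in>{1..n}. \<Sum>j\<in>{1..n}. (x i * y j) *\<^sub>V b i j)"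
  unfolding bilinear_map_def linear_map_def using assms
  by (auto intro!: V_sum simp: fun_eq_iff algebra_simps sum.distrib sum_distrib_left)

lemma bilinear_Vbracket: "bilinear_map n (Vbracket n)"
  unfolding Vbracket_def[abs_def] by (rule bilinear_map_from_basis) auto

lemma Vbracket_e:
  assumes "1 \<le> i" "i \<le> n" "1 \<le> j" "j \<le> n"
  shows "Vbracket n (e i) (e j) = (if i + j \<le> n then (of_nat j - of_nat i) *\<^sub>V e (i + j) else 0)"
proof -
  have "Vbracket n (e i) (e j) = (\<Sum>i'\<in>{1..n}. e i i' *\<^sub>V (\<Sum>j'\<in>{1..n}. e j j' *\<^sub>V
      (if i' + j' \<le> n then (of_nat j' - of_nat i') *\<^sub>V e (i' + j') else 0)))"
    by (rule ext) (simp add: Vbracket_def sum_distrib_left mult.assoc)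
  then show ?thesis
    using assms by (simp add: extend_e[unfolded extend_def] del: One_nat_def)
qed

lemma bilinear_plus:
  assumes "bilinear_map n B" "bilinear_map n B'" shows "bilinear_map n (B + B')"
  using assms linear_map_plus unfolding bilinear_map_def plus_fun_def by fastforce

lemma bilinear_smult:
  assumes "bilinear_map n B" shows "bilinear_map n (\<lambda>x y. c *\<^sub>V B x y)"
  using assms linear_map_smult unfolding bilinear_map_def by fast

lemma bilinear_flip_neg:
  assumes "bilinear_map n B" shows "bilinear_map n (\<lambda>x y. - B y x)"
  using assms linear_map_neg unfolding bilinear_map_def by fast

lemma trilinear_eq_0:
  assumes "\<And>y z. \<lbrakk>y \<in> V n; z \<in> V n\<rbrakk> \<Longrightarrow> linear_map n (\<lambda>x. T x y z)"
    and "\<And>x z. \<lbrakk>x \<in> V n; z \<in> V n\<rbrakk> \<Longrightarrow> linear_map n (\<lambda>y. T x y z)"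
    and "\<And>x y. \<lbrakk>x \<in> V n; y \<in> V n\<rbrakk> \<Longrightarrow> linear_map n (\<lambda>z. T x y z)"
    and "\<And>i j k. \<lbrakk>1 \<le> i; i \<le> n; 1 \<le> j; j \<le> n; 1 \<le> k; k \<le> n\<rbrakk> \<Longrightarrow> T (e i) (e j) (e k) = 0"
    and "x \<in> V n" "y \<in> V n" "z \<in> V n"
  shows "T x y z = 0"
proof -
  have 1: "T x (e j) (e k) = 0" if "x \<in> V n" "1 \<le> j" "j \<le> n" "1 \<le> k" "k \<le> n" for x j k
    by (rule linear_map_eqI[OF assms(1) linear_map_zero]) (use that assms(4) in auto)
  have 2: "T x y (e k) = 0" if "x \<in> V n" "y \<in> V n" "1 \<le> k" "k \<le> n" for x y k
    by (rule linear_map_eqI[OF assms(2) linear_map_zero]) (use that 1 in auto)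
  show ?thesis
    by (rule linear_map_eqI[OF assms(3)[OF assms(5,6)] linear_map_zero _ assms(7)])
      (rule 2[OF assms(5,6)])
qed

lemma skew_imp_alternating:
  fixes B :: "'k::field_char_0 bimap"
  assumes "skew_symmetric n B" "x \<in> V n" shows "B x x = 0"
proof (rule ext)
  fix k
  have "B x x = - B x x" using assms unfolding skew_symmetric_def by blast
  from fun_cong[OF this, of k] show "B x x k = 0 k" by simp
qed

lemma skew_symmetricI:
  assumes "bilinear_map n B"
    and "\<And>i j. \<lbrakk>1 \<le> i; i \<le> n; 1 \<le> j; j \<le> n\<rbrakk> \<Longrightarrow> B (e i) (e j) = - B (e j) (e i)"
  shows "skew_symmetric n B"
  unfolding skew_symmetric_def
  using bilinear_eqI[OF assms(1) bilinear_flip_neg[OF assms(1)]] assms(2) by blast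

lemma skew_Vbracket: "skew_symmetric n (Vbracket n)"
  by (rule skew_symmetricI[OF bilinear_Vbracket])
    (auto simp: Vbracket_e fun_eq_iff algebra_simps)

lemma skew_plus:
  fixes B B' :: "('a::field) bimap"
  assumes "skew_symmetric n B" "skew_symmetric n B'" shows "skew_symmetric n (B + B')"
  unfolding skew_symmetric_def
proof (intro ballI)
  fix x y :: "'a vect" assume "x \<in> V n" "y \<in> V n"
  then have "B x y = - B y x" "B' x y = - B' y x"
    using assms unfolding skew_symmetric_def by blast+
  then have "B x y + B' x y = - (B y x + B' y x)" by (metis minus_add_distrib)
  then show "(B + B') x y = - (B + B') y x" by simp
qed

definition jacobiator :: "('k::field) bimap \<Rightarrow> 'k bimap \<Rightarrow> 'k vect \<Rightarrow> 'k vect \<Rightarrow> 'k vect \<Rightarrow> 'k vect" where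
  "jacobiator B B' x y z = B x (B' y z) + B y (B' z x) + B z (B' x y)"

lemma trilinear_jacobiator:
  assumes "bilinear_map n B" "bilinear_map n B'"
  shows "\<lbrakk>y \<in> V n; z \<in> V n\<rbrakk> \<Longrightarrow> linear_map n (\<lambda>x. jacobiator B B' x y z)"
    and "\<lbrakk>x \<in> V n; z \<in> V n\<rbrakk> \<Longrightarrow> linear_map n (\<lambda>y. jacobiator B B' x y z)"
    and "\<lbrakk>x \<in> V n; y \<in> V n\<rbrakk> \<Longrightarrow> linear_map n (\<lambda>z. jacobiator B B' x y z)"
proof -
  note l = bilinear_left[OF assms(1)] bilinear_right[OF assms(1)]
    and l' = bilinear_left[OF assms(2)] bilinear_right[OF assms(2)]
    and c = bilinear_V[OF assms(2)]
  note lc = linear_map_comp[OF l(2)]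
  show "\<lbrakk>y \<in> V n; z \<in> V n\<rbrakk> \<Longrightarrow> linear_map n (\<lambda>x. jacobiator B B' x y z)"
    unfolding jacobiator_def by (intro linear_map_plus l(1) lc l' c)
  show "\<lbrakk>x \<in> V n; z \<in> V n\<rbrakk> \<Longrightarrow> linear_map n (\<lambda>y. jacobiator B B' x y z)"
    unfolding jacobiator_def by (intro linear_map_plus l(1) lc l' c)
  show "\<lbrakk>x \<in> V n; y \<in> V n\<rbrakk> \<Longrightarrow> linear_map n (\<lambda>z. jacobiator B B' x y z)"
    unfolding jacobiator_def by (intro linear_map_plus l(1) lc l' c)
qed

lemma linear_map_scaled_e:
  assumes "linear_map n f" "1 \<le> i" "i \<le> n"
  shows "f (c *\<^sub>V e i) = c *\<^sub>V f (e i)"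
  using linear_map_scale[OF assms(1)] assms by simp

lemma Vbracket_e_e:
  assumes "1 \<le> i" "i \<le> n" "1 \<le> j" "j \<le> n" "1 \<le> k" "k \<le> n"
  shows "Vbracket n (e i) (Vbracket n (e j) (e k))
    = (if i + j + k \<le> n then ((of_nat k - of_nat j) * (of_nat j + of_nat k - of_nat i)) *\<^sub>V e (i + j + k) else 0)"
proof -
  have lin: "linear_map n (\<lambda>y. Vbracket n (e i) y)"
    using assms by (intro bilinear_right[OF bilinear_Vbracket]) auto
  show ?thesis
  proof (cases "j + k \<le> n")
    case True
    have "Vbracket n (e i) ((of_nat k - of_nat j) *\<^sub>V e (j + k)) = (of_nat k - of_nat j) *\<^sub>V Vbracket n (e i) (e (j + k))"
      by (rule linear_map_scaled_e[OF lin]) (use assms True in auto)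
    also have "\<dots> = (if i + j + k \<le> n
        then ((of_nat k - of_nat j) * (of_nat j + of_nat k - of_nat i)) *\<^sub>V e (i + j + k) else 0)"
      using assms True by (auto simp: Vbracket_e fun_eq_iff add.assoc)
    finally show ?thesis using assms True by (simp add: Vbracket_e)
  next
    case False
    then show ?thesis using assms linear_map_0[OF lin] by (simp add: Vbracket_e)
  qed
qed

lemma jacobi_Vbracket:
  assumes "x \<in> V n" "y \<in> V n" "z \<in> V n"
  shows "jacobiator (Vbracket n) (Vbracket n) x y z = 0"
proof (rule trilinear_eq_0[OF trilinear_jacobiator[OF bilinear_Vbracket bilinear_Vbracket] _ assms])
  fix i j k assume "1 \<le> i" "i \<le> n" "1 \<le> j" "j \<le> n" "1 \<le> k" "k \<le> n"
  then show "jacobiator (Vbracket n) (Vbracket n) (e i) (e j) (e k) = 0"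
    by (auto simp: jacobiator_def Vbracket_e_e fun_eq_iff algebra_simps)
qed

lemma deformed_is_filtered:
  fixes B :: "'k::field_char_0 bimap"
  assumes "B \<in> deformed_brackets n"
  shows "filtered_bracket n B"
proof -
  obtain \<Psi> where B: "B = Vbracket n + \<Psi>" and \<Psi>: "filtered_deformation n \<Psi>"
    using assms by (auto simp: deformed_brackets_def)
  from \<Psi> obtain \<Psi>l where hom: "\<And>l. 1 \<le> l \<Longrightarrow> homogeneous n l (\<Psi>l l)"
    and sum: "\<And>x y. \<lbrakk>x \<in> V n; y \<in> V n\<rbrakk> \<Longrightarrow> \<Psi> x y = (\<Sum>l\<in>{1..n}. \<Psi>l l x y)"
    by (auto simp: filtered_deformation_def)
  have F: "\<Psi> (e i) (e j) \<in> Fil n (Suc (i + j))" if ij: "1 \<le> i" "i \<le> n" "1 \<le> j" "j \<le> n" for i j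
  proof -
    have "\<Psi>l l (e i) (e j) \<in> Fil n (Suc (i + j))" if l: "l \<in> {1..n}" for l
    proof -
      obtain c where "\<Psi>l l (e i) (e j) = (if i + j + l \<le> n then c i j *\<^sub>V e (i + j + l) else 0)"
        using hom[of l] l ij unfolding homogeneous_def by fastforce
      moreover have "i + j + l \<le> n \<Longrightarrow> c i j *\<^sub>V e (i + j + l) \<in> Fil n (Suc (i + j))"
        using l ij by (intro Fil_scale Fil_e) auto
      ultimately show ?thesis by (simp del: scale_apply)
    qed
    then have "(\<Sum>l\<in>{1..n}. \<Psi>l l (e i) (e j)) \<in> Fil n (Suc (i + j))"
      by (rule Fil_sum)
    then show ?thesis using sum[of "e i" "e j"] ij by (simp del: sum_apply)
  qed
  show ?thesis
  proof
    show "lie_bracket n B" using \<Psi> B by (simp add: filtered_deformation_def)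
  next
    fix i j assume ij: "1 \<le> i" "i \<le> n" "1 \<le> j" "j \<le> n"
    have "Vbracket n (e i) (e j) \<in> Fil n (i + j)"
      using ij by (auto simp: Vbracket_e intro!: Fil_scale Fil_e)
    then have "Vbracket n (e i) (e j) + \<Psi> (e i) (e j) \<in> Fil n (i + j)"
      using Fil_mono[OF F[OF ij], of "i + j"] by (auto intro: Fil_add)
    then show "B (e i) (e j) \<in> Fil n (i + j)" by (simp add: B)
  next
    fix i j :: nat assume "1 \<le> i" "1 \<le> j" "i + j \<le> n"
    then show "B (e i) (e j) (i + j) = of_nat j - of_nat i"
      using Fil_below[OF F[of i j], of "i + j"] by (simp add: B Vbracket_e e_apply)
  qed
qed

section \<open>Comparing two filtered brackets\<close>

text \<open>
  In the application \<open>B0\<close> is the expected normal form of \<open>B\<close> and \<open>f\<close> sends the basis to the elements generated by an adapted pair.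
\<close>
locale bracket_comparison =
  src: filtered_bracket n B0 + tgt: filtered_bracket n B + tri: unitriangular n f
  for n :: nat and B0 B :: "('k::field_char_0) bimap" and f :: "'k vect \<Rightarrow> 'k vect"
begin

definition defect :: "'k bimap" where
  "defect x y = B (f x) (f y) - f (B0 x y)"

lemma fV: "x \<in> V n \<Longrightarrow> f x \<in> V n"
  using linear_map_V[OF tri.linear] .

lemma bilinear_defect: "bilinear_map n defect"
  unfolding bilinear_map_def defect_def
  by (intro conjI ballI linear_map_minus)
    (auto intro: linear_map_comp[OF tri.linear] linear_map_comp[OF tgt.left tri.linear]
      linear_map_comp[OF tgt.right tri.linear] src.left src.right fV)

lemma skew_defect: "\<lbrakk>x \<in> V n; y \<in> V n\<rbrakk> \<Longrightarrow> defect y x = - defect x y"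
  using tgt.skew[of "f x" "f y"] src.skew[of x y] linear_map_uminus[OF tri.linear, of "B0 x y"]
    src.closed[of x y] fV by (simp add: defect_def)

text \<open>
  In the Jacobi identity of \<open>B\<close> replace each inner bracket \<open>B (f x) (f y)\<close> by
  \<open>defect x y + f (B0 x y)\<close>; the Jacobi identity of \<open>B0\<close> removes what does not involve the defect. Since the outer
  bracket with \<open>f z\<close> is kept, the result is exactly linear in the defect.
\<close>
lemma defect_cocycle:
  assumes "x \<in> V n" "y \<in> V n" "z \<in> V n"
  shows "B (defect x y) (f z) + defect (B0 x y) z + (B (defect y z) (f x) + defect (B0 y z) x)
    + (B (defect z x) (f y) + defect (B0 z x) y) = 0"
proof -
  have single: "B (defect x y) (f z) + defect (B0 x y) z = - B (f z) (B (f x) (f y)) + f (B0 z (B0 x y))"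
    if "x \<in> V n" "y \<in> V n" "z \<in> V n" for x y z
  proof -
    have "B (defect x y) (f z) = B (B (f x) (f y)) (f z) - B (f (B0 x y)) (f z)"
      unfolding defect_def using that
      by (intro linear_map_diff[OF tgt.left]) (auto intro: fV tgt.closed src.closed)
    moreover have "B (B (f x) (f y)) (f z) = - B (f z) (B (f x) (f y))"
      using that by (intro tgt.skew) (auto intro: fV tgt.closed)
    moreover have "f (B0 (B0 x y) z) = - f (B0 z (B0 x y))"
      using src.skew[of z "B0 x y"] linear_map_uminus[OF tri.linear, of "B0 z (B0 x y)"] src.closed that
      by simp
    ultimately show ?thesis by (simp add: defect_def)
  qed
  have "f (B0 z (B0 x y)) + f (B0 x (B0 y z)) + f (B0 y (B0 z x)) = f (B0 z (B0 x y) + B0 x (B0 y z) + B0 y (B0 z x))"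
    using assms linear_map_add[OF tri.linear] src.closed by simp
  also have "\<dots> = 0"
    using src.jacobi[OF assms] linear_map_0[OF tri.linear] by (simp add: ac_simps)
  finally have 1: "f (B0 z (B0 x y)) + f (B0 x (B0 y z)) + f (B0 y (B0 z x)) = 0" .
  have 2: "B (f z) (B (f x) (f y)) + B (f x) (B (f y) (f z)) + B (f y) (B (f z) (f x)) = 0"
    using tgt.jacobi[of "f x" "f y" "f z"] assms fV by (simp add: ac_simps)
  have "(- B (f z) (B (f x) (f y)) + f (B0 z (B0 x y))) + (- B (f x) (B (f y) (f z)) + f (B0 x (B0 y z)))
      + (- B (f y) (B (f z) (f x)) + f (B0 y (B0 z x)))
    = (f (B0 z (B0 x y)) + f (B0 x (B0 y z)) + f (B0 y (B0 z x)))
      - (B (f z) (B (f x) (f y)) + B (f x) (B (f y) (f z)) + B (f y) (B (f z) (f x)))"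
    by (simp add: algebra_simps)
  then show ?thesis
    unfolding single[OF assms] single[OF assms(2,3,1)] single[OF assms(3,1,2)] 1 2 by simp
qed

definition raises :: "nat \<Rightarrow> bool" where
  "raises l \<longleftrightarrow> (\<forall>i\<in>{1..n}. \<forall>j\<in>{1..n}. defect (e i) (e j) \<in> Fil n (i + j + l))"

lemma raisesD:
  "\<lbrakk>raises l; 1 \<le> i; i \<le> n; 1 \<le> j; j \<le> n\<rbrakk> \<Longrightarrow> defect (e i) (e j) \<in> Fil n (i + j + l)"
  by (simp add: raises_def)

lemma raises_one: "raises 1"
  unfolding raises_def
proof (intro ballI)
  fix i j assume ij: "i \<in> {1..n}" "j \<in> {1..n}"
  then have "f (e i) \<in> Fil n i" "f (e j) \<in> Fil n j" using tri.basis_Fil by auto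
  then have "B (f (e i)) (f (e j)) \<in> Fil n (i + j)"
    and 1: "i + j \<le> n \<Longrightarrow> B (f (e i)) (f (e j)) (i + j) = of_nat j - of_nat i"
    using tgt.bracket_Fil tgt.bracket_lead ij tri.basis_lead by auto
  moreover have "f (B0 (e i) (e j)) \<in> Fil n (i + j)"
    and 2: "i + j \<le> n \<Longrightarrow> f (B0 (e i) (e j)) (i + j) = of_nat j - of_nat i"
    using tri.Fil_image tri.lead src.basis_Fil src.basis_lead ij by auto
  ultimately have "defect (e i) (e j) \<in> Fil n (i + j)" by (simp add: defect_def Fil_diff)
  moreover have "i + j \<le> n \<Longrightarrow> defect (e i) (e j) (i + j) = 0" using 1 2 by (simp add: defect_def)
  ultimately have "defect (e i) (e j) \<in> Fil n (Suc (i + j))" by (intro Fil_SucI) auto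
  then show "defect (e i) (e j) \<in> Fil n (i + j + 1)" by simp
qed

text \<open>
  The coefficient of \<open>e\<^sub>i\<^sub>+\<^sub>j\<^sub>+\<^sub>k\<^sub>+\<^sub>l\<close> in \<open>defect_cocycle\<close> on \<open>e\<^sub>i, e\<^sub>j, e\<^sub>k\<close>.
\<close>
lemma leading_coefficients:
  assumes l: "raises l"
    and one: "\<And>j. \<lbrakk>1 \<le> j; j \<le> n\<rbrakk> \<Longrightarrow> defect (e 1) (e j) = 0"
    and two_three: "5 \<le> n \<Longrightarrow> defect (e 2) (e 3) = 0"
  shows "truncated_cocycle (n - l) l (\<lambda>i j. defect (e i) (e j) (i + j + l))"
proof
  have deg: "\<And>i j. \<lbrakk>1 \<le> i; i \<le> n; 1 \<le> j; j \<le> n\<rbrakk> \<Longrightarrow> defect (e i) (e j) \<in> Fil n (i + j + l)"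
    using l by (auto simp: raises_def)
  {
    fix i j :: nat assume "1 \<le> i" "1 \<le> j" "i + j \<le> n - l"
    then show "defect (e j) (e i) (j + i + l) = - defect (e i) (e j) (i + j + l)"
      using skew_defect[of "e i" "e j"] by (simp add: add.commute)
  next
    fix j :: nat assume "1 \<le> j" "1 + j \<le> n - l"
    then show "defect (e 1) (e j) (1 + j + l) = 0" using one[of j] by simp
  next
    assume "5 \<le> n - l"
    then show "defect (e 2) (e 3) (2 + 3 + l) = 0" using two_three by simp
  next
    have single: "(B (defect (e i) (e j)) (f (e k)) + defect (B0 (e i) (e j)) (e k)) (i + j + k + l)
      = (of_nat k - of_nat i - of_nat j - of_nat l) * defect (e i) (e j) (i + j + l)
        + (of_nat j - of_nat i) * defect (e (i + j)) (e k) (i + j + k + l)"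
      if "1 \<le> i" "1 \<le> j" "1 \<le> k" "i + j + k + l \<le> n" for i j k
    proof -
      have "B (defect (e i) (e j)) (f (e k)) (i + j + l + k)
          = (of_nat k - of_nat (i + j + l)) * defect (e i) (e j) (i + j + l) * f (e k) k"
        using that by (intro tgt.bracket_lead deg tri.basis_Fil) auto
      then have 1: "B (defect (e i) (e j)) (f (e k)) (i + j + k + l)
          = (of_nat k - of_nat i - of_nat j - of_nat l) * defect (e i) (e j) (i + j + l)"
        using tri.basis_lead[of k] that by (simp add: ac_simps diff_diff_eq)
      have "defect (B0 (e i) (e j)) (e k) (i + j + k + l)
          = B0 (e i) (e j) (i + j) * e k k * defect (e (i + j)) (e k) (i + j + k + l)"
        using that by (intro bilinear_filtered(2)[OF bilinear_defect] deg src.basis_Fil Fil_e) auto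
      then have 2: "defect (B0 (e i) (e j)) (e k) (i + j + k + l)
          = (of_nat j - of_nat i) * defect (e (i + j)) (e k) (i + j + k + l)"
        using src.basis_lead[of i j] that by (simp add: e_apply)
      show ?thesis using 1 2 by simp
    qed
    fix i j k :: nat assume ijk: "1 \<le> i" "1 \<le> j" "1 \<le> k" "i + j + k \<le> n - l"
    then have n: "i + j + k + l \<le> n" by simp
    define X where "X i j k = B (defect (e i) (e j)) (f (e k)) + defect (B0 (e i) (e j)) (e k)" for i j k
    have X: "X i j k (i + j + k + l) = (of_nat k - of_nat i - of_nat j - of_nat l) * defect (e i) (e j) (i + j + l)
        + (of_nat j - of_nat i) * defect (e (i + j)) (e k) (i + j + k + l)"
      "X j k i (i + j + k + l) = (of_nat i - of_nat j - of_nat k - of_nat l) * defect (e j) (e k) (j + k + l)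
        + (of_nat k - of_nat j) * defect (e (j + k)) (e i) (j + k + i + l)"
      "X k i j (i + j + k + l) = (of_nat j - of_nat k - of_nat i - of_nat l) * defect (e k) (e i) (k + i + l)
        + (of_nat i - of_nat k) * defect (e (k + i)) (e j) (k + i + j + l)"
      using single[OF ijk(1-3) n] single[of j k i] single[of k i j] ijk n
      unfolding X_def by (simp_all only: ac_simps)
    have "X i j k + X j k i + X k i j = 0"
      unfolding X_def by (rule defect_cocycle) (use ijk n in auto)
    from fun_cong[OF this, of "i + j + k + l"]
    have "X i j k (i + j + k + l) + X j k i (i + j + k + l) + X k i j (i + j + k + l) = 0"
      by simp
    then show "(of_nat k - of_nat i - of_nat j - of_nat l) * defect (e i) (e j) (i + j + l)
      + (of_nat j - of_nat i) * defect (e (i + j)) (e k) (i + j + k + l)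
      + (of_nat i - of_nat j - of_nat k - of_nat l) * defect (e j) (e k) (j + k + l)
      + (of_nat k - of_nat j) * defect (e (j + k)) (e i) (j + k + i + l)
      + (of_nat j - of_nat k - of_nat i - of_nat l) * defect (e k) (e i) (k + i + l)
      + (of_nat i - of_nat k) * defect (e (k + i)) (e j) (k + i + j + l) = 0"
      unfolding X by (simp only: add.assoc)
  }
qed

lemma raises_Suc:
  assumes l: "raises l" "1 \<le> l"
    and one: "\<And>j. \<lbrakk>1 \<le> j; j \<le> n\<rbrakk> \<Longrightarrow> defect (e 1) (e j) = 0"
    and two_three: "5 \<le> n \<Longrightarrow> defect (e 2) (e 3) = 0"
    and five: "defect (e 2) (e 5) = 0 \<or> 16 \<le> n \<and> l + 12 \<le> n"
  shows "raises (Suc l)"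
proof -
  let ?c = "\<lambda>i j. defect (e i) (e j) (i + j + l)"
  interpret truncated_cocycle "n - l" l ?c
    by (rule leading_coefficients[OF l(1) one two_three])
  have "?c 2 5 = 0"
  proof (cases "defect (e 2) (e 5) = 0")
    case False
    then show ?thesis using five l(2) two_five by auto
  qed simp
  then have "?c i j = 0" if "1 \<le> i" "1 \<le> j" "i + j \<le> n - l" for i j
    using vanishing that by blast
  then show ?thesis
    using l(1) unfolding raises_def by (auto intro!: Fil_SucI)
qed

text \<open>
  A defect on \<open>(e\<^sub>2, e\<^sub>5)\<close> cannot start below degree \<open>n - 11\<close>, and without it there is no defect in any degree.
\<close>
lemma raises_upto:
  assumes one: "\<And>j. \<lbrakk>1 \<le> j; j \<le> n\<rbrakk> \<Longrightarrow> defect (e 1) (e j) = 0"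
    and two_three: "5 \<le> n \<Longrightarrow> defect (e 2) (e 3) = 0"
    and five: "defect (e 2) (e 5) = 0 \<or> 16 \<le> n \<and> m + 11 \<le> n"
    and "1 \<le> m"
  shows "raises m"
proof -
  have "m' \<le> m \<Longrightarrow> raises m'" if "1 \<le> m'" for m'
    using that
  proof (induction m' rule: dec_induct)
    case base
    show ?case by (rule raises_one)
  next
    case (step l)
    then show ?case using five by (intro raises_Suc one two_three) auto
  qed
  then show ?thesis using assms(4) by blast
qed

lemma homomorphism:
  assumes one: "\<And>j. \<lbrakk>1 \<le> j; j \<le> n\<rbrakk> \<Longrightarrow> defect (e 1) (e j) = 0"
    and two_three: "5 \<le> n \<Longrightarrow> defect (e 2) (e 3) = 0"
    and five: "defect (e 2) (e 5) = 0"
    and xy: "x \<in> V n" "y \<in> V n"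
  shows "f (B0 x y) = B (f x) (f y)"
proof -
  have "raises (Suc n)" using raises_upto[OF one two_three] five by simp
  then have "defect (e i) (e j) = 0" if "1 \<le> i" "i \<le> n" "1 \<le> j" "j \<le> n" for i j
    using that Fil_beyond[of "defect (e i) (e j)" n "i + j + Suc n"] by (auto simp: raises_def)
  moreover have "bilinear_map n (\<lambda>x y. 0)"
    by (simp add: bilinear_map_def linear_map_zero)
  ultimately have "defect x y = 0"
    by (rule bilinear_eqI[OF bilinear_defect _ _ xy, rotated])
  then show ?thesis by (simp add: defect_def)
qed

end

section \<open>The basic cocycles\<close>

lemma of_nat_choose_small:
  fixes m :: nat
  defines "M \<equiv> (of_nat m :: 'k::field_char_0)"
  shows "of_nat (m choose 2) = (M * (M - 1) / 2 :: 'k)"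
    and "of_nat (m choose 3) = (M * (M - 1) * (M - 2) / 6 :: 'k)"
    and "of_nat (m choose 4) = (M * (M - 1) * (M - 2) * (M - 3) / 24 :: 'k)"
  by (simp_all add: M_def binomial_gbinomial gbinomial_prod_rev eval_nat_numeral mult.assoc)

lemma wedge_e: "wedge p q (e a) (e b)
    = (if a = p \<and> b = q then 1 else 0) - (if b = p \<and> a = q then 1 else 0 :: 'k::field)"
  unfolding wedge_def e_apply by (cases "a = p"; cases "b = q"; cases "b = p"; cases "a = q") simp_all

text \<open>
  The forms \<open>\<xi>\<^sub>p\<close> live on disjoint sets of pairs, since \<open>\<xi>\<^sub>p\<close> only sees \<open>(e\<^sub>a, e\<^sub>b)\<close> with \<open>a + b = 7 + p\<close>. Hence
  their sum carries the coefficients of all basic cocycles with the same \<open>j = n - s\<close>; the number \<open>s\<close>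
  only determines at which weight it is cut off.
\<close>
definition cochain :: "nat \<Rightarrow> nat \<Rightarrow> nat \<Rightarrow> 'k::field" where
  "cochain j a b = xi0 (e a) (e b) + xi1 j (e a) (e b) + xi2 j (e a) (e b)
    + xi3 j (e a) (e b) + xi4 j (e a) (e b)"

lemma wedge_weight: "a + b \<noteq> p + q \<Longrightarrow> wedge p q (e a) (e b) = (0 :: 'k::field)"
  by (auto simp: wedge_e)

lemma xi_weight:
  fixes j :: nat
  shows "a + b \<noteq> 7 \<Longrightarrow> xi0 (e a) (e b) = (0 :: 'k::field)"
    and "a + b \<noteq> 8 \<Longrightarrow> xi1 j (e a) (e b) = (0 :: 'k)"
    and "a + b \<noteq> 9 \<Longrightarrow> xi2 j (e a) (e b) = (0 :: 'k)"
    and "a + b \<noteq> 10 \<Longrightarrow> xi3 j (e a) (e b) = (0 :: 'k)"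
    and "a + b \<noteq> 11 \<Longrightarrow> xi4 j (e a) (e b) = (0 :: 'k)"
  by (simp_all add: xi0_def xi1_def xi2_def xi3_def xi4_def wedge_weight)

lemma cochain_skew: "cochain j b a = - (cochain j a b :: 'k::field)"
  by (simp add: cochain_def xi0_def xi1_def xi2_def xi3_def xi4_def wedge_def algebra_simps)

lemma cochain_one: "cochain j 1 b = (0 :: 'k::field)" "cochain j (Suc 0) b = (0 :: 'k::field)"
  by (simp_all add: cochain_def xi0_def xi1_def xi2_def xi3_def xi4_def wedge_e)

lemma cochain_low: "a + b < 7 \<Longrightarrow> cochain j a b = (0 :: 'k::field)"
  by (simp add: cochain_def xi_weight)

lemma xi_cochain: "1 \<le> p \<Longrightarrow> p \<le> 4 \<Longrightarrow>
    xi p j (e a) (e b) = (if a + b = 7 + p then cochain j a b else 0 :: 'k::field)"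
  and xi0_cochain: "xi0 (e a) (e b) = (if a + b = 7 then cochain j a b else 0 :: 'k::field)"
proof -
  assume "1 \<le> p" "p \<le> 4"
  then consider "p = 1" | "p = 2" | "p = 3" | "p = 4" by linarith
  then show "xi p j (e a) (e b) = (if a + b = 7 + p then cochain j a b else 0 :: 'k::field)"
    by cases (auto simp: xi_def cochain_def xi_weight)
qed (auto simp: cochain_def xi_weight)

text \<open>
  The coefficient of \<open>e\<^sub>i\<^sub>+\<^sub>j\<^sub>+\<^sub>k\<^sub>+\<^sub>l\<close> in \<open>[e\<^sub>i, \<psi>(e\<^sub>j, e\<^sub>k)] + \<psi>(e\<^sub>i, [e\<^sub>j, e\<^sub>k])\<close> for the basic cocycle
  \<open>\<psi>\<close> of degree \<open>l\<close>; its index is \<open>j = l + 7\<close>.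
\<close>
definition coboundary :: "nat \<Rightarrow> nat \<Rightarrow> nat \<Rightarrow> nat \<Rightarrow> 'k::field" where
  "coboundary l i j k =
     (of_nat j + of_nat k + of_nat l - of_nat i) * cochain (l + 7) j k
     + (of_nat k - of_nat j) * cochain (l + 7) i (j + k)"

text \<open>
  In terms of the degree \<open>l\<close> the binomial coefficients disappear and the cocycle conditions become polynomial
  identities in one variable.
\<close>
lemma coefficient_polynomials:
  fixes l :: nat
  defines "L \<equiv> (of_nat l :: 'k::field_char_0)"
  shows "P1 (l + 7) = (5 * L^2 + 71 * L + 240) / 42"
    and "P2 (l + 7) = - (2 * L^2 + 41 * L + 159) / 21"
    and "P3 (l + 7) = - (13 * L^2 + 109 * L + 246) / 42"
    and "Q1 (l + 7) = (L^3 + 25 * L^2 + 198 * L + 496) / 56"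
    and "Q2 (l + 7) = (L^3 - 3 * L^2 - 166 * L - 624) / 84"
    and "Q3 (l + 7) = - (13 * L^3 + 213 * L^2 + 1118 * L + 1968) / 168"
    and "Z1 (l + 7) = (21 * L^4 + 814 * L^3 + 11255 * L^2 + 65518 * L + 135408) / 11088"
    and "Z2 (l + 7) = (51 * L^4 + 1034 * L^3 + 4969 * L^2 - 7582 * L - 63984) / 11088"
    and "Z3 (l + 7) = - (29 * L^4 + 902 * L^3 + 9215 * L^2 + 39014 * L + 59568) / 3696"
    and "Z4 (l + 7) = - (141 * L^4 + 2750 * L^3 + 20695 * L^2 + 69590 * L + 91824) / 11088"
  unfolding P1_def P2_def P3_def Q1_def Q2_def Q3_def Z1_def Z2_def Z3_def Z4_def
    of_nat_choose_small
  by (simp_all add: L_def[symmetric] field_simps power2_eq_square power3_eq_cube power4_eq_xxxx)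

lemma coboundary_cyclic_ordered:
  assumes "1 \<le> i" "i < j" "j < k" "i + j + k \<le> 11"
  shows "coboundary l i j k + coboundary l j k i + coboundary l k i j = (0 :: 'k::field_char_0)"
proof -
  consider "i = 1" "j = 2" "k = 3" | "i = 1" "j = 2" "k = 4" | "i = 1" "j = 2" "k = 5"
    | "i = 1" "j = 2" "k = 6" | "i = 1" "j = 2" "k = 7" | "i = 1" "j = 2" "k = 8"
    | "i = 1" "j = 3" "k = 4" | "i = 1" "j = 3" "k = 5" | "i = 1" "j = 3" "k = 6" | "i = 1" "j = 3" "k = 7"
    | "i = 1" "j = 4" "k = 5" | "i = 1" "j = 4" "k = 6"
    | "i = 2" "j = 3" "k = 4" | "i = 2" "j = 3" "k = 5" | "i = 2" "j = 3" "k = 6"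
    | "i = 2" "j = 4" "k = 5"
  proof -
    have "i = 1 \<or> i = 2" "j = 2 \<or> j = 3 \<or> j = 4"
      "k = 3 \<or> k = 4 \<or> k = 5 \<or> k = 6 \<or> k = 7 \<or> k = 8"
      using assms by linarith+
    then show thesis using assms that by (elim disjE) simp_all
  qed
  note c = this
  define L where "L = (of_nat l :: 'k)"
  note defs = coboundary_def cochain_def xi0_def xi1_def xi2_def xi3_def xi4_def wedge_e
  note polys = coefficient_polynomials[where 'k='k and l=l, folded L_def]
  from c show ?thesis
    by cases (simp_all add: defs polys L_def[symmetric] field_simps power2_eq_square power3_eq_cube power4_eq_xxxx)
qed

lemma coboundary_swap: "coboundary l i k j = - (coboundary l i j k :: 'k::field)"
  by (simp add: coboundary_def cochain_skew[of _ k j] add.commute[of k j] algebra_simps)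

text \<open>
  The cyclic sum is alternating in its three arguments, so the sixteen ordered triples suffice.
\<close>
lemma coboundary_cyclic:
  assumes "1 \<le> i" "1 \<le> j" "1 \<le> k" "i + j + k \<le> 11"
  shows "coboundary l i j k + coboundary l j k i + coboundary l k i j = (0 :: 'k::field_char_0)"
proof -
  define T :: "nat \<Rightarrow> nat \<Rightarrow> nat \<Rightarrow> 'k" where
    "T i j k = coboundary l i j k + coboundary l j k i + coboundary l k i j" for i j k
  have rot: "T j k i = T i j k" and swap: "T j i k = - T i j k" for i j k
    using coboundary_swap[of l i k j, where 'k='k] coboundary_swap[of l j i k, where 'k='k]
      coboundary_swap[of l k j i, where 'k='k]
    by (simp_all add: T_def algebra_simps)
  have diag: "T i i k = 0" for i k using swap[of i i k] by simp
  have ordered: "T i j k = 0" if "1 \<le> i" "i < j" "j < k" "i + j + k \<le> 11" for i j k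
    using coboundary_cyclic_ordered[OF that] by (simp add: T_def)
  have min: "T i j k = 0" if "1 \<le> i" "i \<le> j" "i \<le> k" "i + j + k \<le> 11" for i j k
  proof -
    consider "i = j" | "i = k" | "j = k" | "i < j" "j < k" | "i < k" "k < j"
      using \<open>i \<le> j\<close> \<open>i \<le> k\<close> by linarith
    then show ?thesis
    proof cases
      case 5
      then have "T i k j = 0" using that by (intro ordered) auto
      moreover have "T i j k = - T i k j" using swap[of i k j] rot[of k i j] rot[of i j k] by simp
      ultimately show ?thesis by simp
    qed (use diag[of i k] diag[of i j] diag[of j i] rot[of i j k] rot[of j k i] rot[of i i j] rot[of i j i]
        ordered[of i j k] that in auto)
  qed
  consider "i \<le> j" "i \<le> k" | "j \<le> i" "j \<le> k" | "k \<le> i" "k \<le> j" by linarith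
  then have "T i j k = 0"
    by cases (use min[of i j k] min[of j k i] min[of k i j] rot[of i j k] rot[of j k i] assms in auto)
  then show ?thesis by (simp add: T_def)
qed

lemma psi_e:
  assumes "s \<le> 4" "s + 7 \<le> n"
  shows "psi n (7 + s) (e a) (e b) = (if a + b \<le> 7 + s then cochain (n - s) a b *\<^sub>V e (a + b + (n - 7 - s)) else 0)"
proof (cases "8 \<le> a + b \<and> a + b \<le> 7 + s")
  case True
  define q where "q = a + b - 7"
  have q: "1 \<le> q" "q \<le> s" "a + b = 7 + q" "n - s + q = a + b + (n - 7 - s)"
    using True assms by (auto simp: q_def)
  have "(\<Sum>p\<in>{1..s}. xi p (n - s) (e a) (e b) *\<^sub>V e (n - s + p))
      = (\<Sum>p\<in>{1..s}. if p = q then cochain (n - s) a b *\<^sub>V e (n - s + p) else (0 :: 'a vect))"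
    by (intro sum.cong refl) (use q assms in \<open>auto simp: xi_cochain\<close>)
  also have "\<dots> = cochain (n - s) a b *\<^sub>V e (a + b + (n - 7 - s))"
    unfolding q(4)[symmetric] using q(1,2) by simp
  finally show ?thesis using True by (simp add: psi_def xi_weight)
next
  case False
  have "(\<Sum>p\<in>{1..s}. xi p (n - s) (e a) (e b) *\<^sub>V e (n - s + p)) = (0 :: 'a vect)"
    by (intro sum.neutral) (use False assms in \<open>auto simp: xi_cochain\<close>)
  moreover have "a + b = 7 \<Longrightarrow> a + b + (n - 7 - s) = n - s" using assms by simp
  ultimately show ?thesis using False by (auto simp: psi_def xi0_cochain[of a b "n - s"] cochain_low)
qed

definition bilinear_form :: "(('k::field) vect \<Rightarrow> 'k vect \<Rightarrow> 'k) \<Rightarrow> bool" where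
  "bilinear_form \<omega> \<longleftrightarrow> (\<forall>x x' y. \<omega> (x + x') y = \<omega> x y + \<omega> x' y) \<and> (\<forall>x y y'. \<omega> x (y + y') = \<omega> x y + \<omega> x y')
     \<and> (\<forall>c x y. \<omega> (c *\<^sub>V x) y = c * \<omega> x y) \<and> (\<forall>c x y. \<omega> x (c *\<^sub>V y) = c * \<omega> x y)"

lemma bilinear_form_xi: "bilinear_form xi0" "bilinear_form (xi p j)"
  by (auto simp: bilinear_form_def xi_def xi0_def xi1_def xi2_def xi3_def xi4_def wedge_def algebra_simps)

lemma bilinear_form_times_vector:
  assumes "bilinear_form \<omega>" "v \<in> V n" shows "bilinear_map n (\<lambda>x y. \<omega> x y *\<^sub>V v)"
  using assms unfolding bilinear_map_def linear_map_def bilinear_form_def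
  by (auto simp: fun_eq_iff algebra_simps)

lemma bilinear_summation:
  assumes "\<And>i. i \<in> A \<Longrightarrow> bilinear_map n (B i)" shows "bilinear_map n (\<lambda>x y. \<Sum>i\<in>A. B i x y)"
  unfolding bilinear_map_def
  by (intro conjI ballI linear_map_summation) (use assms in \<open>auto intro: bilinear_left bilinear_right\<close>)

lemma bilinear_psi:
  assumes "s < n"
  shows "bilinear_map n (psi n (7 + s))"
proof -
  have "bilinear_map n (\<lambda>x y. xi0 x y *\<^sub>V e (n - s))"
    by (rule bilinear_form_times_vector[OF bilinear_form_xi(1)]) (use assms in auto)
  moreover have "bilinear_map n (\<lambda>x y. \<Sum>p\<in>{1..s}. xi p (n - s) x y *\<^sub>V e (n - s + p))"
    by (intro bilinear_summation bilinear_form_times_vector bilinear_form_xi(2)) (use assms in auto)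
  ultimately show ?thesis
    using bilinear_plus unfolding psi_def plus_fun_def by fastforce
qed

lemma homogeneous_psi:
  assumes "s \<le> 4" "s + 7 \<le> n"
  shows "homogeneous n (n - 7 - s) (\<lambda>x y. c *\<^sub>V psi n (7 + s) x y)"
  unfolding homogeneous_def
proof (intro conjI exI ballI)
  show "bilinear_map n (\<lambda>x y. c *\<^sub>V psi n (7 + s) x y)"
    by (intro bilinear_smult bilinear_psi) (use assms in simp)
next
  fix i j assume "i \<in> {1..n}" "j \<in> {1..n}"
  have "(i + j + (n - 7 - s) \<le> n) = (i + j \<le> 7 + s)" using assms by linarith
  then show "c *\<^sub>V psi n (7 + s) (e i) (e j) = (if i + j + (n - 7 - s) \<le> n
      then (c * cochain (n - s) i j) *\<^sub>V e (i + j + (n - 7 - s)) else 0)"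
    using psi_e[OF assms, of i j] by (auto simp: fun_eq_iff simp del: diff_diff_left)
qed

lemma homogeneous_0: "homogeneous n l (\<lambda>x y. 0)"
  by (auto simp: homogeneous_def bilinear_map_def linear_map_zero intro!: exI[of _ "\<lambda>i j. 0"])

text \<open>
  The component that belongs to the basic cocycle with index \<open>7 + s\<close>; the parameters are listed in the opposite order.
\<close>
fun coordinate :: "'k quint \<Rightarrow> nat \<Rightarrow> 'k" where
  "coordinate (x1, x2, x3, x4, x5) s =
     (if s = 4 then x1 else if s = 3 then x2 else if s = 2 then x3 else if s = 1 then x4 else x5)"

lemma Psi_sum: "Psi n x u v = (\<Sum>s\<le>4. coordinate x s *\<^sub>V psi n (7 + s) u v)"
  by (cases x) (simp add: eval_nat_numeral add.commute add.left_commute)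

lemma bilinear_Psi:
  assumes "5 \<le> n" shows "bilinear_map n (Psi n x)"
  unfolding Psi_sum[abs_def]
  by (intro bilinear_summation bilinear_smult bilinear_psi) (use assms in auto)

lemma Psi_e:
  assumes "11 \<le> n"
  shows "Psi n x (e a) (e b) = (\<Sum>s\<le>4. if a + b \<le> 7 + s
    then (coordinate x s * cochain (n - s) a b) *\<^sub>V e (a + b + (n - 7 - s)) else 0)"
  unfolding Psi_sum
  by (intro sum.cong refl) (use assms in \<open>auto simp: psi_e fun_eq_iff\<close>)

lemma skew_Psi:
  assumes "11 \<le> n" shows "skew_symmetric n (Psi n x)"
proof (rule skew_symmetricI)
  fix i j
  show "Psi n x (e i) (e j) = - Psi n x (e j) (e i)"
    unfolding Psi_e[OF assms] sum_negf[symmetric]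
    by (intro sum.cong refl) (simp add: cochain_skew[of _ j i] add.commute[of j i] fun_eq_iff)
qed (rule bilinear_Psi, use assms in simp)

text \<open>
  Both cut-offs agree: a triple contributes exactly if \<open>i + j + k + l \<le> n\<close>, where \<open>l = n - 7 - s\<close> is the degree.
\<close>
lemma Vbracket_psi:
  assumes s: "s \<le> 4" "s + 11 \<le> n" and ijk: "1 \<le> i" "i \<le> n" "1 \<le> j" "j \<le> n" "1 \<le> k" "k \<le> n"
  shows "Vbracket n (e i) (psi n (7 + s) (e j) (e k)) + psi n (7 + s) (e i) (Vbracket n (e j) (e k))
    = (if i + j + k \<le> 7 + s then coboundary (n - 7 - s) i j k *\<^sub>V e (i + j + k + (n - 7 - s)) else (0 :: ('k::field) vect))"
proof -
  define l where "l = n - 7 - s"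
  have l: "n - s = l + 7" "n = l + 7 + s" "1 \<le> l" using s by (auto simp: l_def)
  have lin: "linear_map n (Vbracket n (e i :: 'k vect))" "linear_map n (psi n (7 + s) (e i :: 'k vect))"
    using bilinear_right[OF bilinear_Vbracket, of "e i" n] bilinear_right[OF bilinear_psi, of s n "e i"] s ijk
    by auto
  have 1: "Vbracket n (e i) (psi n (7 + s) (e j) (e k)) = (if i + j + k \<le> 7 + s
      then ((of_nat j + of_nat k + of_nat l - of_nat i) * cochain (l + 7) j k) *\<^sub>V e (i + j + k + l) else (0 :: 'k vect))"
  proof (cases "j + k \<le> 7 + s")
    case True
    have "psi n (7 + s) (e j) (e k) = (cochain (l + 7) j k *\<^sub>V e (j + k + l) :: 'k vect)"
      using psi_e[where 'a='k, of s n j k] s True unfolding l_def[symmetric] l(1) by simp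
    then have "Vbracket n (e i) (psi n (7 + s) (e j) (e k))
        = cochain (l + 7) j k *\<^sub>V Vbracket n (e i) (e (j + k + l) :: 'k vect)"
      using linear_map_scaled_e[OF lin(1), of "j + k + l"] True ijk l by simp
    also have "\<dots> = (if i + j + k \<le> 7 + s
      then ((of_nat j + of_nat k + of_nat l - of_nat i) * cochain (l + 7) j k) *\<^sub>V e (i + j + k + l) else (0 :: 'k vect))"
      using True ijk l by (simp add: Vbracket_e fun_eq_iff add.assoc)
    finally show ?thesis .
  next
    case False
    then show ?thesis using linear_map_0[OF lin(1)] psi_e[where 'a='k, of s n j k] s by simp
  qed
  have 2: "psi n (7 + s) (e i) (Vbracket n (e j) (e k)) = (if i + j + k \<le> 7 + s
      then ((of_nat k - of_nat j) * cochain (l + 7) i (j + k)) *\<^sub>V e (i + j + k + l) else (0 :: 'k vect))"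
  proof (cases "j + k \<le> n")
    case True
    then have "psi n (7 + s) (e i) (Vbracket n (e j) (e k))
        = (of_nat k - of_nat j) *\<^sub>V psi n (7 + s) (e i) (e (j + k) :: 'k vect)"
      using linear_map_scaled_e[OF lin(2), of "j + k"] ijk by (simp add: Vbracket_e)
    also have "\<dots> = (if i + j + k \<le> 7 + s
      then ((of_nat k - of_nat j) * cochain (l + 7) i (j + k)) *\<^sub>V e (i + j + k + l) else (0 :: 'k vect))"
      using psi_e[where 'a='k, of s n i "j + k"] s
      unfolding l_def[symmetric] l(1) by (auto simp: fun_eq_iff add.assoc)
    finally show ?thesis .
  next
    case False
    then show ?thesis using linear_map_0[OF lin(2)] ijk s by (simp add: Vbracket_e)
  qed
  show ?thesis
    unfolding 1 2 l_def[symmetric] by (simp add: coboundary_def fun_eq_iff algebra_simps)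
qed

lemma Psi_cocycle:
  fixes x :: "'k::field_char_0 quint"
  assumes n: "15 \<le> n" and "u \<in> V n" "v \<in> V n" "w \<in> V n"
  shows "jacobiator (Vbracket n) (Psi n x) u v w + jacobiator (Psi n x) (Vbracket n) u v w = 0"
proof (rule trilinear_eq_0[where T = "\<lambda>u v w. jacobiator (Vbracket n) (Psi n x) u v w + jacobiator (Psi n x) (Vbracket n) u v w"])
  note b = bilinear_Vbracket bilinear_Psi[of n x]
  note t = trilinear_jacobiator[OF b] trilinear_jacobiator[OF b(2,1)]
  show "\<lbrakk>v \<in> V n; w \<in> V n\<rbrakk> \<Longrightarrow> linear_map n (\<lambda>u. jacobiator (Vbracket n) (Psi n x) u v w + jacobiator (Psi n x) (Vbracket n) u v w)" for v w
    by (intro linear_map_plus t) (use n in auto)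
  show "\<lbrakk>u \<in> V n; w \<in> V n\<rbrakk> \<Longrightarrow> linear_map n (\<lambda>v. jacobiator (Vbracket n) (Psi n x) u v w + jacobiator (Psi n x) (Vbracket n) u v w)" for u w
    by (intro linear_map_plus t) (use n in auto)
  show "\<lbrakk>u \<in> V n; v \<in> V n\<rbrakk> \<Longrightarrow> linear_map n (\<lambda>w. jacobiator (Vbracket n) (Psi n x) u v w + jacobiator (Psi n x) (Vbracket n) u v w)" for u v
    by (intro linear_map_plus t) (use n in auto)
next
  fix i j k assume ijk: "1 \<le> i" "i \<le> n" "1 \<le> j" "j \<le> n" "1 \<le> k" "k \<le> n"
  define S where "S i j k s = (if i + j + k \<le> 7 + s
      then coboundary (n - 7 - s) i j k *\<^sub>V e (i + j + k + (n - 7 - s)) else (0 :: 'k vect))" for i j k s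
  have single: "Vbracket n (e i) (Psi n x (e j) (e k)) + Psi n x (e i) (Vbracket n (e j) (e k))
      = (\<Sum>s\<le>4. coordinate x s *\<^sub>V S i j k s)"
    if ijk: "1 \<le> i" "i \<le> n" "1 \<le> j" "j \<le> n" "1 \<le> k" "k \<le> n" for i j k
  proof -
    have lin: "linear_map n (Vbracket n (e i :: 'k vect))"
      using bilinear_right[OF bilinear_Vbracket, of "e i" n] ijk by auto
    have mem: "psi n (7 + s) (e j) (e k :: 'k vect) \<in> V n" if "s \<le> 4" for s
      by (intro bilinear_V[OF bilinear_psi] V_e) (use that ijk n in auto)
    have "Vbracket n (e i) (Psi n x (e j) (e k))
        = (\<Sum>s\<le>4. Vbracket n (e i) (coordinate x s *\<^sub>V psi n (7 + s) (e j) (e k)))"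
      unfolding Psi_sum by (rule linear_map_sum[OF lin]) (use mem in auto)
    also have "\<dots> = (\<Sum>s\<le>4. coordinate x s *\<^sub>V Vbracket n (e i) (psi n (7 + s) (e j) (e k)))"
      by (intro sum.cong refl linear_map_scale[OF lin]) (use mem in auto)
    finally have "Vbracket n (e i) (Psi n x (e j) (e k)) + Psi n x (e i) (Vbracket n (e j) (e k))
        = (\<Sum>s\<le>4. coordinate x s *\<^sub>V (Vbracket n (e i) (psi n (7 + s) (e j) (e k))
            + psi n (7 + s) (e i) (Vbracket n (e j) (e k))))"
      by (simp add: Psi_sum fun_eq_iff sum.distrib algebra_simps)
    also have "\<dots> = (\<Sum>s\<le>4. coordinate x s *\<^sub>V S i j k s)"
      unfolding S_def by (intro sum.cong refl arg_cong[of _ _ "scale _"] Vbracket_psi) (use ijk n in auto)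
    finally show ?thesis .
  qed
  have cyc: "S i j k s + S j k i s + S k i j s = 0" if "s \<le> 4" for s
  proof (cases "i + j + k \<le> 7 + s")
    case True
    have "S i j k s + S j k i s + S k i j s = (coboundary (n - 7 - s) i j k + coboundary (n - 7 - s) j k i
        + coboundary (n - 7 - s) k i j) *\<^sub>V e (i + j + k + (n - 7 - s))"
      using True by (simp add: S_def fun_eq_iff algebra_simps del: diff_diff_left)
    then show ?thesis
      using coboundary_cyclic[of i j k "n - 7 - s", where 'k='k] ijk that True by simp
  qed (simp add: S_def ac_simps)
  have "jacobiator (Vbracket n) (Psi n x) (e i) (e j) (e k) + jacobiator (Psi n x) (Vbracket n) (e i) (e j) (e k)
    = (\<Sum>s\<le>4. coordinate x s *\<^sub>V S i j k s) + (\<Sum>s\<le>4. coordinate x s *\<^sub>V S j k i s) + (\<Sum>s\<le>4. coordinate x s *\<^sub>V S k i j s)"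
    unfolding single[OF ijk, symmetric] single[OF ijk(3-6,1,2), symmetric] single[OF ijk(5,6,1-4), symmetric]
    by (simp add: jacobiator_def)
  also have "\<dots> = (\<Sum>s\<le>4. coordinate x s *\<^sub>V (S i j k s + S j k i s + S k i j s))"
    by (simp add: fun_eq_iff sum.distrib algebra_simps)
  also have "\<dots> = 0" using cyc by (intro sum.neutral) auto
  finally show "jacobiator (Vbracket n) (Psi n x) (e i) (e j) (e k) + jacobiator (Psi n x) (Vbracket n) (e i) (e j) (e k) = 0" .
qed fact+


lemma Psi_Fil:
  assumes "15 \<le> n" "u \<in> V n" "v \<in> V n" shows "Psi n x u v \<in> Fil n (n - 4)"
  unfolding Psi_sum psi_def Let_def
  by (intro Fil_sum Fil_scale Fil_add Fil_e) (use assms in auto)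

lemma Psi_eq_0:
  assumes "v \<in> Fil n 10" shows "Psi n x u v = 0"
proof -
  have "wedge p q u v = 0" if "p < 10" "q < 10" for p q
    using Fil_below[OF assms] that by (simp add: wedge_def)
  then have "xi0 u v = 0" "xi p j u v = 0" for p j
    by (simp_all add: xi_def xi0_def xi1_def xi2_def xi3_def xi4_def)
  then show ?thesis by (simp add: Psi_sum psi_def)
qed

lemma jacobiator_plus:
  assumes "bilinear_map n B" "bilinear_map n B'" "x \<in> V n" "y \<in> V n" "z \<in> V n"
  shows "jacobiator (B + B') (B + B') x y z = jacobiator B B x y z
    + (jacobiator B B' x y z + jacobiator B' B x y z) + jacobiator B' B' x y z"
  using assms(3-)
  by (simp add: jacobiator_def bilinear_V[OF assms(1)] bilinear_V[OF assms(2)]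
      linear_map_add[OF bilinear_right[OF assms(1)]] linear_map_add[OF bilinear_right[OF assms(2)]] ac_simps)

text \<open>
  In the Jacobi identity the part linear in \<open>\<Psi>\<close> is \<open>Psi_cocycle\<close>. The quadratic part is zero because \<open>\<Psi>\<close> has
  values in \<open>Fil n (n - 4)\<close>, which lies in \<open>Fil n 10\<close> and so is killed by \<open>\<Psi>\<close>.
\<close>
theorem filtered_deformation_Psi:
  fixes x :: "'k::field_char_0 quint"
  assumes n: "15 \<le> n"
  shows "filtered_deformation n (Psi n x)"
  unfolding filtered_deformation_def
proof (intro conjI)
  have b: "bilinear_map n (Psi n x)" and s: "skew_symmetric n (Psi n x)"
    using n by (auto intro: bilinear_Psi skew_Psi)
  then show "bilinear_map n (Psi n x)" "skew_symmetric n (Psi n x)" by auto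
  define \<Psi>l where "\<Psi>l l = (if n - 11 \<le> l \<and> l \<le> n - 7
      then (\<lambda>u v. coordinate x (n - 7 - l) *\<^sub>V psi n (7 + (n - 7 - l)) u v) else (\<lambda>u v. 0))" for l
  have "homogeneous n l (\<Psi>l l)" if "1 \<le> l" for l
  proof (cases "n - 11 \<le> l \<and> l \<le> n - 7")
    case True
    then show ?thesis
      using homogeneous_psi[of "n - 7 - l" n "coordinate x (n - 7 - l)"] n by (auto simp: \<Psi>l_def)
  qed (auto simp: \<Psi>l_def homogeneous_0)
  moreover have "Psi n x u v = (\<Sum>l\<in>{1..n}. \<Psi>l l u v)" for u v
  proof -
    have "(\<Sum>l\<in>{1..n}. \<Psi>l l u v) = (\<Sum>l\<in>{n - 11..n - 7}. \<Psi>l l u v)"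
      by (rule sum.mono_neutral_right) (use n in \<open>auto simp: \<Psi>l_def\<close>)
    also have "\<dots> = (\<Sum>s\<le>4. coordinate x s *\<^sub>V psi n (7 + s) u v)"
      by (rule sum.reindex_bij_witness[of _ "\<lambda>s. n - 7 - s" "\<lambda>l. n - 7 - l"])
        (use n in \<open>auto simp: \<Psi>l_def\<close>)
    finally show ?thesis by (simp only: Psi_sum)
  qed
  ultimately show "\<exists>\<Psi>l. (\<forall>l\<ge>1. homogeneous n l (\<Psi>l l)) \<and>
      (\<forall>u\<in>V n. \<forall>v\<in>V n. Psi n x u v = (\<Sum>l\<in>{1..n}. \<Psi>l l u v))"
    by blast
  show "lie_bracket n (Vbracket n + Psi n x)"
    unfolding lie_bracket_def
  proof (intro conjI ballI)
    show "bilinear_map n (Vbracket n + Psi n x)"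
      by (rule bilinear_plus[OF bilinear_Vbracket b])
    show "(Vbracket n + Psi n x) u u = 0" if "u \<in> V n" for u
      by (rule skew_imp_alternating[OF skew_plus[OF skew_Vbracket s] that])
    fix u v w :: "'k vect" assume mem: "u \<in> V n" "v \<in> V n" "w \<in> V n"
    have "Psi n x u (Psi n x v w) = 0" if "u \<in> V n" "v \<in> V n" "w \<in> V n" for u v w
      by (rule Psi_eq_0[OF Fil_mono[OF Psi_Fil[OF n that(2,3)]]]) (use n in simp)
    then have "jacobiator (Psi n x) (Psi n x) u v w = 0"
      using mem by (simp add: jacobiator_def)
    then have "jacobiator (Vbracket n + Psi n x) (Vbracket n + Psi n x) u v w = 0"
      unfolding jacobiator_plus[OF bilinear_Vbracket b mem]
      using jacobi_Vbracket[OF mem] Psi_cocycle[OF n mem] by simp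
    then show "(Vbracket n + Psi n x) u ((Vbracket n + Psi n x) v w) + (Vbracket n + Psi n x) v ((Vbracket n + Psi n x) w u)
        + (Vbracket n + Psi n x) w ((Vbracket n + Psi n x) u v) = 0"
      by (simp only: jacobiator_def)
  qed
qed

section \<open>The model brackets\<close>

definition model :: "nat \<Rightarrow> ('k::field) quint \<Rightarrow> 'k bimap" where
  "model n x = Vbracket n + Psi n x"

text \<open>
  The value of \<open>Psi n x\<close> on \<open>(e\<^sub>2, e\<^sub>5)\<close>, from which \<open>x\<close> can be read off.
\<close>
definition tail :: "nat \<Rightarrow> ('k::field) quint \<Rightarrow> 'k vect" where
  "tail n x = (\<Sum>s\<le>4. coordinate x s *\<^sub>V e (n - s))"

lemma filtered_model:
  fixes x :: "'k::field_char_0 quint"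
  assumes "15 \<le> n" shows "filtered_bracket n (model n x)"
  by (rule deformed_is_filtered) (use filtered_deformation_Psi[OF assms, of x] in \<open>auto simp: deformed_brackets_def model_def\<close>)

lemma model_one:
  fixes x :: "'k::field_char_0 quint"
  assumes "15 \<le> n" "1 \<le> j" "j \<le> n"
  shows "model n x (e 1) (e j) = (if j < n then of_nat (j - 1) *\<^sub>V e (Suc j) else 0)"
proof -
  have "Psi n x (e 1) (e j) = 0"
    using assms by (auto simp: Psi_e cochain_one intro!: sum.neutral)
  then show ?thesis using assms by (auto simp: model_def Vbracket_e of_nat_diff)
qed

lemma model_two_three:
  fixes x :: "'k::field_char_0 quint"
  assumes "15 \<le> n" shows "model n x (e 2) (e 3) = e 5"
proof -
  have "Psi n x (e 2) (e 3) = 0"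
    using assms by (auto simp: Psi_e cochain_low intro!: sum.neutral)
  then show ?thesis using assms by (simp add: model_def Vbracket_e)
qed

lemma model_two_five:
  fixes x :: "'k::field_char_0 quint"
  assumes "15 \<le> n" shows "model n x (e 2) (e 5) = 3 *\<^sub>V e 7 + tail n x"
proof -
  have c: "cochain j 2 5 = (1 :: 'k)" for j
    by (simp add: cochain_def xi0_def xi1_def xi2_def xi3_def xi4_def wedge_e)
  have "Psi n x (e 2) (e 5) = tail n x"
    unfolding tail_def
  proof (subst Psi_e, goal_cases)
    case 2
    show ?case by (rule sum.cong[OF refl]) (use assms in \<open>auto simp: c\<close>)
  qed (use assms in simp)
  then show ?thesis using assms by (simp add: model_def Vbracket_e)
qed

lemma tail_apply:
  assumes "5 \<le> n"
  shows "tail n (x1, x2, x3, x4, x5) k = (if k = n - 4 then x1 else if k = n - 3 then x2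
    else if k = n - 2 then x3 else if k = n - 1 then x4 else if k = n then x5 else 0)"
  using assms by (auto simp: tail_def eval_nat_numeral e_apply)

lemma tail_Fil: "5 \<le> n \<Longrightarrow> tail n x \<in> Fil n (n - 4)"
  unfolding tail_def by (intro Fil_sum Fil_scale Fil_e) auto

lemma tail_inj: assumes "5 \<le> n" "tail n x = tail n y" shows "x = y"
proof -
  obtain x1 x2 x3 x4 x5 y1 y2 y3 y4 y5 where "x = (x1, x2, x3, x4, x5)" "y = (y1, y2, y3, y4, y5)"
    by (metis surj_pair)
  moreover obtain m where m: "n = m + 5" using assms(1) by (metis add.commute le_Suc_ex)
  ultimately have "tail (m + 5) (x1, x2, x3, x4, x5) k = tail (m + 5) (y1, y2, y3, y4, y5) k" for k
    using assms(2) by simp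
  from this[of "m + 1"] this[of "m + 2"] this[of "m + 3"] this[of "m + 4"] this[of "m + 5"]
  have "x1 = y1 \<and> x2 = y2 \<and> x3 = y3 \<and> x4 = y4 \<and> x5 = y5"
    by (simp add: tail_apply)
  then show ?thesis using \<open>x = _\<close> \<open>y = _\<close> by simp
qed

lemma tail_surj:
  assumes "5 \<le> n" "w \<in> Fil n (n - 4)" obtains x where "w = tail n x"
proof
  show "w = tail n (w (n - 4), w (n - 3), w (n - 2), w (n - 1), w n)"
  proof (rule ext)
    fix k
    show "w k = tail n (w (n - 4), w (n - 3), w (n - 2), w (n - 1), w n) k"
    proof (cases "n - 4 \<le> k \<and> k \<le> n")
      case True
      then have "k = n - 4 \<or> k = n - 3 \<or> k = n - 2 \<or> k = n - 1 \<or> k = n" by linarith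
      then show ?thesis unfolding tail_apply[OF assms(1)] by auto
    next
      case False
      then have "w k = 0"
        using Fil_below[OF assms(2), of k] V_outside[OF Fil_V[OF assms(2)], of k] by (cases "k < n - 4") auto
      then show ?thesis unfolding tail_apply[OF assms(1)] by auto
    qed
  qed
qed

text \<open>
  The comparison with the undeformed bracket, which has all parameters zero, shows that the defect on
  \<open>(e\<^sub>2, e\<^sub>5)\<close> lies in the span of the last five basis vectors. This determines the parameters \<open>x\<close>, and for the bracket with these
  parameters the defect is zero.
\<close>
theorem normal_form:
  fixes B :: "'k::field_char_0 bimap"
  assumes n: "16 \<le> n" and "filtered_bracket n B"
  obtains x where "lie_isomorphic n (model n x) B"
proof -
  interpret B: filtered_bracket n B by fact
  obtain u v where uv: "adapted n u v" and rel: "B.relation5 u v = 0"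
    by (rule B.adapted_pair_exists) (use n in simp)
  define E where "E = generated B u v"
  define f where "f = extend n E"
  have E: "E j \<in> Fil n j" "j \<le> n \<Longrightarrow> E j j = 1" if "1 \<le> j" for j
    using B.generated_leading[OF uv that] by (auto simp: E_def)
  have fe: "f (e j) = E j" if "1 \<le> j" "j \<le> n" for j
    using extend_e[OF that] by (simp add: f_def)
  have tri: "unitriangular n f"
  proof
    show "linear_map n f" unfolding f_def by (rule linear_map_extend) (use E Fil_V in blast)
  qed (use fe E in auto)
  interpret f: unitriangular n f by (rule tri)
  have cmp: "bracket_comparison n (model n x) B f" for x
    using filtered_model[of n x] n \<open>filtered_bracket n B\<close> tri
    by (auto simp: bracket_comparison_def)
  have one: "B (f (e 1)) (f (e j)) - f (model n x (e 1) (e j)) = 0" if j: "1 \<le> j" "j \<le> n" for x j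
  proof -
    have E1: "f (e 1) = u" using fe[of 1] n by (simp add: E_def)
    have m: "model n x (e 1) (e j) = (if j < n then of_nat (j - 1) *\<^sub>V e (Suc j) else 0)"
      by (rule model_one) (use n j in auto)
    have Bu: "B u (E j) = of_nat (j - 1) *\<^sub>V E (Suc j)"
    proof (cases "j = 1")
      case True
      then show ?thesis using B.alternating[of u] uv Fil_V by (auto simp: E_def adapted_def)
    next
      case False
      then show ?thesis using B.generated_step[of j u v] j by (simp add: E_def)
    qed
    show ?thesis
    proof (cases "j < n")
      case True
      then have "f (of_nat (j - 1) *\<^sub>V e (Suc j)) = of_nat (j - 1) *\<^sub>V E (Suc j)"
        using linear_map_scaled_e[OF f.linear, of "Suc j"] fe[of "Suc j"] by simp
      then show ?thesis unfolding m E1 fe[OF j] using True Bu by simp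
    next
      case False
      then have "E (Suc j) = 0" using Fil_beyond[OF E(1)[of "Suc j"]] j by simp
      then show ?thesis unfolding m E1 fe[OF j] using False Bu linear_map_0[OF f.linear] by simp
    qed
  qed
  have two_three: "B (f (e 2)) (f (e 3)) - f (model n x (e 2) (e 3)) = 0" for x
    using rel fe[of 2] fe[of 3] fe[of 5] n by (simp add: model_two_three B.relation5_def E_def)
  define r where "r = B (f (e 2)) (f (e 5)) - f (3 *\<^sub>V e 7)"
  have two_five: "B (f (e 2)) (f (e 5)) - f (model n x (e 2) (e 5)) = r - f (tail n x)" for x
  proof -
    have "f (3 *\<^sub>V e 7 + tail n x) = f (3 *\<^sub>V e 7) + f (tail n x)"
      by (rule linear_map_add[OF f.linear]) (use n tail_Fil[of n x] Fil_V in auto)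
    then show ?thesis using n by (simp add: model_two_five r_def)
  qed
  have "r \<in> Fil n (n - 4)"
  proof -
    let ?x = "(0, 0, 0, 0, 0) :: 'k quint"
    interpret c: bracket_comparison n "model n ?x" B f by (rule cmp)
    have "c.raises (n - 11)"
      by (rule c.raises_upto) (use one two_three n in \<open>auto simp: c.defect_def\<close>)
    then have "c.defect (e 2) (e 5) \<in> Fil n (2 + 5 + (n - 11))"
      by (rule c.raisesD) (use n in auto)
    moreover have "tail n ?x = 0" by (auto simp: tail_def intro!: sum.neutral)
    ultimately show ?thesis
      using two_five[of ?x] linear_map_0[OF f.linear] n by (simp add: c.defect_def)
  qed
  then obtain w where w: "w \<in> Fil n (n - 4)" "f w = r" using f.surj_Fil by blast
  have "5 \<le> n" using n by simp
  from tail_surj[OF this w(1)] obtain x where "w = tail n x" .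
  then have x: "f (tail n x) = r" using w(2) by simp
  interpret c: bracket_comparison n "model n x" B f by (rule cmp)
  have "f (model n x y z) = B (f y) (f z)" if "y \<in> V n" "z \<in> V n" for y z
    by (rule c.homomorphism[OF _ _ _ that]) (use one two_three two_five x in \<open>auto simp: c.defect_def\<close>)
  then have "lie_isomorphic n (model n x) B"
    unfolding lie_isomorphic_def using f.linear f.bij by blast
  then show thesis by (rule that)
qed

section \<open>Inner automorphisms\<close>

text \<open>
  \<open>D\<^sup>k / k!\<close>. With this normalisation the Leibniz rule has no binomial coefficients.
\<close>
fun divided_power :: "(('k::field) vect \<Rightarrow> 'k vect) \<Rightarrow> nat \<Rightarrow> 'k vect \<Rightarrow> 'k vect" where
  "divided_power D 0 x = x"
| "divided_power D (Suc k) x = (1 / of_nat (Suc k)) *\<^sub>V D (divided_power D k x)"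

context filtered_bracket
begin

lemma linear_divided_power:
  assumes "linear_map n D" shows "linear_map n (divided_power D k)"
proof (induction k)
  case 0
  have "divided_power D 0 = (\<lambda>x. x)" by (rule ext) simp
  then show ?case using linear_map_ident by (simp only:)
next
  case (Suc k)
  have "divided_power D (Suc k) = (\<lambda>x. (1 / of_nat (Suc k)) *\<^sub>V D (divided_power D k x))"
    by (rule ext) simp
  then show ?case using linear_map_smult[OF linear_map_comp[OF assms Suc]] by (simp only:)
qed

lemma divided_power_bracket:
  assumes D: "linear_map n D"
    and der: "\<And>x y. \<lbrakk>x \<in> V n; y \<in> V n\<rbrakk> \<Longrightarrow> D (B x y) = B (D x) y + B x (D y)"
    and xy: "x \<in> V n" "y \<in> V n"
  shows "divided_power D k (B x y) = (\<Sum>i\<le>k. B (divided_power D i x) (divided_power D (k - i) y))"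
proof (induction k)
  case (Suc k)
  define d where "d = divided_power D"
  have dV: "d i z \<in> V n" if "z \<in> V n" for i z
    using linear_map_V[OF linear_divided_power[OF D]] that by (simp add: d_def)
  have Dd: "D (d i z) = of_nat (Suc i) *\<^sub>V d (Suc i) z" for i z
    by (simp add: d_def fun_eq_iff del: of_nat_Suc)
  define g where "g i = B (d i x) (d (Suc k - i) y)" for i
  have "D (d k (B x y)) = D (\<Sum>i\<le>k. B (d i x) (d (k - i) y))"
    unfolding d_def by (rule arg_cong[OF Suc])
  also have "\<dots> = (\<Sum>i\<le>k. D (B (d i x) (d (k - i) y)))"
    by (rule linear_map_sum[OF D]) (auto intro: closed dV xy)
  also have "\<dots> = (\<Sum>i\<le>k. of_nat (Suc i) *\<^sub>V g (Suc i) + of_nat (Suc k - i) *\<^sub>V g i)"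
  proof (rule sum.cong[OF refl])
    fix i assume i: "i \<in> {..k}"
    have "D (B (d i x) (d (k - i) y)) = B (of_nat (Suc i) *\<^sub>V d (Suc i) x) (d (k - i) y)
        + B (d i x) (of_nat (Suc (k - i)) *\<^sub>V d (Suc (k - i)) y)"
      using der[OF dV dV] xy by (simp only: Dd)
    also have "\<dots> = of_nat (Suc i) *\<^sub>V B (d (Suc i) x) (d (k - i) y)
        + of_nat (Suc (k - i)) *\<^sub>V B (d i x) (d (Suc (k - i)) y)"
      by (simp only: linear_map_scale[OF left] linear_map_scale[OF right] dV xy)
    finally show "D (B (d i x) (d (k - i) y)) = of_nat (Suc i) *\<^sub>V g (Suc i) + of_nat (Suc k - i) *\<^sub>V g i"
      using i by (simp add: g_def Suc_diff_le)
  qed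
  also have "\<dots> = (\<Sum>i\<le>k. of_nat (Suc i) *\<^sub>V g (Suc i)) + (\<Sum>i\<le>k. of_nat (Suc k - i) *\<^sub>V g i)"
    by (rule sum.distrib)
  also have "(\<Sum>i\<le>k. of_nat (Suc i) *\<^sub>V g (Suc i)) = (\<Sum>i\<le>Suc k. of_nat i *\<^sub>V g i)"
    by (simp only: sum.atMost_Suc_shift of_nat_0 scale_zero_left add_0_left)
  also have "(\<Sum>i\<le>k. of_nat (Suc k - i) *\<^sub>V g i) = (\<Sum>i\<le>Suc k. of_nat (Suc k - i) *\<^sub>V g i)"
    by (simp only: sum.atMost_Suc diff_self_eq_0 of_nat_0 scale_zero_left add_0_right)
  also have "(\<Sum>i\<le>Suc k. of_nat i *\<^sub>V g i) + (\<Sum>i\<le>Suc k. of_nat (Suc k - i) *\<^sub>V g i)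
      = (\<Sum>i\<le>Suc k. of_nat (Suc k) *\<^sub>V g i)"
    unfolding sum.distrib[symmetric]
    by (intro sum.cong refl) (simp add: fun_eq_iff distrib_right[symmetric] of_nat_add[symmetric] del: of_nat_add of_nat_Suc)
  also have "\<dots> = of_nat (Suc k) *\<^sub>V (\<Sum>i\<le>Suc k. g i)"
    by (simp add: fun_eq_iff sum_distrib_left del: of_nat_Suc sum.atMost_Suc)
  finally have "d (Suc k) (B x y) = (\<Sum>i\<le>Suc k. g i)"
    by (simp add: d_def fun_eq_iff del: of_nat_Suc sum.atMost_Suc)
  then show ?case by (simp only: d_def g_def)
qed simp

text \<open>
  The exponential of \<open>\<tau> ad e\<^sub>l\<close>, a finite sum since the derivation is nilpotent. Only its first-order term is
  prescribed.
\<close>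
lemma inner_automorphism:
  assumes l: "1 \<le> l" "l \<le> n"
  obtains g where "linear_map n g" "\<And>x y. \<lbrakk>x \<in> V n; y \<in> V n\<rbrakk> \<Longrightarrow> g (B x y) = B (g x) (g y)"
    "\<And>a z. z \<in> Fil n a \<Longrightarrow> g z - z - \<tau> *\<^sub>V B (e l) z \<in> Fil n (a + 2 * l)"
proof
  define D where "D z = \<tau> *\<^sub>V B (e l) z" for z
  define d where "d = divided_power D"
  define g where "g x = (\<Sum>k\<le>n. d k x)" for x
  have el: "(e l :: 'k vect) \<in> V n" using l by simp
  have D: "linear_map n D"
    unfolding D_def by (rule linear_map_smult[OF right[OF el]])
  have der: "D (B x y) = B (D x) y + B x (D y)" if "x \<in> V n" "y \<in> V n" for x y
  proof -
    have "B x (B y (e l)) = - B x (B (e l) y)"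
      using that el skew[of "e l" y] linear_map_uminus[OF right] closed by simp
    moreover have "B y (B (e l) x) = - B (B (e l) x) y"
      using skew[of "B (e l) x" y] that el closed by simp
    ultimately have "B (e l) (B x y) = B (B (e l) x) y + B x (B (e l) y)"
      using jacobi[OF el that] by (simp add: add.assoc add_eq_0_iff2 diff_eq_eq)
    moreover have "B (D x) y = \<tau> *\<^sub>V B (B (e l) x) y" "B x (D y) = \<tau> *\<^sub>V B x (B (e l) y)"
      using that el closed linear_map_scale[OF left] linear_map_scale[OF right] by (auto simp: D_def)
    ultimately show ?thesis by (simp add: D_def fun_eq_iff algebra_simps)
  qed
  have D_Fil: "D z \<in> Fil n (a + l)" if "z \<in> Fil n a" for z a
    unfolding D_def add.commute[of a l] using l by (intro Fil_scale bracket_Fil Fil_e that) auto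
  have d_Fil: "d k z \<in> Fil n (a + k * l)" if "z \<in> Fil n a" for k z a
  proof (induction k)
    case (Suc k)
    have "D (d k z) \<in> Fil n (a + Suc k * l)"
      using D_Fil[OF Suc] by (simp add: ac_simps)
    then have "(1 / of_nat (Suc k)) *\<^sub>V D (d k z) \<in> Fil n (a + Suc k * l)"
      by (rule Fil_scale)
    then show ?case by (simp only: d_def divided_power.simps)
  qed (use that in \<open>simp add: d_def\<close>)
  have dV: "d k z \<in> V n" if "z \<in> V n" for k z
    using linear_map_V[OF linear_divided_power[OF D]] that by (simp add: d_def)
  show "linear_map n g"
    unfolding g_def d_def by (rule linear_map_summation) (rule linear_divided_power[OF D])
  show "g (B x y) = B (g x) (g y)" if xy: "x \<in> V n" "y \<in> V n" for x y
  proof -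
    define h where "h = (\<lambda>(i, j). B (d i x) (d j y))"
    have h0: "h (i, j) = 0" if "n < i + j" for i j
    proof -
      have "d i x \<in> Fil n i" "d j y \<in> Fil n j"
        using l by (auto intro!: Fil_mono[OF d_Fil[OF Fil_degree_0]] xy)
      from Fil_beyond[OF bracket_Fil[OF this]] that show ?thesis by (simp add: h_def)
    qed
    have "g (B x y) = (\<Sum>k\<le>n. \<Sum>i\<le>k. B (d i x) (d (k - i) y))"
      unfolding g_def d_def by (intro sum.cong refl divided_power_bracket[OF D der xy])
    also have "\<dots> = (\<Sum>p\<in>{(i, j). i + j \<le> n}. h p)"
      unfolding h_def by (rule sum.triangle_reindex_eq[symmetric])
    also have "\<dots> = (\<Sum>p\<in>{..n} \<times> {..n}. h p)"
      by (rule sum.mono_neutral_left) (use h0 in \<open>auto simp: not_le\<close>)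
    also have "\<dots> = (\<Sum>i\<le>n. \<Sum>j\<le>n. B (d i x) (d j y))"
      unfolding h_def by (rule sum.cartesian_product[symmetric])
    also have "\<dots> = (\<Sum>i\<le>n. B (d i x) (g y))"
      unfolding g_def by (intro sum.cong refl linear_map_sum[OF right, symmetric] dV xy)
    also have "\<dots> = B (g x) (g y)"
      unfolding g_def by (intro linear_map_sum[OF left, symmetric] dV xy V_sum)
    finally show ?thesis .
  qed
  show "g z - z - \<tau> *\<^sub>V B (e l) z \<in> Fil n (a + 2 * l)" if z: "z \<in> Fil n a" for a z
  proof -
    obtain m where m: "n = Suc m" using l by (metis One_nat_def Suc_le_D le_trans)
    have "g z - z - \<tau> *\<^sub>V B (e l) z = (\<Sum>k<m. d (Suc (Suc k)) z)"
      unfolding g_def m sum.atMost_Suc_shift lessThan_Suc_atMost[symmetric] sum.lessThan_Suc_shift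
      by (simp add: d_def D_def)
    also have "\<dots> \<in> Fil n (a + 2 * l)"
      by (intro Fil_sum Fil_mono[OF d_Fil[OF z]]) simp
    finally show ?thesis .
  qed
qed

end

section \<open>Isomorphisms between model brackets\<close>

definition homomorphism :: "nat \<Rightarrow> ('k::field) bimap \<Rightarrow> 'k bimap \<Rightarrow> ('k vect \<Rightarrow> 'k vect) \<Rightarrow> bool" where
  "homomorphism n B B' f \<longleftrightarrow> linear_map n f \<and> (\<forall>x\<in>V n. \<forall>y\<in>V n. f (B x y) = B' (f x) (f y))"

lemma homomorphismD:
  assumes "homomorphism n B B' f"
  shows "linear_map n f" "\<lbrakk>x \<in> V n; y \<in> V n\<rbrakk> \<Longrightarrow> f (B x y) = B' (f x) (f y)"
  using assms by (auto simp: homomorphism_def)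

lemma homomorphism_comp:
  fixes B B' B'' :: "('k::field) bimap"
  assumes "homomorphism n B B' f" "homomorphism n B' B'' g"
  shows "homomorphism n B B'' (\<lambda>x. g (f x))"
  unfolding homomorphism_def
proof (intro conjI ballI)
  show "linear_map n (\<lambda>x. g (f x))"
    by (rule linear_map_comp[OF homomorphismD(1)[OF assms(2)] homomorphismD(1)[OF assms(1)]])
  fix x y :: "'k vect" assume "x \<in> V n" "y \<in> V n"
  then show "g (f (B x y)) = B'' (g (f x)) (g (f y))"
    using homomorphismD[OF assms(1)] homomorphismD(2)[OF assms(2)] linear_map_V by metis
qed

lemma lie_isomorphic_iff:
  "lie_isomorphic n B B' \<longleftrightarrow> (\<exists>f. homomorphism n B B' f \<and> bij_betw f (V n) (V n))"
  by (auto simp: lie_isomorphic_def homomorphism_def)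

lemma homomorphism_model_chain:
  fixes x :: "'k::field_char_0 quint"
  assumes f: "homomorphism n (model n x) B f" and j: "15 \<le> n" "2 \<le> j" "j < n"
  shows "B (f (e 1)) (f (e j)) = of_nat (j - 1) *\<^sub>V f (e (Suc j))"
proof -
  have "B (f (e 1)) (f (e j)) = f (model n x (e 1) (e j))"
    using homomorphismD(2)[OF f, of "e 1" "e j"] j by simp
  also have "model n x (e 1) (e j) = of_nat (j - 1) *\<^sub>V e (Suc j)"
    using model_one[of n j x] j by simp
  also have "f (of_nat (j - 1) *\<^sub>V e (Suc j)) = of_nat (j - 1) *\<^sub>V f (e (Suc j))"
    by (rule linear_map_scaled_e[OF homomorphismD(1)[OF f]]) (use j in auto)
  finally show ?thesis .
qed

text \<open>
  Homomorphisms out of a model bracket are determined by the images of the two generators.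
\<close>
lemma homomorphism_model_generated:
  fixes x :: "'k::field_char_0 quint"
  assumes f: "homomorphism n (model n x) B f" and n: "15 \<le> n" and j: "1 \<le> j" "j \<le> n"
  shows "f (e j) = generated B (f (e 1)) (f (e 2)) j"
  using j
proof (induction j rule: less_induct)
  case (less j)
  consider "j = 1" | "j = 2" | i where "j = Suc (Suc (Suc i))"
    using less.prems by (metis One_nat_def Suc_1 Suc_le_D not0_implies_Suc)
  then show ?case
  proof cases
    case 3
    then have "generated B (f (e 1)) (f (e 2)) j = (1 / of_nat (Suc i)) *\<^sub>V B (f (e 1)) (f (e (Suc (Suc i))))"
      using less.IH[of "Suc (Suc i)"] less.prems by simp
    also have "\<dots> = f (e j)"
      using homomorphism_model_chain[OF f n, of "Suc (Suc i)"] less.prems 3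
      by (simp add: fun_eq_iff del: of_nat_Suc)
    finally show ?thesis by simp
  qed (use generated_12 in \<open>simp_all del: One_nat_def\<close>)
qed

lemma homomorphism_relation5:
  fixes x :: "'k::field_char_0 quint"
  assumes f: "homomorphism n (model n x) B f" and n: "15 \<le> n" and B: "filtered_bracket n B"
  shows "filtered_bracket.relation5 B (f (e 1)) (f (e 2)) = 0"
proof -
  have "B (f (e 2)) (f (e 3)) = f (e 5)"
    using homomorphismD(2)[OF f, of "e 2" "e 3"] model_two_three[OF n, of x] n by simp
  then show ?thesis
    using homomorphism_model_generated[OF f n, of 3] homomorphism_model_generated[OF f n, of 5] n
    by (simp add: filtered_bracket.relation5_def[OF B])
qed

lemma homomorphism_id: "homomorphism n B B (\<lambda>x. x)"
  by (simp add: homomorphism_def linear_map_ident)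

text \<open>
  The filtration is preserved from degree 3 on, because it is generated by brackets with \<open>e\<^sub>1\<close>. In degrees 1 and 2 the
  relation \<open>[e\<^sub>2, e\<^sub>3] = e\<^sub>5\<close> decides: it has no term in degree 4, so the image of \<open>e\<^sub>2\<close> has no component
  along \<open>e\<^sub>1\<close>, and its terms in degree 5 give the square.
\<close>
lemma isomorphism_diagonal:
  fixes x y :: "'k::field_char_0 quint"
  assumes n: "15 \<le> n" and f: "homomorphism n (model n x) (model n y) f" and bij: "bij_betw f (V n) (V n)"
  shows "\<exists>\<alpha>. \<alpha> \<noteq> 0 \<and> f (e 1) 1 = \<alpha> \<and> f (e 2) \<in> Fil n 2 \<and> f (e 2) 2 = \<alpha> ^ 2"
proof -
  interpret B: filtered_bracket n "model n y" by (rule filtered_model[OF n])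
  define F where "F j = f (e j)" for j
  have FV: "F j \<in> Fil n 1" if "1 \<le> j" "j \<le> n" for j
    unfolding F_def V_eq_Fil[symmetric] by (rule linear_map_V[OF homomorphismD(1)[OF f] V_e[OF that]])
  have chain: "F (Suc j) = (1 / of_nat (j - 1)) *\<^sub>V model n y (F 1) (F j)" if "2 \<le> j" "j < n" for j
    using homomorphism_model_chain[OF f n that] that by (simp add: F_def fun_eq_iff)
  have F3: "F 3 = model n y (F 1) (F 2)"
    using chain[of 2] n by (simp add: eval_nat_numeral)
  have F5: "F 5 = model n y (F 2) (F 3)"
    using homomorphismD(2)[OF f, of "e 2" "e 3"] model_two_three[OF n, of x] n by (simp add: F_def)
  have F3_Fil: "F 3 \<in> Fil n 3"
  proof -
    have "F 3 \<in> Fil n 2" using B.bracket_Fil[OF FV[of 1] FV[of 2]] n by (simp add: F3 numeral_2_eq_2)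
    moreover have "F 3 2 = 0" using B.bracket_lead[OF FV[of 1] FV[of 2]] n by (simp add: F3 numeral_2_eq_2)
    ultimately show ?thesis using Fil_Suc[of "F 3" n 2] by simp
  qed
  have up: "F j \<in> Fil n (j + d)" if "F 3 \<in> Fil n (3 + d)" "3 \<le> j" "j \<le> n" for j d
    using that(2,3)
  proof (induction j rule: dec_induct)
    case (step j)
    have "model n y (F 1) (F j) \<in> Fil n (Suc j + d)"
      using B.bracket_Fil[OF FV[of 1] step.IH] step.hyps step.prems by simp
    moreover have "F (Suc j) = (1 / of_nat (j - 1)) *\<^sub>V model n y (F 1) (F j)"
      by (rule chain) (use step in auto)
    ultimately show ?case by (simp only: Fil_scale)
  qed (use that in simp)
  have FF: "F j \<in> Fil n j" if "3 \<le> j" "j \<le> n" for j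
    using up[of 0 j] F3_Fil that by simp
  define \<alpha> \<Delta> where "\<alpha> = F 1 1" and "\<Delta> = F 3 3"
  have "\<Delta> \<noteq> 0"
  proof
    \<comment> \<open>Otherwise the image of \<open>e\<^sub>n\<close> would be pushed beyond the last degree.\<close>
    assume "\<Delta> = 0"
    then have "F 3 \<in> Fil n (3 + 1)" using Fil_Suc[OF F3_Fil] by (simp add: \<Delta>_def)
    from Fil_beyond[OF up[OF this, of n]] have "f (e n) = f 0"
      using n linear_map_0[OF homomorphismD(1)[OF f]] by (simp add: F_def)
    then have "e n = (0 :: 'k vect)"
      using bij n by (auto simp: bij_betw_def dest: inj_onD)
    from fun_cong[OF this, of n] show False by (simp add: e_apply)
  qed
  have F4: "F 4 4 = \<alpha> * \<Delta>"
    using chain[of 3] B.bracket_lead[OF FV[of 1] F3_Fil] n by (simp add: \<alpha>_def \<Delta>_def)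
  have F5_lead: "F 5 5 = \<alpha> ^ 2 * \<Delta>"
    using chain[of 4] B.bracket_lead[OF FV[of 1] FF[of 4]] F4 n
    by (simp add: \<alpha>_def power2_eq_square)
  have "F 5 4 = 2 * F 2 1 * \<Delta>"
    using B.bracket_lead[OF FV[of 2] F3_Fil] n by (simp add: F5 \<Delta>_def)
  moreover have "F 5 4 = 0" using Fil_below[OF FF[of 5], of 4] n by simp
  ultimately have "F 2 1 = 0" using \<open>\<Delta> \<noteq> 0\<close> by simp
  then have F2: "F 2 \<in> Fil n 2" using Fil_Suc[OF FV[of 2]] n by (simp add: numeral_2_eq_2)
  have "\<Delta> = \<alpha> * F 2 2"
    using B.bracket_lead[OF FV[of 1] F2] n by (simp add: F3 \<alpha>_def \<Delta>_def del: One_nat_def)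
  moreover have "F 5 5 = F 2 2 * \<Delta>"
    using B.bracket_lead[OF F2 F3_Fil] n by (simp add: F5 \<Delta>_def)
  ultimately have "\<alpha> \<noteq> 0" "F 2 2 = \<alpha> ^ 2"
    using F5_lead \<open>\<Delta> \<noteq> 0\<close> by auto
  then show ?thesis using F2 by (auto simp: F_def \<alpha>_def)
qed

definition dilation :: "'k::field \<Rightarrow> 'k vect \<Rightarrow> 'k vect" where
  "dilation \<alpha> x = (\<lambda>k. \<alpha> ^ k * x k)"

lemma dilation_e: "dilation \<alpha> (e k) = \<alpha> ^ k *\<^sub>V e k"
  by (auto simp: dilation_def e_apply fun_eq_iff)

lemma linear_dilation: "linear_map n (dilation \<alpha>)"
  by (auto simp: linear_map_def dilation_def V_def fun_eq_iff algebra_simps)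

lemma bij_dilation: assumes "\<alpha> \<noteq> 0" shows "bij_betw (dilation \<alpha>) (V n) (V n)"
  by (rule bij_betw_byWitness[where f' = "dilation (1 / \<alpha>)"])
    (use assms in \<open>auto simp: dilation_def V_def fun_eq_iff power_one_over\<close>)

lemma coordinate_rho:
  "s \<le> 4 \<Longrightarrow> coordinate (rho n \<alpha> x) s = \<alpha> ^ (n - 7 - s) * coordinate x s"
  by (cases x) (auto simp: numeral_eq_Suc le_Suc_eq)

lemma dilation_homomorphism:
  fixes x :: "'k::field_char_0 quint"
  assumes n: "15 \<le> n"
  shows "homomorphism n (model n x) (model n (rho n \<alpha> x)) (dilation \<alpha>)"
  unfolding homomorphism_def
proof (intro conjI ballI)
  show "linear_map n (dilation \<alpha>)" by (rule linear_dilation)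
  interpret B: filtered_bracket n "model n x" by (rule filtered_model[OF n])
  interpret B': filtered_bracket n "model n (rho n \<alpha> x)" by (rule filtered_model[OF n])
  let ?d = "dilation \<alpha> :: 'k vect \<Rightarrow> 'k vect"
  note dV = linear_map_V[OF linear_dilation]
  have 1: "bilinear_map n (\<lambda>u v. ?d (model n x u v))"
    unfolding bilinear_map_def
    by (intro conjI ballI linear_map_comp[OF linear_dilation] B.left B.right)
  have 2: "bilinear_map n (\<lambda>u v. model n (rho n \<alpha> x) (?d u) (?d v))"
    unfolding bilinear_map_def
    by (intro conjI ballI linear_map_comp[OF B'.left linear_dilation] linear_map_comp[OF B'.right linear_dilation] dV)
  fix u v :: "'k vect" assume "u \<in> V n" "v \<in> V n"
  then show "?d (model n x u v) = model n (rho n \<alpha> x) (?d u) (?d v)"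
  proof (rule bilinear_eqI[OF 1 2, rotated])
    fix i j assume ij: "1 \<le> i" "i \<le> n" "1 \<le> j" "j \<le> n"
    have "model n (rho n \<alpha> x) (?d (e i)) (?d (e j)) = \<alpha> ^ (i + j) *\<^sub>V model n (rho n \<alpha> x) (e i) (e j)"
      using linear_map_scale[OF B'.left, of "\<alpha> ^ j *\<^sub>V e j" "e i" "\<alpha> ^ i"]
        linear_map_scale[OF B'.right, of "e i" "e j" "\<alpha> ^ j"] ij
      by (simp add: dilation_e power_add fun_eq_iff)
    also have "\<dots> = ?d (model n x (e i) (e j))"
    proof (rule ext)
      fix k
      have "Psi n (rho n \<alpha> x) (e i) (e j) k * \<alpha> ^ (i + j) = \<alpha> ^ k * Psi n x (e i) (e j) k"
      proof -
        have "(if i + j \<le> 7 + s then (coordinate (rho n \<alpha> x) s * cochain (n - s) i j) *\<^sub>V e (i + j + (n - 7 - s))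
              else 0) k * \<alpha> ^ (i + j)
            = \<alpha> ^ k * (if i + j \<le> 7 + s then (coordinate x s * cochain (n - s) i j) *\<^sub>V e (i + j + (n - 7 - s))
              else 0) k" if "s \<le> 4" for s
          unfolding coordinate_rho[OF that]
          by (cases "k = i + j + (n - 7 - s)") (simp_all add: e_apply power_add del: diff_diff_left)
        moreover have "11 \<le> n" using n by simp
        ultimately show ?thesis
          by (simp only: Psi_e sum_apply sum_distrib_left sum_distrib_right) (intro sum.cong refl, simp)
      qed
      then show "(\<alpha> ^ (i + j) *\<^sub>V model n (rho n \<alpha> x) (e i) (e j)) k = ?d (model n x (e i) (e j)) k"
        using ij by (simp add: model_def Vbracket_e dilation_def e_apply algebra_simps)
    qed
    finally show "?d (model n x (e i) (e j)) = model n (rho n \<alpha> x) (?d (e i)) (?d (e j))" by simp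
  qed
qed

lemma adapted_e: "2 \<le> n \<Longrightarrow> adapted n (e 1) (e 2)"
  by (auto simp: adapted_def e_apply intro!: Fil_e)

text \<open>
  Let \<open>f\<close> differ from the identity on the generators in degree \<open>l\<close>, by \<open>t\<close> and \<open>s\<close>. Since both pairs of
  generators satisfy the first relation, \<open>relation5_change\<close> gives \<open>(l - 2) t = (l - 1) s\<close>, so \<open>(t, s)\<close> equals
  \<open>(s - t) (1 - l, 2 - l)\<close>, and the inner automorphism with factor \<open>t - s\<close> along \<open>e\<^sub>l\<close> removes the
  difference in this degree. Beyond \<open>l = n - 5\<close> the relation is out of range, but then the difference is
  invisible on \<open>e\<^sub>5\<close> and in the bracket with it.
\<close>
theorem unipotent_rigidity:
  fixes x y :: "'k::field_char_0 quint"
  assumes n: "15 \<le> n" and f: "homomorphism n (model n x) (model n y) f"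
    and ad: "adapted n (f (e 1)) (f (e 2))"
  shows "x = y"
proof -
  interpret B: filtered_bracket n "model n y" by (rule filtered_model[OF n])
  have e12: "adapted n (e 1) (e 2 :: 'k vect)" by (rule adapted_e) (use n in simp)
  have gen_e: "generated (model n y) (e 1) (e 2) j = e j" if "1 \<le> j" "j \<le> n" for j
    using homomorphism_model_generated[OF homomorphism_id[of n "model n y"] n that] by simp
  have rel_e: "B.relation5 (e 1) (e 2) = 0"
    using homomorphism_relation5[OF homomorphism_id[of n "model n y"] n B.filtered_bracket_axioms] by simp
  have "l + 4 \<le> n \<Longrightarrow> \<exists>f. homomorphism n (model n x) (model n y) f \<and> adapted n (f (e 1)) (f (e 2))
    \<and> f (e 1) - e 1 \<in> Fil n (1 + l) \<and> f (e 2) - e 2 \<in> Fil n (2 + l)" if "1 \<le> l" for l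
    using that
  proof (induction l rule: dec_induct)
    case base
    have "f (e 1) - e 1 \<in> Fil n (Suc 1)" "f (e 2) - e 2 \<in> Fil n (Suc 2)"
      by (rule Fil_Suc; use ad e12 in \<open>auto simp: adapted_def intro: Fil_diff\<close>)+
    then have "f (e 1) - e 1 \<in> Fil n (1 + 1)" "f (e 2) - e 2 \<in> Fil n (2 + 1)"
      by (simp_all add: eval_nat_numeral)
    then show ?case using f ad by blast
  next
    case (step l)
    then have "l + 4 \<le> n" by simp
    from step.IH[OF this] obtain f where f: "homomorphism n (model n x) (model n y) f" and ad: "adapted n (f (e 1)) (f (e 2))"
      and d: "f (e 1) - e 1 \<in> Fil n (1 + l)" "f (e 2) - e 2 \<in> Fil n (2 + l)"
      by blast
    have l: "1 \<le> l" "5 + l \<le> n" using step by auto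
    define t s where "t = (f (e 1) - e 1) (1 + l)" and "s = (f (e 2) - e 2) (2 + l)"
    have "(of_nat l ^ 2 + of_nat l + 6) * ((of_nat l - 2) * t - (of_nat l - 1) * s) = 0"
      using B.relation5_change(2)[OF e12 l(1) d l(2)] rel_e
        homomorphism_relation5[OF f n B.filtered_bracket_axioms]
      by (simp add: t_def s_def)
    then have ts: "(of_nat l - 2) * t = (of_nat l - 1) * s"
      using B.degree_factor_nonzero[of l] by simp
    obtain g where g: "linear_map n g"
        "\<And>x z. \<lbrakk>x \<in> V n; z \<in> V n\<rbrakk> \<Longrightarrow> g (model n y x z) = model n y (g x) (g z)"
      and g_lead: "\<And>a z. z \<in> Fil n a \<Longrightarrow> g z - z - (t - s) *\<^sub>V model n y (e l) z \<in> Fil n (a + 2 * l)"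
      using B.inner_automorphism[of l "t - s"] l by auto
    define h where "h z = g (f z)" for z
    have h: "homomorphism n (model n x) (model n y) h"
      unfolding h_def by (rule homomorphism_comp[OF f]) (use g in \<open>simp add: homomorphism_def\<close>)
    have el: "(e l :: 'k vect) \<in> Fil n l" by (rule Fil_e) (use l in auto)
    have better: "h (e i) - e i \<in> Fil n (i + Suc l)"
      if i: "1 \<le> i" "f (e i) \<in> Fil n i" "f (e i) i = 1" "f (e i) - e i \<in> Fil n (i + l)" "i + l \<le> n"
        and zero: "(f (e i) - e i) (i + l) + (t - s) * (of_nat i - of_nat l) = 0" for i
    proof -
      define z where "z = f (e i)"
      define w where "w = (z - e i) + (t - s) *\<^sub>V model n y (e l) z"
      have m: "model n y (e l) z \<in> Fil n (i + l)" "model n y (e l) z (i + l) = of_nat i - of_nat l"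
        using B.bracket_Fil[OF el i(2)] B.bracket_lead[OF el i(2)] i
        by (auto simp: z_def add.commute e_apply)
      have "w \<in> Fil n (i + l)" "w (i + l) = 0"
        using m zero i(4) by (auto simp: w_def z_def intro!: Fil_add Fil_scale)
      then have "w \<in> Fil n (i + Suc l)" using Fil_Suc[of w n "i + l"] by simp
      moreover have "g z - z - (t - s) *\<^sub>V model n y (e l) z \<in> Fil n (i + Suc l)"
        using g_lead[OF i(2)] l(1) unfolding z_def by (auto elim!: Fil_mono)
      ultimately have "(g z - z - (t - s) *\<^sub>V model n y (e l) z) + w \<in> Fil n (i + Suc l)"
        by (intro Fil_add)
      moreover have "(g z - z - (t - s) *\<^sub>V model n y (e l) z) + w = h (e i) - e i"
        by (simp add: w_def h_def z_def)
      ultimately show ?thesis by simp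
    qed
    have z1: "(f (e 1) - e 1) (1 + l) + (t - s) * (of_nat 1 - of_nat l) = 0"
      and z2: "(f (e 2) - e 2) (2 + l) + (t - s) * (of_nat 2 - of_nat l) = 0"
      unfolding t_def[symmetric] s_def[symmetric] using ts by (simp_all add: algebra_simps)
    have h1: "h (e 1) - e 1 \<in> Fil n (1 + Suc l)"
      by (rule better[OF _ _ _ d(1) _ z1]) (use ad l in \<open>auto simp: adapted_def\<close>)
    moreover have h2: "h (e 2) - e 2 \<in> Fil n (2 + Suc l)"
      by (rule better[OF _ _ _ d(2) _ z2]) (use ad l in \<open>auto simp: adapted_def\<close>)
    moreover have "adapted n (h (e 1)) (h (e 2))"
    proof -
      have "e 1 + (h (e 1) - e 1) \<in> Fil n 1" "e 2 + (h (e 2) - e 2) \<in> Fil n 2"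
        by (rule Fil_add; use e12 Fil_mono[OF h1, of 1] Fil_mono[OF h2, of 2] in \<open>simp add: adapted_def\<close>)+
      moreover have "(h (e 1) - e 1) 1 = 0" "(h (e 2) - e 2) 2 = 0"
        using Fil_below[OF h1, of 1] Fil_below[OF h2, of 2] by auto
      ultimately show ?thesis using e12 by (simp add: adapted_def)
    qed
    ultimately show ?case using h by blast
  qed
  moreover have "1 \<le> n - 4" "n - 4 + 4 \<le> n" using n by simp_all
  ultimately obtain f where f: "homomorphism n (model n x) (model n y) f"
    and ad: "adapted n (f (e 1)) (f (e 2))"
    and d: "f (e 1) - e 1 \<in> Fil n (1 + (n - 4))" "f (e 2) - e 2 \<in> Fil n (2 + (n - 4))"
    by blast
  have fixed: "f (e j) = e j" if "5 \<le> j" "j \<le> n" for j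
  proof -
    have "f (e j) - e j \<in> Fil n (j + (n - 4))"
      using B.generated_change[OF e12 _ d, of j] gen_e[of j] homomorphism_model_generated[OF f n, of j] that n
      by simp
    from Fil_beyond[OF this] that n show ?thesis by simp
  qed
  have lin: "linear_map n f" using homomorphismD[OF f] by simp
  have "f w = w" if "w \<in> Fil n 5" for w
  proof -
    have wV: "w \<in> V n" by (rule Fil_V[OF that])
    have "f w = (\<Sum>i=1..n. w i *\<^sub>V f (e i))" by (rule linear_map_expand[OF lin wV])
    also have "\<dots> = (\<Sum>i=1..n. w i *\<^sub>V e i)"
    proof (rule sum.cong[OF refl])
      fix i assume "i \<in> {1..n}"
      then show "w i *\<^sub>V f (e i) = w i *\<^sub>V e i"
        using fixed[of i] Fil_below[OF that, of i] by (cases "5 \<le> i") auto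
    qed
    finally show ?thesis using V_expand[OF wV] by simp
  qed
  moreover have "3 *\<^sub>V e 7 + tail n x \<in> Fil n 5"
    using tail_Fil[of n x] n by (auto intro!: Fil_add Fil_scale Fil_e elim!: Fil_mono)
  ultimately have "f (model n x (e 2) (e 5)) = 3 *\<^sub>V e 7 + tail n x"
    using model_two_five[OF n, of x] by simp
  moreover have "f (model n x (e 2) (e 5)) = model n y (f (e 2)) (e 5)"
    using homomorphismD(2)[OF f, of "e 2" "e 5"] fixed[of 5] n by simp
  moreover have "model n y (f (e 2)) (e 5) = model n y (e 2) (e 5)"
  proof -
    have e2: "(e 2 :: 'k vect) \<in> V n" and e5: "(e 5 :: 'k vect) \<in> Fil n 5"
      using n by (auto intro!: Fil_e)
    have "model n y (f (e 2) - e 2) (e 5) = 0"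
      using Fil_beyond[OF B.bracket_Fil[OF d(2) e5]] n by simp
    then show ?thesis
      using linear_map_diff[OF B.left, of "e 5" "f (e 2)" "e 2"] linear_map_V[OF lin e2] e2 Fil_V[OF e5] by simp
  qed
  ultimately have "tail n x = tail n y" using model_two_five[OF n, of y] by simp
  then show ?thesis using tail_inj[of n x y] n by simp
qed

lemma rho_mult: "rho n \<alpha> (rho n \<beta> x) = rho n (\<alpha> * \<beta>) x"
  by (cases x) (simp add: power_mult_distrib)

lemma rho_one: "rho n 1 x = x"
  by (cases x) simp

text \<open>
  The dilation by \<open>1 / \<alpha>\<close> turns an isomorphism with diagonal \<open>\<alpha>, \<alpha>\<^sup>2\<close> into a unipotent one that starts at the
  model with parameters \<open>rho n \<alpha> x\<close>.
\<close>
theorem model_isomorphic_iff: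
  fixes x y :: "'k::field_char_0 quint"
  assumes n: "15 \<le> n"
  shows "lie_isomorphic n (model n x) (model n y) \<longleftrightarrow> (\<exists>\<alpha>. \<alpha> \<noteq> 0 \<and> y = rho n \<alpha> x)"
proof
  assume "\<exists>\<alpha>. \<alpha> \<noteq> 0 \<and> y = rho n \<alpha> x"
  then show "lie_isomorphic n (model n x) (model n y)"
    using dilation_homomorphism[OF n] bij_dilation unfolding lie_isomorphic_iff by blast
next
  assume "lie_isomorphic n (model n x) (model n y)"
  then obtain f where f: "homomorphism n (model n x) (model n y) f" and bij: "bij_betw f (V n) (V n)"
    by (auto simp: lie_isomorphic_iff)
  obtain \<alpha> where \<alpha>: "\<alpha> \<noteq> 0" "f (e 1) 1 = \<alpha>" "f (e 2) \<in> Fil n 2" "f (e 2) 2 = \<alpha> ^ 2"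
    using isomorphism_diagonal[OF n f bij] by blast
  define h where "h z = f (dilation (1 / \<alpha>) z)" for z
  have "homomorphism n (model n (rho n \<alpha> x)) (model n (rho n (1 / \<alpha>) (rho n \<alpha> x))) (dilation (1 / \<alpha>))"
    by (rule dilation_homomorphism[OF n])
  then have "homomorphism n (model n (rho n \<alpha> x)) (model n x) (dilation (1 / \<alpha>))"
    using \<alpha>(1) by (simp add: rho_mult rho_one)
  then have h: "homomorphism n (model n (rho n \<alpha> x)) (model n y) h"
    unfolding h_def by (rule homomorphism_comp[OF _ f])
  have lin: "linear_map n f" using homomorphismD[OF f] by simp
  have he: "h (e 1) = (1 / \<alpha>) *\<^sub>V f (e 1)" "h (e 2) = (1 / \<alpha> ^ 2) *\<^sub>V f (e 2)"
    using linear_map_scaled_e[OF lin, of 1] linear_map_scaled_e[OF lin, of 2] n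
    by (simp_all add: h_def dilation_e power_one_over)
  have "f (e 1) \<in> Fil n 1"
    unfolding V_eq_Fil[symmetric] by (rule linear_map_V[OF lin]) (use n in auto)
  then have "adapted n (h (e 1)) (h (e 2))"
    unfolding adapted_def he using \<alpha> by (intro conjI Fil_scale) auto
  then have "rho n \<alpha> x = y" by (rule unipotent_rigidity[OF n h])
  then show "\<exists>\<alpha>. \<alpha> \<noteq> 0 \<and> y = rho n \<alpha> x" using \<alpha>(1) by blast
qed

section \<open>The moduli space\<close>

lemma lie_isomorphic_refl: "lie_isomorphic n B B"
  unfolding lie_isomorphic_iff using homomorphism_id bij_betw_id[unfolded id_def] by blast

lemma lie_isomorphic_trans:
  assumes "lie_isomorphic n B B'" "lie_isomorphic n B' B''" shows "lie_isomorphic n B B''"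
proof -
  obtain f g where "homomorphism n B B' f" "bij_betw f (V n) (V n)"
    "homomorphism n B' B'' g" "bij_betw g (V n) (V n)"
    using assms by (auto simp: lie_isomorphic_iff)
  then show ?thesis
    unfolding lie_isomorphic_iff
    using homomorphism_comp bij_betw_trans[unfolded comp_def] by blast
qed

lemma lie_isomorphic_sym:
  assumes "bilinear_map n B" "lie_isomorphic n B B'" shows "lie_isomorphic n B' B"
proof -
  obtain f where f: "homomorphism n B B' f" and bij: "bij_betw f (V n) (V n)"
    using assms by (auto simp: lie_isomorphic_iff)
  note lin = homomorphismD(1)[OF f]
  define g where "g = the_inv_into (V n) f"
  have g: "bij_betw g (V n) (V n)" unfolding g_def by (rule bij_betw_the_inv_into[OF bij])
  have gV: "g z \<in> V n" and fg: "f (g z) = z" if "z \<in> V n" for z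
    using g that f_the_inv_into_f_bij_betw[OF bij, of z] by (auto simp: g_def bij_betw_def)
  have gf: "g (f z) = z" if "z \<in> V n" for z
    using that bij the_inv_into_f_f[of f "V n" z] by (auto simp: g_def bij_betw_def)
  have "homomorphism n B' B g"
    unfolding homomorphism_def linear_map_def
  proof (intro conjI ballI allI)
    fix u v :: "'a vect" assume u: "u \<in> V n" and v: "v \<in> V n"
    show "g u \<in> V n" by (rule gV[OF u])
    show "g (u + v) = g u + g v"
      using gf[of "g u + g v"] linear_map_add[OF lin gV[OF u] gV[OF v]] fg u v gV by simp
    show "g (c *\<^sub>V u) = c *\<^sub>V g u" for c
      using gf[of "c *\<^sub>V g u"] linear_map_scale[OF lin gV[OF u]] fg u gV by simp
    show "g (B' u v) = B (g u) (g v)"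
      using gf[of "B (g u) (g v)"] homomorphismD(2)[OF f gV[OF u] gV[OF v]] fg[OF u] fg[OF v]
        bilinear_V[OF assms(1) gV[OF u] gV[OF v]] by simp
  qed
  then show ?thesis using g by (auto simp: lie_isomorphic_iff)
qed

lemma equiv_iso_rel: "equiv (deformed_brackets n) (iso_rel n :: ('k::field_char_0 bimap \<times> 'k bimap) set)"
proof (rule equivI)
  show "refl_on (deformed_brackets n) (iso_rel n :: ('k bimap \<times> 'k bimap) set)"
    by (auto simp: refl_on_def iso_rel_def lie_isomorphic_refl)
  show "sym (iso_rel n :: ('k bimap \<times> 'k bimap) set)"
    by (auto simp: sym_def iso_rel_def intro: lie_isomorphic_sym
        filtered_bracket.bilinear[OF deformed_is_filtered])
  show "trans (iso_rel n :: ('k bimap \<times> 'k bimap) set)"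
    by (auto simp: trans_def iso_rel_def intro: lie_isomorphic_trans)
qed (auto simp: iso_rel_def)

lemma orbit_eq_iff: "orbit n x = orbit n y \<longleftrightarrow> (\<exists>\<alpha>. \<alpha> \<noteq> 0 \<and> y = rho n \<alpha> x)"
proof
  have "y \<in> orbit n y" unfolding orbit_def mem_Collect_eq by (intro exI[of _ 1]) (simp add: rho_one)
  moreover assume "orbit n x = orbit n y"
  ultimately show "\<exists>\<alpha>. \<alpha> \<noteq> 0 \<and> y = rho n \<alpha> x" by (auto simp: orbit_def)
next
  assume "\<exists>\<alpha>. \<alpha> \<noteq> 0 \<and> y = rho n \<alpha> x"
  then obtain \<alpha> where \<alpha>: "\<alpha> \<noteq> 0" "y = rho n \<alpha> x" by blast
  have 1: "rho n \<beta> y = rho n (\<beta> * \<alpha>) x" and 2: "rho n \<beta> x = rho n (\<beta> / \<alpha>) y" for \<beta>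
    using \<alpha> by (simp_all add: rho_mult)
  show "orbit n x = orbit n y"
  proof
    show "orbit n x \<subseteq> orbit n y"
      unfolding orbit_def using \<alpha>(1) by (auto simp: 2 simp del: rho.simps intro: exI[of _ "_ / \<alpha>"])
    show "orbit n y \<subseteq> orbit n x"
      unfolding orbit_def using \<alpha>(1) by (auto simp: 1 simp del: rho.simps intro: exI[of _ "_ * \<alpha>"])
  qed
qed

theorem theorem7p9:
  fixes n :: nat
  assumes "n \<ge> 16"
  shows "\<exists>\<Phi> :: ('k::field_char_0) quint set \<Rightarrow> 'k bimap set.
           bij_betw \<Phi> (orbit_space n) (moduli_space n) \<and>
           (\<forall>x. filtered_deformation n (Psi n x) \<and>
                \<Phi> (orbit n x) = iso_rel n `` {Vbracket n + Psi n x})"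
proof -
  have n: "15 \<le> n" using assms by simp
  define class_of where "class_of x = iso_rel n `` {model n x}" for x :: "'k quint"
  define \<Phi> where "\<Phi> A = class_of (SOME x. orbit n x = A)" for A :: "'k quint set"
  have def: "filtered_deformation n (Psi n x)" for x :: "'k quint"
    by (rule filtered_deformation_Psi[OF n])
  then have model: "model n x \<in> deformed_brackets n" for x :: "'k quint"
    by (auto simp: deformed_brackets_def model_def)
  have class_eq: "class_of x = class_of y \<longleftrightarrow> orbit n x = orbit n y" for x y
    unfolding class_of_def eq_equiv_class_iff[OF equiv_iso_rel model model] orbit_eq_iff
      model_isomorphic_iff[OF n, symmetric]
    using model by (simp add: iso_rel_def)
  have \<Phi>: "\<Phi> (orbit n x) = class_of x" for x
  proof -
    have "orbit n (SOME y. orbit n y = orbit n x) = orbit n x" by (rule someI) (rule refl)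
    then show ?thesis unfolding \<Phi>_def class_eq .
  qed
  have "bij_betw \<Phi> (orbit_space n) (moduli_space n)"
    unfolding bij_betw_def
  proof
    show "inj_on \<Phi> (orbit_space n)"
      by (rule inj_onI) (auto simp: orbit_space_def \<Phi> class_eq)
    show "\<Phi> ` orbit_space n = moduli_space n"
    proof
      show "\<Phi> ` orbit_space n \<subseteq> moduli_space n"
        using quotientI[OF model] unfolding orbit_space_def moduli_space_def image_image \<Phi> class_of_def by blast
      show "moduli_space n \<subseteq> \<Phi> ` orbit_space n"
      proof
        fix C :: "'k bimap set" assume "C \<in> moduli_space n"
        then obtain B where B: "B \<in> deformed_brackets n" "C = iso_rel n `` {B}"
          by (auto simp: moduli_space_def elim: quotientE)
        obtain x where "lie_isomorphic n (model n x) B"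
          using normal_form[OF assms deformed_is_filtered[OF B(1)]] .
        then have "(model n x, B) \<in> iso_rel n" using B(1) model by (simp add: iso_rel_def)
        then have "class_of x = C"
          unfolding class_of_def B(2) by (rule equiv_class_eq[OF equiv_iso_rel])
        then show "C \<in> \<Phi> ` orbit_space n"
          unfolding orbit_space_def using \<Phi>[of x] by blast
      qed
    qed
  qed
  then show ?thesis
    using def \<Phi> unfolding class_of_def model_def by blast
qed

end
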